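(* The shortest (nontrivial) semigroup identities satisfied by $\mathcal{UT}_3(\mathbb{T})$ have length $22$. Up to exchanging the roles of $a$ and $b$ and reversing the words, these are exactly the following ten identities over the alphabet $\{a,b\}$ (spaces are only for readability): 1. $abbaabba\;ab\;baababbbbaba \sim_3 abbaabba\;ba\;baababbbbaba$ 2. $abbabaabab\;ab\;babaababba \sim_3 abbabaabab\;ba\;babaababba$ 3. $ababbabaab\;ab\;baababbaba \sim_3 ababbabaab\;ba\;baababbaba$ 4. $abbabaabab\;ab\;ababbabaab \sim_3 abbabaabab\;ba\;ababbabaab$ 5. $ababbabaab\;ab\;ababbabaab \sim_3 ababbabaab\;ba\;ababbabaab$ 6. $abbaabbaba\;ab\;baababbaba \sim_3 abbaabbaba\;ba\;baababbaba$ 7. $abbaabbaba\;ab\;babaabbaab \sim_3 abbaabbaba\;ba\;babaabbaab$ 8. $ababbabaab\;ab\;abbabaabab \sim_3 ababbabaab\;ba\;abbabaabab$ 9. $ababbabaab\;ab\;babaababba \sim_3 ababbabaab\;ba\;babaababba$ 10. $abbaabbaba\;ab\;babaababba \sim_3 abbaabbaba\;ba\;babaababba$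
   Context: Let $\mathbb{T}=(\mathbb{R}\cup\{-\infty\},\oplus,\odot)$ be the tropical semifield, $x\oplus y=\max(x,y)$, $x\odot y=x+y$. $\mathcal{UT}_n(\mathbb{T})$ is the semigroup, under tropical matrix multiplication, of all $n\times n$ matrices $M$ over $\mathbb{T}$ with $M_{ij}=-\infty$ whenever $i>j$. For words $w,v\in\Sigma^+$ (the free semigroup on a finite alphabet $\Sigma$), $w\sim_n v$ means that $\varphi(w)=\varphi(v)$ for every semigroup morphism $\varphi:\Sigma^+\to\mathcal{UT}_n(\mathbb{T})$; such a pair is called an identity for $\mathcal{UT}_n(\mathbb{T})$, nontrivial if $w\neq v$. Identities are regarded as unordered pairs $\{w,v\}$; the two sides of an identity for $\mathcal{UT}_n(\mathbb{T})$ ($n\ge2$) necessarily have the same number of occurrences of each letter, and the length of the identity is the common length of the two words. Reversing an identity means reversing both words (reading them right to left), and exchanging the roles of $a$ and $b$ means applying the letter swap $a\leftrightarrow b$ to both words. For identities of shortest length it suffices to consider words over a two letter alphabet. *)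

theory Defs
  imports "Jordan_Normal_Form.Matrix"
begin

datatype trop = MInfty | Fin real

instantiation trop :: comm_semiring_1
begin

definition zero_trop :: trop where "0 = MInfty"

definition one_trop :: trop where "1 = Fin 0"

text \<open>The overloaded sum and product are the tropical ones: maximum and real addition, with
  \<open>MInfty\<close> (minus infinity) as zero. Hence the library's matrix product on \<^typ>\<open>trop mat\<close> is the
  tropical one.\<close>

fun plus_trop :: "trop \<Rightarrow> trop \<Rightarrow> trop" where
  "MInfty + y = y"
| "x + MInfty = x"
| "Fin x + Fin y = Fin (max x y)"

fun times_trop :: "trop \<Rightarrow> trop \<Rightarrow> trop" where
  "Fin x * Fin y = Fin (x + y)"
| "_ * _ = MInfty"

instance
proof
  fix a b c :: trop
  show "a + b + c = a + (b + c)" by (cases a; cases b; cases c) auto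
  show "a + b = b + a" by (cases a; cases b) auto
  show "0 + a = a" by (simp add: zero_trop_def)
  show "a * b * c = a * (b * c)" by (cases a; cases b; cases c) auto
  show "a * b = b * a" by (cases a; cases b) auto
  show "1 * a = a" by (cases a) (auto simp: one_trop_def)
  show "(a + b) * c = a * c + b * c" by (cases a; cases b; cases c) auto
  show "0 * a = 0" by (cases a) (auto simp: zero_trop_def)
  show "a * 0 = 0" by (cases a) (auto simp: zero_trop_def)
  show "(0::trop) \<noteq> 1" by (simp add: zero_trop_def one_trop_def)
qed

end

definition UT :: "nat \<Rightarrow> trop mat set" where
  "UT n = {M \<in> carrier_mat n n. upper_triangular M}"

definition free_semigroup :: "'c set \<Rightarrow> 'c list set" where
  "free_semigroup \<Sigma> = lists \<Sigma> - {[]}"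

definition UT_morphisms :: "'c set \<Rightarrow> nat \<Rightarrow> ('c list \<Rightarrow> trop mat) set" where
  "UT_morphisms \<Sigma> n = {\<phi>. \<phi> \<in> free_semigroup \<Sigma> \<rightarrow> UT n \<and>
     (\<forall>u\<in>free_semigroup \<Sigma>. \<forall>v\<in>free_semigroup \<Sigma>. \<phi> (u @ v) = \<phi> u * \<phi> v)}"

definition sim :: "'c set \<Rightarrow> nat \<Rightarrow> 'c list \<Rightarrow> 'c list \<Rightarrow> bool" where
  "sim \<Sigma> n w v \<longleftrightarrow> w \<in> free_semigroup \<Sigma> \<and> v \<in> free_semigroup \<Sigma> \<and>
     (\<forall>\<phi>\<in>UT_morphisms \<Sigma> n. \<phi> w = \<phi> v)"

definition nontrivial_identities :: "'c set \<Rightarrow> nat \<Rightarrow> 'c list set set" where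
  "nontrivial_identities \<Sigma> n = {{w, v} | w v. sim \<Sigma> n w v \<and> w \<noteq> v}"

text \<open>The common length of the two sides; a pair with sides of different lengths has none.\<close>

definition has_length :: "'c list set \<Rightarrow> nat \<Rightarrow> bool" where
  "has_length P l \<longleftrightarrow> (\<forall>w\<in>P. length w = l)"

definition shortest_identities :: "'c set \<Rightarrow> nat \<Rightarrow> 'c list set set" where
  "shortest_identities \<Sigma> n = {P \<in> nontrivial_identities \<Sigma> n.
     \<exists>l. has_length P l \<and> (\<forall>Q\<in>nontrivial_identities \<Sigma> n. \<forall>k. has_length Q k \<longrightarrow> l \<le> k)}"

definition AB :: "char set" where
  "AB = {CHR ''a'', CHR ''b''}"

definition exchange :: "string set \<Rightarrow> string set" where
  "exchange P = map (id(CHR ''a'' := CHR ''b'', CHR ''b'' := CHR ''a'')) ` P"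

definition reversal :: "'c list set \<Rightarrow> 'c list set" where
  "reversal P = rev ` P"

text \<open>The two symmetries are commuting involutions, so these four sets form the whole orbit
  of an identity.\<close>

definition same_up_to_symmetry :: "string set \<Rightarrow> string set \<Rightarrow> bool" where
  "same_up_to_symmetry P Q \<longleftrightarrow> P \<in> {Q, exchange Q, reversal Q, exchange (reversal Q)}"

definition ten_identities :: "string set list" where
  "ten_identities =
    [{''abbaabba'' @ ''ab'' @ ''baababbbbaba'', ''abbaabba'' @ ''ba'' @ ''baababbbbaba''},
     {''abbabaabab'' @ ''ab'' @ ''babaababba'', ''abbabaabab'' @ ''ba'' @ ''babaababba''},
     {''ababbabaab'' @ ''ab'' @ ''baababbaba'', ''ababbabaab'' @ ''ba'' @ ''baababbaba''},
     {''abbabaabab'' @ ''ab'' @ ''ababbabaab'', ''abbabaabab'' @ ''ba'' @ ''ababbabaab''},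
     {''ababbabaab'' @ ''ab'' @ ''ababbabaab'', ''ababbabaab'' @ ''ba'' @ ''ababbabaab''},
     {''abbaabbaba'' @ ''ab'' @ ''baababbaba'', ''abbaabbaba'' @ ''ba'' @ ''baababbaba''},
     {''abbaabbaba'' @ ''ab'' @ ''babaabbaab'', ''abbaabbaba'' @ ''ba'' @ ''babaabbaab''},
     {''ababbabaab'' @ ''ab'' @ ''abbabaabab'', ''ababbabaab'' @ ''ba'' @ ''abbabaabab''},
     {''ababbabaab'' @ ''ab'' @ ''babaababba'', ''ababbabaab'' @ ''ba'' @ ''babaababba''},
     {''abbaabbaba'' @ ''ab'' @ ''babaababba'', ''abbaabbaba'' @ ''ba'' @ ''babaababba''}]"

end

theory Submission
  imports Defs
begin

section \<open>Tropical semiring\<close>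

definition tle :: "trop \<Rightarrow> trop \<Rightarrow> bool" where "tle x y \<longleftrightarrow> x + y = y"

lemma tle_simps [simp]: "tle MInfty y" "tle (Fin a) MInfty \<longleftrightarrow> False" "tle (Fin a) (Fin b) \<longleftrightarrow> a \<le> b"
  by (auto simp: tle_def max_def)

lemma tle_refl [simp]: "tle x x" by (cases x) auto
lemma tle_trans [trans]: "tle x y \<Longrightarrow> tle y z \<Longrightarrow> tle x z"
  by (cases x; cases y; cases z) auto
lemma tle_antisym: "tle x y \<Longrightarrow> tle y x \<Longrightarrow> x = y"
  by (cases x; cases y) auto
lemma tle_linear: "tle x y \<or> tle y x"
  by (cases x; cases y) auto
lemma tle_zero [simp]: "tle 0 y" by (simp add: zero_trop_def)
lemma tle_add: "tle x z \<Longrightarrow> tle x (z + y)" "tle x z \<Longrightarrow> tle x (y + z)"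
  by (cases x; cases y; cases z; auto)+
lemma tle_mult: "tle x y \<Longrightarrow> tle (z * x) (z * y)"
  by (cases x; cases y; cases z) auto
lemma trop_add_cases: obtains "(x::trop) + y = x" | "(x::trop) + y = y"
  using tle_linear[of x y] by (auto simp: tle_def add.commute)

section \<open>Products of upper triangular matrices\<close>

fun matprod :: "('c \<Rightarrow> trop mat) \<Rightarrow> 'c list \<Rightarrow> trop mat" where
  "matprod f [] = 1\<^sub>m 3"
| "matprod f (t # w) = f t * matprod f w"

lemma UT_3: "A \<in> UT 3 \<longleftrightarrow> A \<in> carrier_mat 3 3 \<and> A $$ (1, 0) = 0 \<and> A $$ (2, 0) = 0 \<and> A $$ (2, 1) = 0"
proof -
  have "upper_triangular A" if c: "A \<in> carrier_mat 3 3" and z: "A $$ (1, 0) = 0" "A $$ (2, 0) = 0" "A $$ (2, 1) = 0"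
  proof
    fix i j assume "j < i" "i < dim_row A"
    then have "i = 1 \<and> j = 0 \<or> i = 2 \<and> j = 0 \<or> i = 2 \<and> j = 1" using c by auto
    then show "A $$ (i, j) = 0" using z by auto
  qed
  then show ?thesis by (auto simp: UT_def)
qed

lemma sum3: "(\<Sum>i = 0..<3::nat. g i) = g 0 + g 1 + g 2"
  by (simp add: numeral_3_eq_3 numeral_2_eq_2)

lemma mult_entry: "A \<in> carrier_mat 3 3 \<Longrightarrow> B \<in> carrier_mat 3 3 \<Longrightarrow> i < 3 \<Longrightarrow> j < 3 \<Longrightarrow>
  (A * B) $$ (i, j) = A $$ (i, 0) * B $$ (0, j) + A $$ (i, 1) * B $$ (1, j) + A $$ (i, 2) * B $$ (2, j)"
  by (auto simp: scalar_prod_def sum3)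

lemma UT_mult: "A \<in> UT 3 \<Longrightarrow> B \<in> UT 3 \<Longrightarrow> A * B \<in> UT 3"
  by (simp add: UT_3 mult_entry mult_carrier_mat[of _ 3 3] del: index_mult_mat)

lemma UT_one: "1\<^sub>m 3 \<in> UT 3"
  by (simp add: UT_def)

lemma matprod_UT: "(\<And>t. t \<in> set w \<Longrightarrow> f t \<in> UT 3) \<Longrightarrow> matprod f w \<in> UT 3"
  by (induction w) (auto simp: UT_one UT_mult)

lemma UT_carrier: "A \<in> UT 3 \<Longrightarrow> A \<in> carrier_mat 3 3" by (simp add: UT_def)

lemma matprod_append:
  assumes "\<And>t. t \<in> set (u @ v) \<Longrightarrow> f t \<in> UT 3"
  shows "matprod f (u @ v) = matprod f u * matprod f v"
  using assms
proof (induction u)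
  case Nil
  then have "matprod f v \<in> carrier_mat 3 3" by (auto intro!: UT_carrier matprod_UT)
  then show ?case by simp
next
  case (Cons t u)
  have "f t \<in> carrier_mat 3 3" "matprod f u \<in> carrier_mat 3 3" "matprod f v \<in> carrier_mat 3 3"
    using Cons.prems by (auto intro!: UT_carrier matprod_UT)
  then show ?case using Cons by (simp add: assoc_mult_mat[of _ 3 3 _ 3 _ 3])
qed

lemma sim_iff_matprod:
  "sim \<Sigma> 3 w v \<longleftrightarrow> w \<in> free_semigroup \<Sigma> \<and> v \<in> free_semigroup \<Sigma> \<and>
     (\<forall>f. (\<forall>t\<in>\<Sigma>. f t \<in> UT 3) \<longrightarrow> matprod f w = matprod f v)" (is "_ \<longleftrightarrow> ?A \<and> ?B \<and> ?C")
proof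
  assume s: "sim \<Sigma> 3 w v"
  have ?C
  proof (intro allI impI)
    fix f :: "'a \<Rightarrow> trop mat" assume f: "\<forall>t\<in>\<Sigma>. f t \<in> UT 3"
    have "matprod f \<in> UT_morphisms \<Sigma> 3"
      unfolding UT_morphisms_def free_semigroup_def using f
      by (auto intro!: matprod_UT matprod_append)
    then show "matprod f w = matprod f v" using s by (auto simp: sim_def)
  qed
  then show "?A \<and> ?B \<and> ?C" using s by (auto simp: sim_def)
next
  assume r: "?A \<and> ?B \<and> ?C"
  have "\<phi> w = \<phi> v" if phi: "\<phi> \<in> UT_morphisms \<Sigma> 3" for \<phi>
  proof -
    let ?f = "\<lambda>t. \<phi> [t]"
    have f: "\<forall>t\<in>\<Sigma>. ?f t \<in> UT 3"
      using phi by (auto simp: UT_morphisms_def free_semigroup_def Pi_def)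
    have "\<phi> u = matprod ?f u" if "u \<in> free_semigroup \<Sigma>" for u
      using that
    proof (induction u)
      case Nil
      then show ?case by (simp add: free_semigroup_def)
    next
      case (Cons t u)
      have t: "t \<in> \<Sigma>" and u: "u \<in> lists \<Sigma>" using Cons.prems by (auto simp: free_semigroup_def)
      show ?case
      proof (cases "u = []")
        case True
        have "\<phi> [t] \<in> carrier_mat 3 3" using f t UT_carrier by blast
        then show ?thesis using True by simp
      next
        case False
        then have "u \<in> free_semigroup \<Sigma>" using u by (simp add: free_semigroup_def)
        moreover have "[t] \<in> free_semigroup \<Sigma>" using t by (simp add: free_semigroup_def)
        ultimately have "\<phi> ([t] @ u) = \<phi> [t] * \<phi> u"
          using phi unfolding UT_morphisms_def by blast
        then show ?thesis using Cons.IH \<open>u \<in> free_semigroup \<Sigma>\<close> by simp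
      qed
    qed
    then show ?thesis using r f by auto
  qed
  then show "sim \<Sigma> 3 w v" using r by (auto simp: sim_def)
qed

text \<open>ident: identity for the monoid, binary words\<close>

definition ident :: "bool list \<Rightarrow> bool list \<Rightarrow> bool" where
  "ident w v \<longleftrightarrow> (\<forall>f. (\<forall>t. f t \<in> UT 3) \<longrightarrow> matprod f w = matprod f v)"

lemma ident_sym: "ident w v \<Longrightarrow> ident v w" by (simp add: ident_def)

lemma matprod_map: "matprod f (map g w) = matprod (f \<circ> g) w"
  by (induction w) auto

lemma ident_map: "ident w v \<Longrightarrow> ident (map g w) (map g v)"
  by (simp add: ident_def matprod_map)

lemma ident_append: "ident w v \<Longrightarrow> ident (w @ z) (v @ z)"
  by (simp add: ident_def matprod_append)

lemma matprod_map_filter: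
  assumes "\<And>t. f t \<in> UT 3"
  shows "matprod f (List.map_filter h w) = matprod (\<lambda>x. case h x of None \<Rightarrow> 1\<^sub>m 3 | Some t \<Rightarrow> f t) w"
proof (induction w)
  case Nil
  then show ?case by (simp add: List.map_filter_def)
next
  case (Cons x w)
  have "matprod f (List.map_filter h w) \<in> carrier_mat 3 3"
    using assms by (auto intro!: UT_carrier matprod_UT)
  then show ?case using Cons by (auto simp: map_filter_simps split: option.splits)
qed

lemma sim_ident_project:
  assumes "sim \<Sigma> 3 w v"
  shows "ident (List.map_filter h w) (List.map_filter h v)"
  unfolding ident_def
proof (intro allI impI)
  fix f :: "bool \<Rightarrow> trop mat" assume f: "\<forall>t. f t \<in> UT 3"
  let ?g = "\<lambda>x. case h x of None \<Rightarrow> 1\<^sub>m 3 | Some t \<Rightarrow> f t"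
  have "\<forall>t\<in>\<Sigma>. ?g t \<in> UT 3" using f by (auto simp: UT_one split: option.splits)
  then have "matprod ?g w = matprod ?g v" using assms by (simp add: sim_iff_matprod)
  then show "matprod f (List.map_filter h w) = matprod f (List.map_filter h v)"
    using f by (simp add: matprod_map_filter)
qed

text \<open>reversal: reflection in the anti-diagonal\<close>

definition antitr :: "trop mat \<Rightarrow> trop mat" where
  "antitr M = mat 3 3 (\<lambda>(i, j). M $$ (2 - j, 2 - i))"

lemma antitr_carrier [simp]: "antitr M \<in> carrier_mat 3 3" by (simp add: antitr_def)

lemma antitr_entry: "i < 3 \<Longrightarrow> j < 3 \<Longrightarrow> antitr M $$ (i, j) = M $$ (2 - j, 2 - i)" by (simp add: antitr_def)

lemma antitr_UT: "M \<in> UT 3 \<Longrightarrow> antitr M \<in> UT 3"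
  by (auto simp: UT_3 antitr_entry)

lemma antitr_antitr: "M \<in> carrier_mat 3 3 \<Longrightarrow> antitr (antitr M) = M"
  by (rule eq_matI) (auto simp: antitr_def)

lemma antitr_mult: "M \<in> carrier_mat 3 3 \<Longrightarrow> N \<in> carrier_mat 3 3 \<Longrightarrow> antitr (M * N) = antitr N * antitr M"
proof (rule eq_matI)
  fix i j assume c: "M \<in> carrier_mat 3 3" "N \<in> carrier_mat 3 3"
    and "i < dim_row (antitr N * antitr M)" "j < dim_col (antitr N * antitr M)"
  then have ij: "i < 3" "j < 3" by (auto simp: antitr_def)
  have e: "(2::nat) - 2 = 0" "(2::nat) - 1 = 1" by auto
  show "antitr (M * N) $$ (i, j) = (antitr N * antitr M) $$ (i, j)"
    using c ij by (simp add: mult_entry antitr_entry e ac_simps del: index_mult_mat)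
qed (auto simp: antitr_def)

lemma antitr_one: "antitr (1\<^sub>m 3) = 1\<^sub>m 3"
  by (rule eq_matI) (auto simp: antitr_def)

lemma matprod_rev:
  assumes "\<And>t. f t \<in> UT 3"
  shows "antitr (matprod f (rev w)) = matprod (antitr \<circ> f) w"
proof (induction w)
  case Nil
  then show ?case by (simp add: antitr_one)
next
  case (Cons t w)
  have c: "f t \<in> carrier_mat 3 3" "matprod f (rev w) \<in> carrier_mat 3 3"
    using assms by (auto intro!: UT_carrier matprod_UT)
  have "matprod f (rev (t # w)) = matprod f (rev w) * (f t * 1\<^sub>m 3)"
    using assms by (simp add: matprod_append)
  then show ?case using Cons c by (simp add: antitr_mult)
qed

lemma ident_rev:
  assumes "ident w v"
  shows "ident (rev w) (rev v)"
  unfolding ident_def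
proof (intro allI impI)
  fix f :: "bool \<Rightarrow> trop mat" assume f: "\<forall>t. f t \<in> UT 3"
  then have "\<forall>t. (antitr \<circ> f) t \<in> UT 3" by (simp add: antitr_UT)
  then have "antitr (matprod f (rev w)) = antitr (matprod f (rev v))"
    using assms f by (simp add: matprod_rev ident_def)
  then have "antitr (antitr (matprod f (rev w))) = antitr (antitr (matprod f (rev v)))" by simp
  then show "matprod f (rev w) = matprod f (rev v)"
    using f by (simp add: antitr_antitr UT_carrier matprod_UT)
qed

section \<open>Entries\<close>

definition mon :: "(bool \<Rightarrow> trop mat) \<Rightarrow> nat \<Rightarrow> bool list \<Rightarrow> trop" where
  "mon f i u = prod_list (map (\<lambda>t. f t $$ (i, i)) u)"

lemma mon_simps [simp]: "mon f i [] = 1" "mon f i (t # u) = f t $$ (i, i) * mon f i u"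
  "mon f i (u @ v) = mon f i u * mon f i v"
  by (auto simp: mon_def)

context
  fixes f :: "bool \<Rightarrow> trop mat"
  assumes f: "\<And>t. f t \<in> UT 3"
begin

lemma matprod_UT': "matprod f w \<in> UT 3" using f by (simp add: matprod_UT)

lemma UT_entries: "M \<in> UT 3 \<Longrightarrow> M $$ (Suc 0, 0) = 0 \<and> M $$ (2, 0) = 0 \<and> M $$ (2, Suc 0) = 0"
  by (simp add: UT_3)

lemma entry_Cons: "i < 3 \<Longrightarrow> j < 3 \<Longrightarrow> matprod f (t # w) $$ (i, j) =
   f t $$ (i, 0) * matprod f w $$ (0, j) + f t $$ (i, 1) * matprod f w $$ (1, j) + f t $$ (i, 2) * matprod f w $$ (2, j)"
  using UT_carrier[OF f[of t]] UT_carrier[OF matprod_UT'[of w]]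
  by (simp add: mult_entry del: index_mult_mat)

lemma entry_diag: "i < 3 \<Longrightarrow> matprod f w $$ (i, i) = mon f i w"
proof (induction w)
  case Nil
  then show ?case by simp
next
  case (Cons t w)
  have "i = 0 \<or> i = 1 \<or> i = 2" using Cons.prems by auto
  then show ?case
    using Cons UT_entries[OF f[of t]] UT_entries[OF matprod_UT'[of w]]
    by (auto simp: entry_Cons simp del: matprod.simps)
qed

lemma entry_01: "i < 2 \<Longrightarrow> matprod f (t # w) $$ (i, Suc i) =
   f t $$ (i, i) * matprod f w $$ (i, Suc i) + f t $$ (i, Suc i) * mon f (Suc i) w"
proof -
  assume "i < 2"
  then have "i = 0 \<or> i = 1" by auto
  then show ?thesis
    using UT_entries[OF f[of t]] UT_entries[OF matprod_UT'[of w]] entry_diag[of 1 w] entry_diag[of 2 w]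
    by (auto simp: entry_Cons numeral_2_eq_2 simp del: matprod.simps)
qed

lemma entry_02: "matprod f (t # w) $$ (0, 2) =
   f t $$ (0, 0) * matprod f w $$ (0, 2) + f t $$ (0, 1) * matprod f w $$ (1, 2) + f t $$ (0, 2) * mon f 2 w"
    using entry_diag[of 2 w] by (simp add: entry_Cons del: matprod.simps)

lemma entry_01_ge: "i < 2 \<Longrightarrow> tle (mon f i u * f S $$ (i, Suc i) * mon f (Suc i) x) (matprod f (u @ S # x) $$ (i, Suc i))"
proof (induction u)
  case Nil
  then show ?case by (auto simp: entry_01 simp del: matprod.simps intro!: tle_add)
next
  case (Cons t u)
  have "tle (f t $$ (i, i) * (mon f i u * f S $$ (i, Suc i) * mon f (Suc i) x)) (f t $$ (i, i) * matprod f (u @ S # x) $$ (i, Suc i))"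
    using Cons by (intro tle_mult) simp
  then show ?case using Cons.prems by (simp add: entry_01 mult.assoc tle_add(1) del: matprod.simps)
qed

lemma entry_01_attained: "i < 2 \<Longrightarrow> matprod f w $$ (i, Suc i) = 0 \<or>
   (\<exists>u S x. w = u @ S # x \<and> matprod f w $$ (i, Suc i) = mon f i u * f S $$ (i, Suc i) * mon f (Suc i) x)"
proof (induction w)
  case Nil
  then show ?case by simp
next
  case (Cons t w)
  let ?y = "f t $$ (i, i) * matprod f w $$ (i, Suc i)" and ?z = "f t $$ (i, Suc i) * mon f (Suc i) w"
  show ?case
  proof (cases rule: trop_add_cases[of ?y ?z])
    case 1
    from Cons.IH[OF Cons.prems] show ?thesis
    proof (elim disjE)
      assume "matprod f w $$ (i, Suc i) = 0"
      then show ?thesis using Cons.prems 1 by (simp add: entry_01 del: matprod.simps)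
    next
      assume "\<exists>u S x. w = u @ S # x \<and> matprod f w $$ (i, Suc i) = mon f i u * f S $$ (i, Suc i) * mon f (Suc i) x"
      then obtain u S x where "w = u @ S # x" "matprod f w $$ (i, Suc i) = mon f i u * f S $$ (i, Suc i) * mon f (Suc i) x" by blast
      then have "t # w = (t # u) @ S # x \<and> matprod f (t # w) $$ (i, Suc i) = mon f i (t # u) * f S $$ (i, Suc i) * mon f (Suc i) x"
        using Cons.prems 1 by (simp add: entry_01 mult.assoc del: matprod.simps)
      then show ?thesis by blast
    qed
  next
    case 2
    then have "t # w = [] @ t # w \<and> matprod f (t # w) $$ (i, Suc i) = mon f i [] * f t $$ (i, Suc i) * mon f (Suc i) w"
      using Cons.prems by (simp add: entry_01 del: matprod.simps)
    then show ?thesis by blast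
  qed
qed

lemma entry_02_ge1: "tle (mon f 0 u * f S $$ (0, 2) * mon f 2 x) (matprod f (u @ S # x) $$ (0, 2))"
proof (induction u)
  case Nil
  then show ?case by (auto simp: entry_02 simp del: matprod.simps intro!: tle_add)
next
  case (Cons t u)
  have "tle (f t $$ (0, 0) * (mon f 0 u * f S $$ (0, 2) * mon f 2 x)) (f t $$ (0, 0) * matprod f (u @ S # x) $$ (0, 2))"
    using Cons by (intro tle_mult) simp
  then show ?case by (simp add: entry_02 mult.assoc tle_add(1) del: matprod.simps)
qed

lemma entry_02_ge2: "tle (mon f 0 u * f S $$ (0, 1) * mon f 1 x * f T $$ (1, 2) * mon f 2 y) (matprod f (u @ S # x @ T # y) $$ (0, 2))"
proof (induction u)
  case Nil
  have "tle (f S $$ (0, 1) * (mon f 1 x * f T $$ (1, 2) * mon f 2 y)) (f S $$ (0, 1) * matprod f (x @ T # y) $$ (1, 2))"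
    using entry_01_ge[of 1 x T y] by (intro tle_mult) (simp add: numeral_2_eq_2)
  then show ?case by (simp add: entry_02 mult.assoc tle_add(1)[OF tle_add(2)] del: matprod.simps)
next
  case (Cons t u)
  have "tle (f t $$ (0, 0) * (mon f 0 u * f S $$ (0, 1) * mon f 1 x * f T $$ (1, 2) * mon f 2 y)) (f t $$ (0, 0) * matprod f (u @ S # x @ T # y) $$ (0, 2))"
    using Cons by (intro tle_mult) simp
  then show ?case by (simp add: entry_02 mult.assoc tle_add(1) del: matprod.simps)
qed

lemma entry_02_attained: "matprod f w $$ (0, 2) = 0 \<or>
   (\<exists>u S x. w = u @ S # x \<and> matprod f w $$ (0, 2) = mon f 0 u * f S $$ (0, 2) * mon f 2 x) \<or>
   (\<exists>u S x T y. w = u @ S # x @ T # y \<and> matprod f w $$ (0, 2) = mon f 0 u * f S $$ (0, 1) * mon f 1 x * f T $$ (1, 2) * mon f 2 y)"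
  (is "?Z w \<or> ?O w \<or> ?T w")
proof (induction w)
  case Nil
  then show ?case by simp
next
  case (Cons t w)
  let ?y = "f t $$ (0, 0) * matprod f w $$ (0, 2)" and ?y' = "f t $$ (0, 1) * matprod f w $$ (1, 2)" and ?z = "f t $$ (0, 2) * mon f 2 w"
  have e: "matprod f (t # w) $$ (0, 2) = ?y + ?y' + ?z" by (rule entry_02)
  consider "matprod f (t # w) $$ (0, 2) = ?y" | "matprod f (t # w) $$ (0, 2) = ?y'" | "matprod f (t # w) $$ (0, 2) = ?z"
    unfolding e by (metis trop_add_cases)
  then show ?case
  proof cases
    case 1
    from Cons show ?thesis
    proof (elim disjE)
      assume "?Z w" then show ?thesis using 1 by simp
    next
      assume "?O w"
      then obtain u S x where w: "w = u @ S # x" "matprod f w $$ (0, 2) = mon f 0 u * f S $$ (0, 2) * mon f 2 x" by blast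
      then have "t # w = (t # u) @ S # x \<and> matprod f (t # w) $$ (0, 2) = mon f 0 (t # u) * f S $$ (0, 2) * mon f 2 x"
        using 1 by (simp add: mult.assoc del: matprod.simps)
      then show ?thesis by blast
    next
      assume "?T w"
      then obtain u S x T y where w: "w = u @ S # x @ T # y" "matprod f w $$ (0, 2) = mon f 0 u * f S $$ (0, 1) * mon f 1 x * f T $$ (1, 2) * mon f 2 y" by blast
      then have "t # w = (t # u) @ S # x @ T # y \<and> matprod f (t # w) $$ (0, 2) = mon f 0 (t # u) * f S $$ (0, 1) * mon f 1 x * f T $$ (1, 2) * mon f 2 y"
        using 1 by (simp add: mult.assoc del: matprod.simps)
      then show ?thesis by blast
    qed
  next
    case 2
    have l: "(1::nat) < 2" by simp
    from entry_01_attained[OF l, of w] show ?thesis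
    proof (elim disjE)
      assume "matprod f w $$ (1, Suc 1) = 0"
      then show ?thesis using 2 by (simp add: numeral_2_eq_2 del: matprod.simps)
    next
      assume "\<exists>u S x. w = u @ S # x \<and> matprod f w $$ (1, Suc 1) = mon f 1 u * f S $$ (1, Suc 1) * mon f (Suc 1) x"
      then obtain u S x where w: "w = u @ S # x" "matprod f w $$ (1, 2) = mon f 1 u * f S $$ (1, 2) * mon f 2 x"
        by (auto simp: numeral_2_eq_2)
      then have "t # w = [] @ t # u @ S # x \<and> matprod f (t # w) $$ (0, 2) = mon f 0 [] * f t $$ (0, 1) * mon f 1 u * f S $$ (1, 2) * mon f 2 x"
        using 2 by (simp add: mult.assoc del: matprod.simps)
      then show ?thesis by blast
    qed
  next
    case 3
    then have "t # w = [] @ t # w \<and> matprod f (t # w) $$ (0, 2) = mon f 0 [] * f t $$ (0, 2) * mon f 2 w" by simp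
    then show ?thesis by blast
  qed
qed

end

definition na :: "bool list \<Rightarrow> int" where "na w = int (count_list w False)"
definition nb :: "bool list \<Rightarrow> int" where "nb w = int (count_list w True)"
definition val :: "int \<Rightarrow> int \<Rightarrow> bool list \<Rightarrow> int" where "val a b w = a * na w + b * nb w"

lemma na_simps [simp]: "na [] = 0" "na (t # w) = (if t then 0 else 1) + na w" "na (u @ v) = na u + na v"
  and nb_simps [simp]: "nb [] = 0" "nb (t # w) = (if t then 1 else 0) + nb w" "nb (u @ v) = nb u + nb v"
  by (auto simp: na_def nb_def)
lemma na_nonneg [simp]: "0 \<le> na w" and nb_nonneg [simp]: "0 \<le> nb w"
  by (auto simp: na_def nb_def)
lemma na_nb_length: "na w + nb w = int (length w)"
  by (induction w) auto
lemma val_simps [simp]: "val a b [] = 0" "val a b (t # w) = (if t then b else a) + val a b w"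
  "val a b (u @ v) = val a b u + val a b v"
  by (auto simp: val_def algebra_simps)

definition dom1 :: "bool list \<Rightarrow> bool list \<Rightarrow> bool" where
  "dom1 w v \<longleftrightarrow> (\<forall>S a b u x. w = u @ S # x \<longrightarrow> (\<exists>u' x'. v = u' @ S # x' \<and> val a b u \<le> val a b u'))"
definition dom2 :: "bool list \<Rightarrow> bool list \<Rightarrow> bool" where
  "dom2 w v \<longleftrightarrow> (\<forall>S T a b c d u x y. w = u @ S # x @ T # y \<longrightarrow>
     (\<exists>u' x' y'. v = u' @ S # x' @ T # y' \<and> val a b u + val c d x \<le> val a b u' + val c d x'))"

definition probe :: "(nat \<Rightarrow> int) \<Rightarrow> (nat \<Rightarrow> int) \<Rightarrow> bool \<Rightarrow> bool \<Rightarrow> bool \<Rightarrow> trop mat" where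
  "probe p q S T t = mat 3 3 (\<lambda>(i, j). if i = j then Fin (real_of_int (if t then q i else p i))
     else if i = 0 \<and> j = 1 \<and> t = S \<or> i = 1 \<and> j = 2 \<and> t = T then Fin 0 else MInfty)"

lemma probe_UT: "probe p q S T t \<in> UT 3"
  by (auto simp: UT_3 probe_def zero_trop_def)

lemma probe_mon: "i < 3 \<Longrightarrow> mon (probe p q S T) i u = Fin (real_of_int (val (p i) (q i) u))"
  by (induction u) (auto simp: one_trop_def probe_def)

lemma probe_01: "probe p q S T t $$ (0, 1) = (if t = S then Fin 0 else MInfty)"
  and probe_12: "probe p q S T t $$ (1, 2) = (if t = T then Fin 0 else MInfty)"
  and probe_02: "probe p q S T t $$ (0, 2) = MInfty"
  by (auto simp: probe_def)

lemma MInfty_times [simp]: "MInfty * x = MInfty" "x * MInfty = MInfty"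
  by (cases x; simp)+

lemma ident_val: "ident w v \<Longrightarrow> val a b w = val a b v"
proof -
  assume i: "ident w v"
  let ?f = "probe (\<lambda>_. a) (\<lambda>_. b) True True"
  have "matprod ?f w = matprod ?f v" using i probe_UT by (auto simp: ident_def)
  then have "mon ?f 0 w = mon ?f 0 v"
    using entry_diag[of ?f 0 w] entry_diag[of ?f 0 v] probe_UT by auto
  then show ?thesis by (simp add: probe_mon)
qed

lemma ident_na_nb: "ident w v \<Longrightarrow> na w = na v" "ident w v \<Longrightarrow> nb w = nb v"
  using ident_val[of w v 1 0] ident_val[of w v 0 1] by (auto simp: val_def)

lemma ident_dom1: "ident w v \<Longrightarrow> dom1 w v"
  unfolding dom1_def
proof (intro allI impI)
  fix S a b u x assume i: "ident w v" and w: "w = u @ S # x"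
  define f where "f = probe (\<lambda>i. if i = 0 then a else 0) (\<lambda>i. if i = 0 then b else 0) S True"
  note m = probe_mon[of 0] probe_mon[of 1] probe_mon[of "Suc 0"]
  have f: "\<And>t. f t \<in> UT 3" unfolding f_def by (rule probe_UT)
  have e: "matprod f w = matprod f v" using i f by (auto simp: ident_def)
  have z: "val 0 0 x = 0" for x by (simp add: val_def)
  have "tle (Fin (real_of_int (val a b u))) (matprod f v $$ (0, 1))"
    using entry_01_ge[where f = f, OF f, where i = 0 and u = u and S = S and x = x] unfolding e[symmetric] w by (simp add: f_def m probe_01[simplified] z)
  moreover have "matprod f v $$ (0, 1) = MInfty \<or>
    (\<exists>u' x'. v = u' @ S # x' \<and> matprod f v $$ (0, 1) = Fin (real_of_int (val a b u')))"
    using entry_01_attained[where f = f, OF f, where i = 0 and w = v, simplified]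
  proof (elim disjE exE conjE)
    fix u' S' x' assume v: "v = u' @ S' # x'"
      and "matprod f v $$ (0, Suc 0) = mon f 0 u' * f S' $$ (0, Suc 0) * mon f (Suc 0) x'"
    then have "matprod f v $$ (0, 1) = (if S' = S then Fin (real_of_int (val a b u')) else MInfty)"
      by (simp add: f_def m probe_01[simplified] z)
    then show ?thesis using v by (cases "S' = S") auto
  qed (simp add: zero_trop_def)
  ultimately show "\<exists>u' x'. v = u' @ S # x' \<and> val a b u \<le> val a b u'"
    by (elim disjE exE conjE) auto
qed

lemma ident_dom2: "ident w v \<Longrightarrow> dom2 w v"
  unfolding dom2_def
proof (intro allI impI)
  fix S T a b c d u x y assume i: "ident w v" and w: "w = u @ S # x @ T # y"
  define f where "f = probe (\<lambda>i. if i = 0 then a else if i = 1 then c else 0) (\<lambda>i. if i = 0 then b else if i = 1 then d else 0) S T"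
  note m = probe_mon[of 0] probe_mon[of 1] probe_mon[of 2] probe_mon[of "Suc 0"]
  have f: "\<And>t. f t \<in> UT 3" unfolding f_def by (rule probe_UT)
  have e: "matprod f w = matprod f v" using i f by (auto simp: ident_def)
  have z: "val 0 0 x = 0" for x by (simp add: val_def)
  note pr = probe_01[simplified] probe_12[simplified] probe_02
  have "tle (Fin (real_of_int (val a b u + val c d x))) (matprod f v $$ (0, 2))"
    using entry_02_ge2[where f = f, OF f, where u = u and S = S and x = x and T = T and y = y] unfolding e[symmetric] w by (simp add: f_def m pr z)
  moreover have "matprod f v $$ (0, 2) = MInfty \<or>
    (\<exists>u' x' y'. v = u' @ S # x' @ T # y' \<and> matprod f v $$ (0, 2) = Fin (real_of_int (val a b u' + val c d x')))"
    using entry_02_attained[where f = f, OF f, where w = v]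
  proof (elim disjE exE conjE)
    fix u' S' x' assume "v = u' @ S' # x'"
      and "matprod f v $$ (0, 2) = mon f 0 u' * f S' $$ (0, 2) * mon f 2 x'"
    then show ?thesis by (simp add: f_def m pr)
  next
    fix u' S' x' T' y' assume v: "v = u' @ S' # x' @ T' # y'"
      and "matprod f v $$ (0, 2) = mon f 0 u' * f S' $$ (0, 1) * mon f 1 x' * f T' $$ (1, 2) * mon f 2 y'"
    then have "matprod f v $$ (0, 2) = (if S' = S \<and> T' = T then Fin (real_of_int (val a b u' + val c d x')) else MInfty)"
      by (simp add: f_def m pr z)
    then show ?thesis using v by (cases "S' = S \<and> T' = T") auto
  qed (simp add: zero_trop_def)
  ultimately show "\<exists>u' x' y'. v = u' @ S # x' @ T # y' \<and> val a b u + val c d x \<le> val a b u' + val c d x'"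
    by (elim disjE exE conjE) (auto simp flip: of_int_add)
qed

fun pts :: "bool \<Rightarrow> int \<Rightarrow> int \<Rightarrow> bool list \<Rightarrow> (int \<times> int) set" where
  "pts S x y [] = {}"
| "pts S x y (t # w) = (if t = S then {(x, y)} else {}) \<union> pts S (if t then x else x + 1) (if t then y + 1 else y) w"

lemma pts_append [simp]: "pts S x y (u @ v) = pts S x y u \<union> pts S (x + na u) (y + nb u) v"
  by (induction u arbitrary: x y) (auto simp: ac_simps)

lemma pts_iff: "(p, q) \<in> pts S x y w \<longleftrightarrow> (\<exists>u z. w = u @ S # z \<and> p = x + na u \<and> q = y + nb u)"
proof
  show "(p, q) \<in> pts S x y w \<Longrightarrow> \<exists>u z. w = u @ S # z \<and> p = x + na u \<and> q = y + nb u"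
  proof (induction w arbitrary: x y)
    case (Cons t w)
    show ?case
    proof (cases "t = S \<and> p = x \<and> q = y")
      case True
      then have "t # w = [] @ S # w \<and> p = x + na [] \<and> q = y + nb []" by simp
      then show ?thesis by blast
    next
      case False
      then have "(p, q) \<in> pts S (if t then x else x + 1) (if t then y + 1 else y) w" using Cons.prems by (auto split: if_splits)
      from Cons.IH[OF this] obtain u z where "w = u @ S # z" "p = (if t then x else x + 1) + na u" "q = (if t then y + 1 else y) + nb u" by blast
      then have "t # w = (t # u) @ S # z \<and> p = x + na (t # u) \<and> q = y + nb (t # u)" by (auto split: if_splits)
      then show ?thesis by blast
    qed
  qed simp
qed auto

definition dominated :: "(int \<times> int) set \<Rightarrow> (int \<times> int) set \<Rightarrow> bool" where
  "dominated P V \<longleftrightarrow> (\<forall>a b. \<forall>(x, y)\<in>P. \<exists>(x', y')\<in>V. a * x + b * y \<le> a * x' + b * y')"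

lemma dominatedI: "(\<And>a b x y. (x, y) \<in> P \<Longrightarrow> \<exists>x' y'. (x', y') \<in> V \<and> a * x + b * y \<le> a * x' + b * y') \<Longrightarrow> dominated P V"
  by (fastforce simp: dominated_def)
lemma dominatedD: "dominated P V \<Longrightarrow> (x, y) \<in> P \<Longrightarrow> \<exists>x' y'. (x', y') \<in> V \<and> a * x + b * y \<le> a * x' + b * y'"
  by (fastforce simp: dominated_def)

lemma dominated_trans: "dominated P V \<Longrightarrow> dominated V W \<Longrightarrow> dominated P W"
  by (rule dominatedI) (meson dominatedD order_trans)

lemma dominated_refl: "dominated P P" by (rule dominatedI) blast

lemma dom1_dominated: "dom1 w v \<longleftrightarrow> (\<forall>S. dominated (pts S x y w) (pts S x y v))"
proof
  assume d: "dom1 w v"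
  show "\<forall>S. dominated (pts S x y w) (pts S x y v)"
  proof (intro allI dominatedI)
    fix S a b p q assume "(p, q) \<in> pts S x y w"
    then obtain u z where w: "w = u @ S # z" "p = x + na u" "q = y + nb u" by (auto simp: pts_iff)
    obtain u' z' where v: "v = u' @ S # z'" "val a b u \<le> val a b u'" using d w(1) unfolding dom1_def by blast
    then have "(x + na u', y + nb u') \<in> pts S x y v \<and> a * p + b * q \<le> a * (x + na u') + b * (y + nb u')"
      using w by (auto simp: pts_iff val_def algebra_simps)
    then show "\<exists>x' y'. (x', y') \<in> pts S x y v \<and> a * p + b * q \<le> a * x' + b * y'" by blast
  qed
next
  assume d: "\<forall>S. dominated (pts S x y w) (pts S x y v)"
  show "dom1 w v" unfolding dom1_def
  proof (intro allI impI)
    fix S a b u z assume "w = u @ S # z"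
    then have "(x + na u, y + nb u) \<in> pts S x y w" by (auto simp: pts_iff)
    then obtain p q where "(p, q) \<in> pts S x y v" "a * (x + na u) + b * (y + nb u) \<le> a * p + b * q"
      using d dominatedD by blast
    then obtain u' z' where "v = u' @ S # z'" "a * (x + na u) + b * (y + nb u) \<le> a * (x + na u') + b * (y + nb u')"
      by (auto simp: pts_iff)
    then show "\<exists>u' x'. v = u' @ S # x' \<and> val a b u \<le> val a b u'"
      by (auto simp: val_def algebra_simps)
  qed
qed

text \<open>exposed points are common\<close>

lemma exposed_common:
  assumes d: "dominated V P" and bP: "\<And>x y. (x, y) \<in> P \<Longrightarrow> 0 \<le> x \<and> x \<le> N \<and> 0 \<le> y \<and> y \<le> N"
    and bV: "\<And>x y. (x, y) \<in> V \<Longrightarrow> 0 \<le> x \<and> x \<le> N \<and> 0 \<le> y \<and> y \<le> N"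
    and bR: "0 \<le> r1 \<and> r1 \<le> N \<and> 0 \<le> r2 \<and> r2 \<le> N"
    and ex: "\<And>x y. (x, y) \<in> P \<Longrightarrow> (x, y) \<noteq> (r1, r2) \<Longrightarrow> a * x + b * y < a * r1 + b * r2"
    and v: "(v1, v2) \<in> V" and ge: "a * r1 + b * r2 \<le> a * v1 + b * v2"
  shows "(v1, v2) = (r1, r2)"
proof (rule ccontr)
  assume ne: "(v1, v2) \<noteq> (r1, r2)"
  define e1 e2 K where "e1 = v1 - r1" and "e2 = v2 - r2" and "K = 2 * N * N + 1"
  have pos: "e1 * e1 + e2 * e2 > 0" using ne by (auto simp: e1_def e2_def sum_squares_gt_zero_iff)
  have N: "0 \<le> N" using bR by auto
  obtain p1 p2 where p: "(p1, p2) \<in> P" and le: "(K * a + e1) * v1 + (K * b + e2) * v2 \<le> (K * a + e1) * p1 + (K * b + e2) * p2"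
    using dominatedD[OF d v] by blast
  have Kge: "K * (a * r1 + b * r2) \<le> K * (a * v1 + b * v2)" using ge N by (simp add: K_def mult_left_mono)
  show False
  proof (cases "(p1, p2) = (r1, r2)")
    case True
    then have "K * (a * v1 + b * v2) - K * (a * r1 + b * r2) + (e1 * e1 + e2 * e2) \<le> 0"
      using le by (auto simp: e1_def e2_def algebra_simps)
    then show False using Kge pos by linarith
  next
    case False
    then have "a * p1 + b * p2 + 1 \<le> a * r1 + b * r2" using ex[OF p] by simp
    then have "K * (a * p1 + b * p2 + 1) \<le> K * (a * r1 + b * r2)" using N by (simp add: K_def mult_left_mono)
    then have *: "K \<le> e1 * (p1 - v1) + e2 * (p2 - v2)"
      using le Kge by (simp add: algebra_simps)
    have "\<bar>e1\<bar> \<le> N" "\<bar>e2\<bar> \<le> N" "\<bar>p1 - v1\<bar> \<le> N" "\<bar>p2 - v2\<bar> \<le> N"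
      using bP[OF p] bV[OF v] bR by (auto simp: e1_def e2_def)
    then have "\<bar>e1 * (p1 - v1)\<bar> \<le> N * N" "\<bar>e2 * (p2 - v2)\<bar> \<le> N * N"
      unfolding abs_mult using N by (auto intro!: mult_mono)
    then show False using * by (simp add: K_def)
  qed
qed

text \<open>moving a point towards another\<close>

lemma swap_dominated:
  assumes PV: "dominated (insert (r1, r2) X) V" and VP: "dominated V (insert (r1, r2) X)"
    and b: "\<And>x y. (x, y) \<in> insert (r1, r2) X \<union> V \<Longrightarrow> 0 \<le> x \<and> x \<le> N \<and> 0 \<le> y \<and> y \<le> N"
    and r: "(r1, r2) \<notin> V" and v: "(r1 + m * e1, r2 + m * e2) \<in> V" and m: "1 \<le> m"
  shows "dominated (insert (r1, r2) X) (insert (r1 + e1, r2 + e2) X)"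
    and "dominated (insert (r1 + e1, r2 + e2) X) (insert (r1, r2) X)"
proof -
  let ?P = "insert (r1, r2) X" and ?Q = "insert (r1 + e1, r2 + e2) X"
  show "dominated ?P ?Q"
  proof (rule dominatedI, rule ccontr)
    fix a c x y assume xy: "(x, y) \<in> ?P" and no: "\<nexists>x' y'. (x', y') \<in> ?Q \<and> a * x + c * y \<le> a * x' + c * y'"
    then have xyr: "x = r1" "y = r2" by auto
    have X: "a * x' + c * y' < a * r1 + c * r2" if "(x', y') \<in> X" for x' y'
      using no that by (auto simp: xyr not_le)
    obtain x' y' where v': "(x', y') \<in> V" and le: "a * r1 + c * r2 \<le> a * x' + c * y'"
      using dominatedD[OF PV, of r1 r2 a c] by auto
    have "(x', y') = (r1, r2)"
      by (rule exposed_common[OF VP, of N, OF _ _ _ _ v' le]) (use b X in auto)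
    then show False using v' r by simp
  qed
  show "dominated ?Q ?P"
  proof (rule dominatedI)
    fix a c x y assume xy: "(x, y) \<in> ?Q"
    show "\<exists>x' y'. (x', y') \<in> ?P \<and> a * x + c * y \<le> a * x' + c * y'"
    proof (cases "(x, y) \<in> X")
      case False
      then have xy: "x = r1 + e1" "y = r2 + e2" using xy by auto
      show ?thesis
      proof (cases "a * e1 + c * e2 \<le> 0")
        case True
        then have "a * x + c * y \<le> a * r1 + c * r2" by (simp add: xy algebra_simps)
        then show ?thesis by blast
      next
        case False
        then have "1 * (a * e1 + c * e2) \<le> m * (a * e1 + c * e2)" using m by (intro mult_right_mono) auto
        then have "a * x + c * y \<le> a * (r1 + m * e1) + c * (r2 + m * e2)" by (simp add: xy algebra_simps)
        then show ?thesis using dominatedD[OF VP v, of a c] by (meson order_trans)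
      qed
    qed blast
  qed
qed

definition eq2 :: "bool list \<Rightarrow> bool list \<Rightarrow> bool" where
  "eq2 w v \<longleftrightarrow> na w = na v \<and> nb w = nb v \<and> dom1 w v \<and> dom1 v w"

lemma dom1_refl: "dom1 w w" by (auto simp: dom1_def)
lemma dom1_trans: "dom1 w v \<Longrightarrow> dom1 v z \<Longrightarrow> dom1 w z"
  unfolding dom1_dominated[of _ _ 0 0] by (blast intro: dominated_trans)
lemma eq2_refl [simp]: "eq2 w w" by (simp add: eq2_def dom1_refl)
lemma eq2_sym: "eq2 w v \<Longrightarrow> eq2 v w" by (simp add: eq2_def)
lemma eq2_trans: "eq2 w v \<Longrightarrow> eq2 v z \<Longrightarrow> eq2 w z" by (auto simp: eq2_def intro: dom1_trans)

lemma eq2_length: "eq2 w v \<Longrightarrow> length w = length v"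
  using na_nb_length[of w] na_nb_length[of v] by (simp add: eq2_def)

lemma pts_bounds: "(x, y) \<in> pts S 0 0 w \<Longrightarrow> 0 \<le> x \<and> x \<le> int (length w) \<and> 0 \<le> y \<and> y \<le> int (length w)"
proof -
  assume "(x, y) \<in> pts S 0 0 w"
  then obtain u z where "w = u @ S # z" "x = na u" "y = nb u" by (auto simp: pts_iff)
  then show ?thesis using na_nb_length[of u] na_nonneg[of u] nb_nonneg[of u] by (simp del: na_nonneg nb_nonneg)
qed

lemma eq2_swap:
  assumes e: "eq2 w v" and w: "w = p @ replicate (Suc i) False @ True # x" and v: "v = p @ True # v'"
  shows "eq2 w (p @ replicate i False @ True # False # x)"
proof -
  define u where "u = p @ replicate i False"
  let ?g = "u @ True # False # x"
  have nar: "na (replicate i False) = int i" "nb (replicate i False) = 0" by (induction i) auto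
  have w': "w = u @ False # True # x" by (simp add: w u_def replicate_append_same)
  have long: "nb p + 1 \<le> nb u'" if "v = u' @ y" "length p < length u'" for u' y
  proof -
    have "u' = take (length u') v" using that by simp
    also have "\<dots> = p @ True # take (length u' - Suc (length p)) v'" using that(2) by (simp add: v take_Cons' )
    finally have "nb u' = nb (p @ True # take (length u' - Suc (length p)) v')" by (rule arg_cong)
    then show ?thesis by simp
  qed
  have d: "dominated (pts S 0 0 w) (pts S 0 0 v)" "dominated (pts S 0 0 v) (pts S 0 0 w)" for S
    using e unfolding eq2_def dom1_dominated[of _ _ 0 0] by auto
  have len: "length w = length v" using e by (rule eq2_length)
  have "dominated (pts S 0 0 w) (pts S 0 0 ?g) \<and> dominated (pts S 0 0 ?g) (pts S 0 0 w)" for S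
  proof (cases S)
    case False
    then have S: "S = False" by simp
    let ?X = "pts False 0 0 u \<union> pts False (na u + 1) (nb u + 1) x"
    have 1: "pts False 0 0 w = insert (na u, nb u) ?X" by (auto simp: w' ac_simps)
    have 2: "pts False 0 0 ?g = insert (na u + 0, nb u + 1) ?X" by (auto simp: ac_simps)
    have col: "\<exists>u' y. z = u' @ False # y \<and> na u' = int n" if "int n < na z" for n z
      using that
    proof (induction z arbitrary: n)
      case (Cons t z)
      show ?case
      proof (cases "t \<or> 0 < n")
        case True
        define m where "m = (if t then n else n - 1)"
        have "int m < na z" using Cons.prems True by (auto simp: m_def split: if_splits)
        then obtain u' y where "z = u' @ False # y" "na u' = int m" using Cons.IH by blast
        then have "t # z = (t # u') @ False # y \<and> na (t # u') = int n" using True by (auto simp: m_def)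
        then show ?thesis by blast
      next
        case False
        then have "t # z = [] @ False # z \<and> na [] = int n" by simp
        then show ?thesis by blast
      qed
    qed simp
    have "na w = na u + 1 + na x" by (simp add: w')
    then have "int (nat (na u)) < na v" using e na_nonneg[of x] na_nonneg[of u] by (simp add: eq2_def del: na_nonneg)
    then obtain u' y where vy: "v = u' @ False # y" and nu: "na u' = na u" using col[of "nat (na u)" v] by auto
    have "length p < length u'"
    proof (rule ccontr)
      assume "\<not> length p < length u'"
      moreover have "length u' \<noteq> length p" using vy v by (metis append_eq_append_conv list.inject)
      ultimately have l: "length u' < length p" by simp
      have "p = take (length p) v" by (simp add: v)
      also have "\<dots> = u' @ False # take (length p - Suc (length u')) y" using l by (simp add: vy take_Cons')
      finally have "na p = na (u' @ False # take (length p - Suc (length u')) y)" by (rule arg_cong)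
      then show False using nu nar na_nonneg[of "take (length p - Suc (length u')) y"] by (simp add: u_def)
    qed
    then have nbu: "nb u + 1 \<le> nb u'" using long[OF vy] by (simp add: u_def nar)
    have v0: "(na u + (nb u' - nb u) * 0, nb u + (nb u' - nb u) * 1) \<in> pts False 0 0 v"
      using vy nu by (auto simp: pts_iff)
    have r: "(na u, nb u) \<notin> pts False 0 0 v"
    proof
      assume "(na u, nb u) \<in> pts False 0 0 v"
      then obtain u1 y1 where v1: "v = u1 @ False # y1" "na u1 = na u" "nb u1 = nb u" by (auto simp: pts_iff)
      then have "length u1 = length u" using na_nb_length[of u1] na_nb_length[of u] by simp
      then have "length p < length (u1 @ [False])" by (simp add: u_def)
      from long[OF _ this, of y1] v1 show False by (simp add: u_def nar)
    qed
    from d[of False] have d': "dominated (insert (na u, nb u) ?X) (pts False 0 0 v)" "dominated (pts False 0 0 v) (insert (na u, nb u) ?X)"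
      unfolding 1 by auto
    have bb: "0 \<le> x' \<and> x' \<le> int (length v) \<and> 0 \<le> y' \<and> y' \<le> int (length v)" if "(x', y') \<in> insert (na u, nb u) ?X \<union> pts False 0 0 v" for x' y'
      using that unfolding 1[symmetric] using pts_bounds[of x' y' False w] pts_bounds[of x' y' False v] len by auto
    have "1 \<le> nb u' - nb u" using nbu by simp
    then show ?thesis
      unfolding S 1 2 by (intro conjI swap_dominated[OF d' bb r v0])
  next
    case True
    then have S: "S = True" by simp
    let ?X = "pts True 0 0 u \<union> pts True (na u + 1) (nb u + 1) x"
    have 1: "pts True 0 0 w = insert (na u + 1, nb u) ?X" by (auto simp: w' ac_simps)
    have 2: "pts True 0 0 ?g = insert (na u + 1 + (-1), nb u + 0) ?X" by (auto simp: ac_simps)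
    have v0: "(na u + 1 + (int i + 1) * (-1), nb u + (int i + 1) * 0) \<in> pts True 0 0 v"
      by (auto simp: pts_iff u_def nar v)
    have r: "(na u + 1, nb u) \<notin> pts True 0 0 v"
    proof
      assume "(na u + 1, nb u) \<in> pts True 0 0 v"
      then obtain u1 y1 where v1: "v = u1 @ True # y1" "na u1 = na u + 1" "nb u1 = nb u" by (auto simp: pts_iff)
      then have "length u1 = length u + 1" using na_nb_length[of u1] na_nb_length[of u] by simp
      then have "length p < length u1" by (simp add: u_def)
      from long[OF v1(1) this] v1 show False by (simp add: u_def nar)
    qed
    from d[of True] have d': "dominated (insert (na u + 1, nb u) ?X) (pts True 0 0 v)" "dominated (pts True 0 0 v) (insert (na u + 1, nb u) ?X)"
      unfolding 1 by auto
    have bb: "0 \<le> x' \<and> x' \<le> int (length v) \<and> 0 \<le> y' \<and> y' \<le> int (length v)" if "(x', y') \<in> insert (na u + 1, nb u) ?X \<union> pts True 0 0 v" for x' y'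
      using that unfolding 1[symmetric] using pts_bounds[of x' y' True w] pts_bounds[of x' y' True v] len by auto
    have "1 \<le> int i + 1" by simp
    then show ?thesis
      unfolding S 1 2 by (intro conjI swap_dominated[OF d' bb r v0])
  qed
  then have "eq2 w ?g" unfolding eq2_def dom1_dominated[of _ _ 0 0] by (auto simp: w')
  then show ?thesis by (simp add: u_def)
qed

definition strict :: "bool list \<Rightarrow> bool \<Rightarrow> int \<Rightarrow> int \<Rightarrow> bool list \<Rightarrow> bool" where
  "strict w S a b u \<longleftrightarrow> (\<exists>x. w = u @ S # x) \<and> (\<forall>u' x'. w = u' @ S # x' \<longrightarrow> u' \<noteq> u \<longrightarrow> val a b u' < val a b u)"

lemma prefix_unique: "u @ x = u' @ x' \<Longrightarrow> na u = na u' \<Longrightarrow> nb u = nb u' \<Longrightarrow> u = u'"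
  using na_nb_length[of u] na_nb_length[of u'] by (simp add: append_eq_append_conv)

lemma dom1D: "dom1 w v \<Longrightarrow> w = u @ S # x \<Longrightarrow> \<exists>u' x'. v = u' @ S # x' \<and> val a b u \<le> val a b u'"
  unfolding dom1_def by simp

lemma prefix_past_step: "p @ True # v' = u' @ y \<Longrightarrow> length p < length u' \<Longrightarrow> nb p + 1 \<le> nb u'"
proof -
  assume v: "p @ True # v' = u' @ y" and l: "length p < length u'"
  have "u' = take (length u') (p @ True # v')" using v by simp
  also have "\<dots> = p @ True # take (length u' - Suc (length p)) v'" using l by (simp add: take_Cons')
  finally have "nb u' = nb (p @ True # take (length u' - Suc (length p)) v')" by (rule arg_cong)
  then show ?thesis by simp
qed

lemma strict_transfer:
  assumes e: "eq2 w v" and s: "strict w S a b u"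
  shows "\<exists>u'. na u' = na u \<and> nb u' = nb u \<and> strict v S a b u'"
proof -
  obtain x where w: "w = u @ S # x" using s by (auto simp: strict_def)
  have common: "na u' = na u \<and> nb u' = nb u" if "v = u' @ S # x'" "val a b u \<le> val a b u'" for u' x'
  proof -
    have "(na u', nb u') = (na u, nb u)"
    proof (rule exposed_common[where P = "pts S 0 0 w" and V = "pts S 0 0 v" and N = "int (length w)" and a = a and b = b])
      show "dominated (pts S 0 0 v) (pts S 0 0 w)" using e unfolding eq2_def dom1_dominated[of _ _ 0 0] by auto
      show "\<And>x y. (x, y) \<in> pts S 0 0 w \<Longrightarrow> 0 \<le> x \<and> x \<le> int (length w) \<and> 0 \<le> y \<and> y \<le> int (length w)" by (rule pts_bounds)
      show "\<And>x y. (x, y) \<in> pts S 0 0 v \<Longrightarrow> 0 \<le> x \<and> x \<le> int (length w) \<and> 0 \<le> y \<and> y \<le> int (length w)"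
        using pts_bounds[of _ _ S v] eq2_length[OF e] by simp
      show "0 \<le> na u \<and> na u \<le> int (length w) \<and> 0 \<le> nb u \<and> nb u \<le> int (length w)"
        using pts_bounds[of "na u" "nb u" S w] w by (auto simp: pts_iff)
      show "(na u', nb u') \<in> pts S 0 0 v" using that by (auto simp: pts_iff)
      show "a * na u + b * nb u \<le> a * na u' + b * nb u'" using that by (simp add: val_def)
      fix x y assume "(x, y) \<in> pts S 0 0 w" "(x, y) \<noteq> (na u, nb u)"
      then obtain u1 x1 where "w = u1 @ S # x1" "x = na u1" "y = nb u1" "u1 \<noteq> u" by (auto simp: pts_iff)
      then show "a * x + b * y < a * na u + b * nb u" using s by (auto simp: strict_def val_def)
    qed
    then show ?thesis by simp
  qed
  obtain u' x' where v: "v = u' @ S # x'" "val a b u \<le> val a b u'"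
    using dom1D[of w v u S x a b] e w unfolding eq2_def by blast
  have c: "na u' = na u \<and> nb u' = nb u" using common[OF v] .
  have "val a b u1 < val a b u'" if "v = u1 @ S # x1" "u1 \<noteq> u'" for u1 x1
  proof (rule ccontr)
    assume "\<not> val a b u1 < val a b u'"
    then have "val a b u \<le> val a b u1" using v(2) by simp
    then have "na u1 = na u \<and> nb u1 = nb u" using common that(1) by blast
    then show False using prefix_unique[of u1 "S # x1" u' "S # x'"] that v(1) c by simp
  qed
  then have "strict v S a b u'" using v(1) by (auto simp: strict_def)
  then show ?thesis using c by blast
qed

definition equiv3 :: "bool list \<Rightarrow> bool list \<Rightarrow> bool" where
  "equiv3 w v \<longleftrightarrow> eq2 w v \<and> dom2 w v \<and> dom2 v w"

lemma ident_equiv3: "ident w v \<Longrightarrow> equiv3 w v"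
  unfolding equiv3_def eq2_def
  by (metis ident_dom1 ident_dom2 ident_na_nb ident_sym)

definition vsim :: "bool list \<Rightarrow> bool list \<Rightarrow> bool" where
  "vsim w v \<longleftrightarrow> eq2 w v \<and> (\<forall>S a b u x. strict w S a b u \<longrightarrow> w = u @ S # x \<longrightarrow>
     (\<exists>u' x'. v = u' @ S # x' \<and> eq2 u u' \<and> eq2 x x'))"

lemma val_bound: "length u \<le> n \<Longrightarrow> \<bar>val p q u\<bar> \<le> (\<bar>p\<bar> + \<bar>q\<bar>) * int n"
proof -
  assume l: "length u \<le> n"
  have "\<bar>val p q u\<bar> \<le> \<bar>p\<bar> * na u + \<bar>q\<bar> * nb u"
    unfolding val_def by (metis abs_mult abs_of_nonneg abs_triangle_ineq na_nonneg nb_nonneg)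
  also have "\<dots> \<le> \<bar>p\<bar> * int n + \<bar>q\<bar> * int n"
    using na_nb_length[of u] na_nonneg[of u] nb_nonneg[of u] l
    by (intro add_mono mult_left_mono) (auto simp del: na_nonneg nb_nonneg)
  finally show ?thesis by (simp add: algebra_simps)
qed

lemma equiv3_tails:
  assumes d: "dom2 w v" and w: "w = u @ S # x" and v: "v = u' @ S # x'" and s: "strict v S a b u'"
    and c: "na u' = na u" "nb u' = nb u" and l: "length w = length v"
  shows "dom1 x x'"
  unfolding dom1_def
proof (intro allI impI)
  fix T p q y z assume x: "x = y @ T # z"
  define K where "K = 2 * ((\<bar>p\<bar> + \<bar>q\<bar>) * int (length w)) + 1"
  have "w = u @ S # y @ T # z" by (simp add: w x)
  then obtain u1 y1 z1 where v1: "v = u1 @ S # y1 @ T # z1"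
      and le: "val (K * a) (K * b) u + val p q y \<le> val (K * a) (K * b) u1 + val p q y1"
    using d unfolding dom2_def by blast
  have K: "val (K * a) (K * b) z = K * val a b z" for z by (simp add: val_def algebra_simps)
  have "length y \<le> length w" "length y1 \<le> length w" using w x v1 l by auto
  then have b: "\<bar>val p q y\<bar> \<le> (\<bar>p\<bar> + \<bar>q\<bar>) * int (length w)" "\<bar>val p q y1\<bar> \<le> (\<bar>p\<bar> + \<bar>q\<bar>) * int (length w)"
    by (auto intro: val_bound)
  have ve: "val a b u' = val a b u" using c by (simp add: val_def)
  have "u1 = u'"
  proof (rule ccontr)
    assume "u1 \<noteq> u'"
    then have "val a b u1 + 1 \<le> val a b u" using s v1 ve by (auto simp: strict_def)
    moreover have "0 \<le> K" by (simp add: K_def)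
    ultimately have "K * (val a b u1 + 1) \<le> K * val a b u" by (intro mult_left_mono) auto
    then have "K \<le> val p q y1 - val p q y" using le by (simp add: K algebra_simps)
    then show False using b unfolding K_def by linarith
  qed
  then show "\<exists>u' x''. x' = u' @ T # x'' \<and> val p q y \<le> val p q u'"
    using v1 v le c ve by (auto simp: K)
qed

lemma equiv3_heads:
  assumes d: "dom2 w v" and w: "w = u @ S # x" and v: "v = u' @ S # x'" and s: "strict v S a b u'"
    and c: "na u' = na u" "nb u' = nb u" and l: "length w = length v"
  shows "dom1 u u'"
  unfolding dom1_def
proof (intro allI impI)
  fix T p q y z assume x: "u = y @ T # z"
  define K where "K = 2 * ((\<bar>p\<bar> + \<bar>q\<bar>) * int (length w)) + 1"
  have "w = y @ T # z @ S # x" by (simp add: w x)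
  then obtain y1 z1 x1 where v1: "v = y1 @ T # z1 @ S # x1"
      and le: "val (K * a + p) (K * b + q) y + val (K * a) (K * b) z \<le> val (K * a + p) (K * b + q) y1 + val (K * a) (K * b) z1"
    using d unfolding dom2_def by blast
  define u1 where "u1 = y1 @ T # z1"
  have le': "K * val a b u + val p q y \<le> K * val a b u1 + val p q y1"
    using le by (simp add: val_def u1_def x algebra_simps)
  have "length y \<le> length w" "length y1 \<le> length w" using w x v1 l by auto
  then have b: "\<bar>val p q y\<bar> \<le> (\<bar>p\<bar> + \<bar>q\<bar>) * int (length w)" "\<bar>val p q y1\<bar> \<le> (\<bar>p\<bar> + \<bar>q\<bar>) * int (length w)"
    by (auto intro: val_bound)
  have ve: "val a b u' = val a b u" using c by (simp add: val_def)
  have "u1 = u'"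
  proof (rule ccontr)
    assume "u1 \<noteq> u'"
    moreover have "v = u1 @ S # x1" by (simp add: v1 u1_def)
    ultimately have "val a b u1 + 1 \<le> val a b u" using s ve by (auto simp: strict_def)
    moreover have "0 \<le> K" by (simp add: K_def)
    ultimately have "K * (val a b u1 + 1) \<le> K * val a b u" by (intro mult_left_mono) auto
    then have "K \<le> val p q y1 - val p q y" using le' by (simp add: algebra_simps)
    then show False using b unfolding K_def by linarith
  qed
  then show "\<exists>y' z'. u' = y' @ T # z' \<and> val p q y \<le> val p q y'"
    using le' ve unfolding u1_def by auto
qed

lemma equiv3_vsim:
  assumes e: "equiv3 w v"
  shows "vsim w v"
  unfolding vsim_def
proof (intro conjI allI impI)
  show e2: "eq2 w v" using e by (simp add: equiv3_def)
  have l: "length w = length v" using eq2_length[OF e2] .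
  fix S a b u x assume s: "strict w S a b u" and w: "w = u @ S # x"
  obtain u' where c: "na u' = na u" "nb u' = nb u" and s': "strict v S a b u'" using strict_transfer[OF e2 s] by blast
  then obtain x' where v: "v = u' @ S # x'" by (auto simp: strict_def)
  have d: "dom2 w v" "dom2 v w" using e by (auto simp: equiv3_def)
  have cx: "na x = na x'" "nb x = nb x'" using e2 c by (auto simp: eq2_def w v split: if_splits)
  have "eq2 u u'" unfolding eq2_def
    using equiv3_heads[OF d(1) w v s' c l] equiv3_heads[OF d(2) v w s c[symmetric] l[symmetric]] c by simp
  moreover have "eq2 x x'" unfolding eq2_def
    using equiv3_tails[OF d(1) w v s' c l] equiv3_tails[OF d(2) v w s c[symmetric] l[symmetric]] cx by simp
  ultimately show "\<exists>u' x'. v = u' @ S # x' \<and> eq2 u u' \<and> eq2 x x'" using v by blast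
qed

lemma vsim_sym: "vsim w v \<Longrightarrow> vsim v w"
  unfolding vsim_def
proof (intro conjI allI impI; elim conjE)
  assume e: "eq2 w v"
  then show "eq2 v w" by (rule eq2_sym)
  assume h: "\<forall>S a b u x. strict w S a b u \<longrightarrow> w = u @ S # x \<longrightarrow> (\<exists>u' x'. v = u' @ S # x' \<and> eq2 u u' \<and> eq2 x x')"
  fix S a b u x assume s: "strict v S a b u" and v: "v = u @ S # x"
  obtain u' where c: "na u' = na u" "nb u' = nb u" and s': "strict w S a b u'" using strict_transfer[OF eq2_sym[OF e] s] by blast
  then obtain x' where w: "w = u' @ S # x'" by (auto simp: strict_def)
  obtain u2 x2 where v2: "v = u2 @ S # x2" "eq2 u' u2" "eq2 x' x2" using h s' w by blast
  have "u2 = u" using prefix_unique[of u2 "S # x2" u "S # x"] v2 v c by (auto simp: eq2_def)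
  then show "\<exists>u' x'. w = u' @ S # x' \<and> eq2 u u' \<and> eq2 x x'"
    using v2 v w by (auto intro: eq2_sym)
qed

lemma vsim_trans: "vsim w v \<Longrightarrow> vsim v z \<Longrightarrow> vsim w z"
  unfolding vsim_def
proof (intro conjI allI impI; elim conjE)
  assume e: "eq2 w v" "eq2 v z"
  then show "eq2 w z" by (rule eq2_trans)
  assume h: "\<forall>S a b u x. strict w S a b u \<longrightarrow> w = u @ S # x \<longrightarrow> (\<exists>u' x'. v = u' @ S # x' \<and> eq2 u u' \<and> eq2 x x')"
    and h': "\<forall>S a b u x. strict v S a b u \<longrightarrow> v = u @ S # x \<longrightarrow> (\<exists>u' x'. z = u' @ S # x' \<and> eq2 u u' \<and> eq2 x x')"
  fix S a b u x assume s: "strict w S a b u" and w: "w = u @ S # x"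
  obtain u' x' where v: "v = u' @ S # x'" "eq2 u u'" "eq2 x x'" using h s w by blast
  obtain u2 where c: "na u2 = na u" "nb u2 = nb u" and s': "strict v S a b u2" using strict_transfer[OF e(1) s] by blast
  then obtain x2 where "v = u2 @ S # x2" by (auto simp: strict_def)
  then have "u2 = u'" using prefix_unique[of u2 "S # x2" u' "S # x'"] v c by (auto simp: eq2_def)
  then obtain u3 x3 where "z = u3 @ S # x3" "eq2 u' u3" "eq2 x' x3" using h' s' v(1) by blast
  then show "\<exists>u' x'. z = u' @ S # x' \<and> eq2 u u' \<and> eq2 x x'" using v by (blast intro: eq2_trans)
qed

lemma vsim_swap:
  assumes e: "vsim w v" and w: "w = p @ replicate (Suc i) False @ True # x" and v: "v = p @ True # v'"
  shows "vsim w (p @ replicate i False @ True # False # x)"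
  unfolding vsim_def
proof (intro conjI allI impI)
  let ?g = "p @ replicate i False @ True # False # x"
  have e2: "eq2 w v" using e by (simp add: vsim_def)
  show "eq2 w ?g" using eq2_swap[OF e2 w v] .
  fix S a b u y assume s: "strict w S a b u" and wu: "w = u @ S # y"
  obtain u' y' where v': "v = u' @ S # y'" and eu: "eq2 u u'" and ey: "eq2 y y'"
    using e s wu unfolding vsim_def by blast
  have lu: "length u' = length u" using eq2_length[OF eu] by simp
  have nar: "na (replicate i False) = int i" "nb (replicate i False) = 0" for i by (induction i) auto
  consider "length u < length p" | "length p \<le> length u" "length u \<le> length p + Suc i" | "length p + Suc i < length u" by linarith
  then show "\<exists>u' x'. ?g = u' @ S # x' \<and> eq2 u u' \<and> eq2 y x'"
  proof cases
    case 1
    obtain us where us: "p = u @ us \<and> us @ replicate (Suc i) False @ True # x = S # y"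
      using wu w 1 by (auto simp: append_eq_append_conv2)
    moreover have "us \<noteq> []" using 1 us by auto
    ultimately obtain p2 where p: "p = u @ S # p2" by (cases us) auto
    have "u' = u" using v' v p lu by simp
    then have "y' = p2 @ True # v'" using v' v p by simp
    moreover have "y = p2 @ replicate (Suc i) False @ True # x" using wu w p by simp
    ultimately have "eq2 y (p2 @ replicate i False @ True # False # x)" using eq2_swap[OF ey] by blast
    then show ?thesis using p by (metis append_Cons append_assoc eq2_refl)
  next
    case 2
    have pv: "p @ True # v' = u' @ S # y'" "p @ True # v' = (u' @ [S]) @ y'" using v v' by auto
    have False
    proof (cases "length u = length p + Suc i")
      case True
      have "u = take (length u) w" by (simp add: wu)
      then have "u = p @ replicate (Suc i) False" by (simp add: w True)
      then have "nb u = nb p" by (simp add: nar del: replicate.simps)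
      then show False using prefix_past_step[OF pv(1)] True lu eu by (simp add: eq2_def)
    next
      case False
      have "u @ [S] = take (Suc (length u)) w" by (simp add: wu)
      also have "\<dots> = p @ replicate (Suc (length u) - length p) False" using 2 False
        by (simp add: w min_def del: replicate.simps)
      finally have "nb (u @ [S]) = nb (p @ replicate (Suc (length u) - length p) False)" by (rule arg_cong)
      then show False using prefix_past_step[OF pv(2)] 2 lu eu by (simp add: eq2_def nar del: replicate.simps)
    qed
    then show ?thesis ..
  next
    case 3
    have "u = take (length u) w" by (simp add: wu)
    then have u: "u = p @ replicate (Suc i) False @ True # take (length u - length p - Suc (Suc i)) x"
      using 3 by (simp add: w take_Cons' del: replicate.simps)
    have "u' = take (length u) v" using v' lu by simp
    then have u': "u' = p @ True # take (length u - length p - 1) v'" using 3 by (simp add: v take_Cons')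
    define x1 where "x1 = take (length u - length p - Suc (Suc i)) x"
    have "x = x1 @ S # y" using wu w u unfolding x1_def[symmetric]
      by simp
    then have "?g = (p @ replicate i False @ True # False # x1) @ S # y" by simp
    moreover have "eq2 u (p @ replicate i False @ True # False # x1)"
      using eq2_swap[OF eu u[folded x1_def] u'] .
    ultimately show ?thesis by (metis eq2_refl)
  qed
qed

lemma adjacent_exists:
  assumes "vsim w v" "w = p @ replicate (Suc i) False @ True # x" "v = p @ True # v'"
  shows "vsim (p @ False # True # replicate i False @ x) (p @ True # False # replicate i False @ x)"
  using assms
proof (induction i arbitrary: w x)
  case 0
  from vsim_swap[OF this] show ?case using 0 by simp
next
  case (Suc i)
  let ?g = "p @ replicate (Suc i) False @ True # False # x"
  have "vsim w ?g" using vsim_swap[OF Suc.prems] .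
  then have "vsim ?g v" using Suc.prems(1) vsim_sym vsim_trans by blast
  from Suc.IH[OF this refl Suc.prems(3)] show ?case by (simp add: replicate_app_Cons_same)
qed

type_synonym target = "bool \<times> int \<times> int \<times> int \<times> int"

fun hits :: "target \<Rightarrow> bool list \<Rightarrow> bool" where
  "hits (L, a, b, m, h) w \<longleftrightarrow> (\<exists>u x. w = u @ L # x \<and> h \<le> val a b u)"
fun wf_target :: "target \<Rightarrow> bool" where
  "wf_target (L, a, b, m, h) \<longleftrightarrow> a \<le> m \<and> b \<le> m \<and> 0 \<le> m"

fun target :: "bool \<Rightarrow> int \<Rightarrow> int \<Rightarrow> int \<Rightarrow> target" where
  "target L a b h = (L, a, b, max 0 (max a b), h - (a + b))"

lemma wf_target [simp]: "wf_target (target L a b h)" by auto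

fun pick :: "bool \<Rightarrow> 'x \<Rightarrow> 'x \<Rightarrow> 'x" where "pick True x y = x" | "pick False x y = y"

lemma pick_if: "pick c x y = (if c then x else y)" by (cases c) auto

fun steeper :: "bool \<Rightarrow> int \<Rightarrow> int \<Rightarrow> int \<times> int \<Rightarrow> int \<times> int" where
  "steeper True x y (vx, vy) = pick (vy * x < vx * y) (x, y) (vx, vy)"
| "steeper False x y (vx, vy) = pick (vx * y < vy * x) (x, y) (vx, vy)"

primrec steep :: "bool \<Rightarrow> bool \<Rightarrow> bool list \<Rightarrow> int \<Rightarrow> int \<Rightarrow> int \<times> int \<Rightarrow> int \<times> int" where
  "steep up L [] x y v = v"
| "steep up L (t # w) x y v = steep up L w (pick t x (x - 1)) (pick t (y - 1) y) (pick (t = L) (steeper up x y v) v)"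

fun above_A :: "int \<times> int \<Rightarrow> target" where "above_A (ux, uy) = target False uy (- ux) 0"
fun below_A :: "int \<times> int \<Rightarrow> target" where "below_A (ux, uy) = target False (- uy) ux ux"
fun above_B :: "int \<times> int \<Rightarrow> target" where "above_B (ux, uy) = target True (- uy) ux 0"
fun below_B :: "int \<times> int \<Rightarrow> target" where "below_B (ux, uy) = target True uy (- ux) uy"

fun bump :: "bool \<Rightarrow> int \<times> int \<Rightarrow> int \<times> int" where "bump True (x, y) = (x, y + 1)" | "bump False (x, y) = (x + 1, y)"
fun endpoint :: "bool list \<Rightarrow> int \<times> int" where
  "endpoint [] = (0, 0)"
| "endpoint (t # w) = bump t (endpoint w)"

lemma endpoint_eq: "endpoint w = (na w, nb w)"
proof (induction w)
  case (Cons t w)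
  then show ?case by (cases t) auto
qed simp

fun cores_at :: "bool list \<Rightarrow> int \<times> int \<Rightarrow> target list" where "cores_at p (x, y) =
  [above_A (steep True False p x y (1, 0)), below_A (steep False False p x (y + 1) (0, 1)),
   above_B (steep False True p x y (0, 1)), below_B (steep True True p (x + 1) y (1, 0))]"
fun cores :: "bool list \<Rightarrow> target list" where "cores p = cores_at p (endpoint p)"

lemma wf_sides: "wf_target (above_A u)" "wf_target (below_A u)" "wf_target (above_B u)" "wf_target (below_B u)"
  by (cases u; simp only: above_A.simps below_A.simps above_B.simps below_B.simps wf_target)+

lemma wf_cores: "r \<in> set (cores p) \<Longrightarrow> wf_target r"
  by (auto simp: endpoint_eq wf_sides simp del: wf_target.simps above_A.simps below_A.simps above_B.simps below_B.simps)

lemma steep_simps: "steep up L (t # w) x y v = steep up L w (if t then x else x - 1) (if t then y - 1 else y) (if t = L then steeper up x y v else v)"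
  by (simp add: pick_if)

lemma separation:
  fixes ux uy :: int
  assumes dom: "\<And>a b. \<exists>x y. (x, y) \<in> G \<and> a * r1 + b * r2 \<le> a * x + b * y"
    and G: "\<And>x y. (x, y) \<in> G \<Longrightarrow> (x, y) \<notin> B \<Longrightarrow> 0 \<le> s * (ux * (r2 - y) - uy * (r1 - x)) \<and> 0 < t1 * (r1 - x) + t2 * (r2 - y)"
    and N: "\<And>x y. (x, y) \<in> B \<Longrightarrow> t1 * (x - r1) + t2 * (y - r2) \<le> N"
  shows "\<exists>x y. (x, y) \<in> B \<and> 0 \<le> s * (ux * (y - r2) - uy * (x - r1))"
proof (rule ccontr)
  assume no: "\<not> ?thesis"
  define K where "K = \<bar>N\<bar> + 1"
  define a b where "a = t1 - K * s * uy" and "b = t2 + K * s * ux"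
  obtain x y where xy: "(x, y) \<in> G" and le: "a * r1 + b * r2 \<le> a * x + b * y" using dom by blast
  have e: "a * x + b * y - (a * r1 + b * r2) =
      K * (s * (ux * (y - r2) - uy * (x - r1))) + (t1 * (x - r1) + t2 * (y - r2))"
    by (simp add: a_def b_def algebra_simps)
  have K: "0 \<le> K" "N < K" by (auto simp: K_def)
  show False
  proof (cases "(x, y) \<in> B")
    case True
    then have "s * (ux * (y - r2) - uy * (x - r1)) \<le> -1" using no by force
    then have "K * (s * (ux * (y - r2) - uy * (x - r1))) \<le> K * (-1)" using K(1) by (rule mult_left_mono)
    then show False using e le N[OF True] K by linarith
  next
    case False
    note g = G[OF xy False]
    have "s * (ux * (y - r2) - uy * (x - r1)) = - (s * (ux * (r2 - y) - uy * (r1 - x)))" by (simp add: algebra_simps)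
    then have "s * (ux * (y - r2) - uy * (x - r1)) \<le> 0" using g by linarith
    then have "K * (s * (ux * (y - r2) - uy * (x - r1))) \<le> 0" by (rule mult_nonneg_nonpos[OF K(1)])
    moreover have "t1 * (x - r1) + t2 * (y - r2) = - (t1 * (r1 - x) + t2 * (r2 - y))" by (simp add: algebra_simps)
    ultimately show False using e le g by linarith
  qed
qed

text \<open>steepest\<close>

lemma steep_up:
  assumes "1 \<le> vx" "0 \<le> vy" and "\<And>u z. w = u @ L # z \<Longrightarrow> 1 \<le> x - na u \<and> 0 \<le> y - nb u"
    and "steep True L w x y (vx, vy) = (ux, uy)"
  shows "1 \<le> ux \<and> 0 \<le> uy \<and> ux * vy \<le> uy * vx \<and> (\<forall>u z. w = u @ L # z \<longrightarrow> ux * (y - nb u) \<le> uy * (x - na u))"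
  using assms
proof (induction w arbitrary: x y vx vy)
  case (Cons t w)
  define v' where "v' = (if t = L then steeper True x y (vx, vy) else (vx, vy))"
  obtain vx' vy' where v': "v' = (vx', vy')" by (cases v')
  have t: "t = L \<Longrightarrow> 1 \<le> x \<and> 0 \<le> y" using Cons.prems(3)[of "[]" w] by auto
  have v'1: "1 \<le> vx'" "0 \<le> vy'" "vx' * vy \<le> vy' * vx" "t = L \<Longrightarrow> vx' * y \<le> vy' * x"
    using v' Cons.prems(1,2) t unfolding v'_def
    by (auto simp: pick_if algebra_simps split: if_splits)
  have ih: "1 \<le> ux \<and> 0 \<le> uy \<and> ux * vy' \<le> uy * vx' \<and> (\<forall>u z. w = u @ L # z \<longrightarrow>
      ux * ((if t then y - 1 else y) - nb u) \<le> uy * ((if t then x else x - 1) - na u))"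
  proof (rule Cons.IH)
    show "1 \<le> vx'" "0 \<le> vy'" using v'1 by auto
    show "steep True L w (if t then x else x - 1) (if t then y - 1 else y) (vx', vy') = (ux, uy)"
      using Cons.prems(4)[unfolded steep_simps, folded v'_def] v' by simp
    fix u z assume "w = u @ L # z"
    then have "t # w = (t # u) @ L # z" by simp
    from Cons.prems(3)[OF this] show "1 \<le> (if t then x else x - 1) - na u \<and> 0 \<le> (if t then y - 1 else y) - nb u" by (auto split: if_splits)
  qed
  have trans: "ux * q \<le> uy * p" if "vx' * q \<le> vy' * p" "0 \<le> p" for p q
  proof -
    have "vx' * (ux * q) = ux * (vx' * q)" by simp
    also have "\<dots> \<le> ux * (vy' * p)" using that ih by (intro mult_left_mono) auto
    also have "\<dots> = (ux * vy') * p" by simp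
    also have "\<dots> \<le> (uy * vx') * p" using that ih by (intro mult_right_mono) auto
    also have "\<dots> = vx' * (uy * p)" by simp
    finally show ?thesis using v'1(1) by (simp add: mult_le_cancel_left)
  qed
  have "ux * (y - nb u) \<le> uy * (x - na u)" if uz: "t # w = u @ L # z" for u z
  proof (cases u)
    case Nil
    then have "t = L" using uz by simp
    then show ?thesis using trans[of y x] v'1(4) t Nil by simp
  next
    case (Cons t' u')
    then have "w = u' @ L # z" "t' = t" using uz by auto
    with ih have "ux * ((if t then y - 1 else y) - nb u') \<le> uy * ((if t then x else x - 1) - na u')" by blast
    then show ?thesis using Cons \<open>t' = t\<close> by (simp add: algebra_simps split: if_splits)
  qed
  moreover have "ux * vy \<le> uy * vx" using trans[of vy vx] v'1(3) Cons.prems(1) by simp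
  ultimately show ?case using ih by blast
qed simp

lemma steep_down:
  assumes "0 \<le> vx" "1 \<le> vy" and "\<And>u z. w = u @ L # z \<Longrightarrow> 0 \<le> x - na u \<and> 1 \<le> y - nb u"
    and "steep False L w x y (vx, vy) = (ux, uy)"
  shows "0 \<le> ux \<and> 1 \<le> uy \<and> uy * vx \<le> ux * vy \<and> (\<forall>u z. w = u @ L # z \<longrightarrow> uy * (x - na u) \<le> ux * (y - nb u))"
  using assms
proof (induction w arbitrary: x y vx vy)
  case (Cons t w)
  define v' where "v' = (if t = L then steeper False x y (vx, vy) else (vx, vy))"
  obtain vx' vy' where v': "v' = (vx', vy')" by (cases v')
  have t: "t = L \<Longrightarrow> 0 \<le> x \<and> 1 \<le> y" using Cons.prems(3)[of "[]" w] by auto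
  have v'1: "0 \<le> vx'" "1 \<le> vy'" "vy' * vx \<le> vx' * vy" "t = L \<Longrightarrow> vy' * x \<le> vx' * y"
    using v' Cons.prems(1,2) t unfolding v'_def
    by (auto simp: pick_if algebra_simps split: if_splits)
  have ih: "0 \<le> ux \<and> 1 \<le> uy \<and> uy * vx' \<le> ux * vy' \<and> (\<forall>u z. w = u @ L # z \<longrightarrow>
      uy * ((if t then x else x - 1) - na u) \<le> ux * ((if t then y - 1 else y) - nb u))"
  proof (rule Cons.IH)
    show "0 \<le> vx'" "1 \<le> vy'" using v'1 by auto
    show "steep False L w (if t then x else x - 1) (if t then y - 1 else y) (vx', vy') = (ux, uy)"
      using Cons.prems(4)[unfolded steep_simps, folded v'_def] v' by simp
    fix u z assume "w = u @ L # z"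
    then have "t # w = (t # u) @ L # z" by simp
    from Cons.prems(3)[OF this] show "0 \<le> (if t then x else x - 1) - na u \<and> 1 \<le> (if t then y - 1 else y) - nb u" by (auto split: if_splits)
  qed
  have trans: "uy * p \<le> ux * q" if "vy' * p \<le> vx' * q" "0 \<le> q" for p q
  proof -
    have "vy' * (uy * p) = uy * (vy' * p)" by simp
    also have "\<dots> \<le> uy * (vx' * q)" using that ih by (intro mult_left_mono) auto
    also have "\<dots> = (uy * vx') * q" by simp
    also have "\<dots> \<le> (ux * vy') * q" using that ih by (intro mult_right_mono) auto
    also have "\<dots> = vy' * (ux * q)" by simp
    finally show ?thesis using v'1(2) by (simp add: mult_le_cancel_left)
  qed
  have "uy * (x - na u) \<le> ux * (y - nb u)" if uz: "t # w = u @ L # z" for u z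
  proof (cases u)
    case Nil
    then have "t = L" using uz by simp
    then show ?thesis using trans[of x y] v'1(4) t Nil by simp
  next
    case (Cons t' u')
    then have "w = u' @ L # z" "t' = t" using uz by auto
    with ih have "uy * ((if t then x else x - 1) - na u') \<le> ux * ((if t then y - 1 else y) - nb u')" by blast
    then show ?thesis using Cons \<open>t' = t\<close> by (simp add: algebra_simps split: if_splits)
  qed
  moreover have "uy * vx \<le> ux * vy" using trans[of vx vy] v'1(3) Cons.prems(2) by simp
  ultimately show ?case using ih by blast
qed simp

lemma cores_hit:
  assumes e: "eq2 (p @ False # True # s) (p @ True # False # s)" (is "eq2 ?w ?g")
    and r: "r \<in> set (cores p)"
  shows "hits r s"
proof -
  let ?X = "na p" and ?Y = "nb p"
  have d: "dominated (pts S (- ?X) (- ?Y) ?w) (pts S (- ?X) (- ?Y) ?g)"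
     "dominated (pts S (- ?X) (- ?Y) ?g) (pts S (- ?X) (- ?Y) ?w)" for S
    using e unfolding eq2_def dom1_dominated[of _ _ "- ?X" "- ?Y"] by auto
  have wg: "pts S (- ?X) (- ?Y) ?w = pts S (- ?X) (- ?Y) p \<union> (if S then {(1, 0)} else {(0, 0)}) \<union> pts S 1 1 s"
    "pts S (- ?X) (- ?Y) ?g = pts S (- ?X) (- ?Y) p \<union> (if S then {(0, 0)} else {(0, 1)}) \<union> pts S 1 1 s" for S by auto
  have before: "x = - (?X - na u) \<and> y = - (?Y - nb u)" if "x = - ?X + na u" "y = - ?Y + nb u" for x y u
    using that by simp
  have pA: "1 \<le> ?X - na u \<and> 0 \<le> ?Y - nb u" if "p = u @ False # z" for u z
    using that by simp
  have pB: "0 \<le> ?X - na u \<and> 1 \<le> ?Y - nb u" if "p = u @ True # z" for u z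
    using that by simp
  have aft: "\<exists>u z. s = u @ S # z \<and> x = 1 + na u \<and> y = 1 + nb u" if "(x, y) \<in> pts S 1 1 s" for S x y
    using that by (simp add: pts_iff)
  have bnd: "x \<le> 1 + int (length s)" "y \<le> 1 + int (length s)" if "(x, y) \<in> pts S 1 1 s" for S x y
  proof -
    obtain u z where "s = u @ S # z \<and> x = 1 + na u \<and> y = 1 + nb u" using aft[OF \<open>(x, y) \<in> pts S 1 1 s\<close>] by blast
    then show "x \<le> 1 + int (length s)" "y \<le> 1 + int (length s)" using na_nb_length[of u] na_nonneg[of u] nb_nonneg[of u]
      by (auto simp del: na_nonneg nb_nonneg)
  qed
  obtain a1 a2 where a: "steep True False p ?X ?Y (1, 0) = (a1, a2)" by (metis surj_pair)
  obtain b1 b2 where b: "steep False False p ?X (?Y + 1) (0, 1) = (b1, b2)" by (metis surj_pair)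
  obtain c1 c2 where c: "steep False True p ?X ?Y (0, 1) = (c1, c2)" by (metis surj_pair)
  obtain d1 d2 where dd: "steep True True p (?X + 1) ?Y (1, 0) = (d1, d2)" by (metis surj_pair)
  have "hits (above_A (a1, a2)) s"
  proof -
    have st: "1 \<le> a1 \<and> 0 \<le> a2 \<and> (\<forall>u z. p = u @ False # z \<longrightarrow> a1 * (?Y - nb u) \<le> a2 * (?X - na u))"
      using steep_up[of 1 0 p False ?X ?Y a1 a2] pA a by auto
    have "\<exists>x y. (x, y) \<in> insert (0, 1) (pts False 1 1 s) \<and> 0 \<le> -1 * (a1 * (y - 0) - a2 * (x - 0))"
    proof (rule separation[where G = "pts False (- ?X) (- ?Y) ?g" and N = "1 + int (length s)" and ?t1.0 = 1 and ?t2.0 = 0])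
      show "\<exists>x y. (x, y) \<in> pts False (- ?X) (- ?Y) ?g \<and> a * 0 + b * 0 \<le> a * x + b * y" for a b
        using dominatedD[OF d(1)[of False], of 0 0 a b] by (simp add: wg)
    next
      fix x y assume "(x, y) \<in> pts False (- ?X) (- ?Y) ?g" "(x, y) \<notin> insert (0, 1) (pts False 1 1 s)"
      then obtain u z where u: "p = u @ False # z" "x = - ?X + na u" "y = - ?Y + nb u" unfolding wg by (auto simp: pts_iff)
      then have k: "a1 * (?Y - nb u) \<le> a2 * (?X - na u)" "1 \<le> ?X - na u" using st pA by blast+
      have e: "0 - x = ?X - na u" "0 - y = ?Y - nb u" using u by auto
      show "0 \<le> -1 * (a1 * (0 - y) - a2 * (0 - x)) \<and> 0 < 1 * (0 - x) + 0 * (0 - y)"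
        unfolding e using k by simp
    next
      fix x y assume "(x, y) \<in> insert (0, 1) (pts False 1 1 s)"
      then show "1 * (x - 0) + 0 * (y - 0) \<le> 1 + int (length s)" using bnd(1)[of x y False] by auto
    qed
    then obtain x y where xy: "(x, y) \<in> pts False 1 1 s" "a1 * y \<le> a2 * x" using st by auto
    then obtain u z where "s = u @ False # z" "x = 1 + na u" "y = 1 + nb u" using aft by blast
    then show ?thesis using xy(2) by (auto simp: val_def algebra_simps)
  qed
  moreover have "hits (below_A (b1, b2)) s"
  proof -
    have st: "0 \<le> b1 \<and> 1 \<le> b2 \<and> (\<forall>u z. p = u @ False # z \<longrightarrow> b2 * (?X - na u) \<le> b1 * (?Y + 1 - nb u))"
      using steep_down[of 0 1 p False ?X "?Y + 1" b1 b2] pA b by force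
    have "\<exists>x y. (x, y) \<in> pts False 1 1 s \<and> 0 \<le> 1 * (b1 * (y - 1) - b2 * (x - 0))"
    proof (rule separation[where G = "pts False (- ?X) (- ?Y) ?w" and N = "1 + int (length s)" and ?t1.0 = 0 and ?t2.0 = 1])
      show "\<exists>x y. (x, y) \<in> pts False (- ?X) (- ?Y) ?w \<and> a * 0 + b * 1 \<le> a * x + b * y" for a b
        using dominatedD[OF d(2)[of False], of 0 1 a b] by (simp add: wg)
    next
      fix x y assume "(x, y) \<in> pts False (- ?X) (- ?Y) ?w" "(x, y) \<notin> pts False 1 1 s"
      then consider "x = 0" "y = 0" | u z where "p = u @ False # z" "x = - ?X + na u" "y = - ?Y + nb u" unfolding wg by (auto simp: pts_iff)
      then show "0 \<le> 1 * (b1 * (1 - y) - b2 * (0 - x)) \<and> 0 < 0 * (0 - x) + 1 * (1 - y)"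
      proof cases
        case 1
        then show ?thesis using st by simp
      next
        case (2 u z)
        then have k: "b2 * (?X - na u) \<le> b1 * (?Y + 1 - nb u)" "0 \<le> ?Y - nb u" using st pA by blast+
        have e: "0 - x = ?X - na u" "1 - y = ?Y + 1 - nb u" using 2 by auto
        show ?thesis unfolding e using k by simp
      qed
    next
      fix x y assume "(x, y) \<in> pts False 1 1 s"
      then show "0 * (x - 0) + 1 * (y - 1) \<le> 1 + int (length s)" using bnd(2)[of x y False] by auto
    qed
    then obtain x y where xy: "(x, y) \<in> pts False 1 1 s" "b2 * x \<le> b1 * (y - 1)" by auto
    then obtain u z where "s = u @ False # z" "x = 1 + na u" "y = 1 + nb u" using aft by blast
    then show ?thesis using xy(2) by (auto simp: val_def algebra_simps)
  qed
  moreover have "hits (above_B (c1, c2)) s"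
  proof -
    have st: "0 \<le> c1 \<and> 1 \<le> c2 \<and> (\<forall>u z. p = u @ True # z \<longrightarrow> c2 * (?X - na u) \<le> c1 * (?Y - nb u))"
      using steep_down[of 0 1 p True ?X ?Y c1 c2] pB c by auto
    have "\<exists>x y. (x, y) \<in> insert (1, 0) (pts True 1 1 s) \<and> 0 \<le> 1 * (c1 * (y - 0) - c2 * (x - 0))"
    proof (rule separation[where G = "pts True (- ?X) (- ?Y) ?w" and N = "1 + int (length s)" and ?t1.0 = 0 and ?t2.0 = 1])
      show "\<exists>x y. (x, y) \<in> pts True (- ?X) (- ?Y) ?w \<and> a * 0 + b * 0 \<le> a * x + b * y" for a b
        using dominatedD[OF d(2)[of True], of 0 0 a b] by (simp add: wg)
    next
      fix x y assume "(x, y) \<in> pts True (- ?X) (- ?Y) ?w" "(x, y) \<notin> insert (1, 0) (pts True 1 1 s)"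
      then obtain u z where u: "p = u @ True # z" "x = - ?X + na u" "y = - ?Y + nb u" unfolding wg by (auto simp: pts_iff)
      then have k: "c2 * (?X - na u) \<le> c1 * (?Y - nb u)" "1 \<le> ?Y - nb u" using st pB by blast+
      have e: "0 - x = ?X - na u" "0 - y = ?Y - nb u" using u by auto
      show "0 \<le> 1 * (c1 * (0 - y) - c2 * (0 - x)) \<and> 0 < 0 * (0 - x) + 1 * (0 - y)"
        unfolding e using k by simp
    next
      fix x y assume "(x, y) \<in> insert (1, 0) (pts True 1 1 s)"
      then show "0 * (x - 0) + 1 * (y - 0) \<le> 1 + int (length s)" using bnd(2)[of x y True] by auto
    qed
    then obtain x y where xy: "(x, y) \<in> pts True 1 1 s" "c2 * x \<le> c1 * y" using st by auto
    then obtain u z where "s = u @ True # z" "x = 1 + na u" "y = 1 + nb u" using aft by blast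
    then show ?thesis using xy(2) by (auto simp: val_def algebra_simps)
  qed
  moreover have "hits (below_B (d1, d2)) s"
  proof -
    have st: "1 \<le> d1 \<and> 0 \<le> d2 \<and> (\<forall>u z. p = u @ True # z \<longrightarrow> d1 * (?Y - nb u) \<le> d2 * (?X + 1 - na u))"
      using steep_up[of 1 0 p True "?X + 1" ?Y d1 d2] pB dd by force
    have "\<exists>x y. (x, y) \<in> pts True 1 1 s \<and> 0 \<le> -1 * (d1 * (y - 0) - d2 * (x - 1))"
    proof (rule separation[where G = "pts True (- ?X) (- ?Y) ?g" and N = "1 + int (length s)" and ?t1.0 = 1 and ?t2.0 = 0])
      show "\<exists>x y. (x, y) \<in> pts True (- ?X) (- ?Y) ?g \<and> a * 1 + b * 0 \<le> a * x + b * y" for a b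
        using dominatedD[OF d(1)[of True], of 1 0 a b] by (simp add: wg)
    next
      fix x y assume "(x, y) \<in> pts True (- ?X) (- ?Y) ?g" "(x, y) \<notin> pts True 1 1 s"
      then consider "x = 0" "y = 0" | u z where "p = u @ True # z" "x = - ?X + na u" "y = - ?Y + nb u" unfolding wg by (auto simp: pts_iff)
      then show "0 \<le> -1 * (d1 * (0 - y) - d2 * (1 - x)) \<and> 0 < 1 * (1 - x) + 0 * (0 - y)"
      proof cases
        case 1
        then show ?thesis using st by simp
      next
        case (2 u z)
        then have k: "d1 * (?Y - nb u) \<le> d2 * (?X + 1 - na u)" "0 \<le> ?X - na u" using st pB by blast+
        have e: "1 - x = ?X + 1 - na u" "0 - y = ?Y - nb u" using 2 by auto
        show ?thesis unfolding e using k by simp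
      qed
    next
      fix x y assume "(x, y) \<in> pts True 1 1 s"
      then show "1 * (x - 1) + 0 * (y - 0) \<le> 1 + int (length s)" using bnd(1)[of x y True] by auto
    qed
    then obtain x y where xy: "(x, y) \<in> pts True 1 1 s" "d1 * y \<le> d2 * (x - 1)" by auto
    then obtain u z where "s = u @ True # z" "x = 1 + na u" "y = 1 + nb u" using aft by blast
    then show ?thesis using xy(2) by (auto simp: val_def algebra_simps)
  qed
  moreover have "set (cores p) = {above_A (a1, a2), below_A (b1, b2), above_B (c1, c2), below_B (d1, d2)}"
    by (simp add: endpoint_eq a b c dd del: above_A.simps below_A.simps above_B.simps below_B.simps)
  ultimately show ?thesis using r by (auto simp del: hits.simps above_A.simps below_A.simps above_B.simps below_B.simps cores.simps)
qed

declare target.simps [simp del]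

section \<open>Search\<close>

fun add_if :: "bool \<Rightarrow> target \<Rightarrow> target list \<Rightarrow> target list option" where
  "add_if True r ts = Some (r # ts)"
| "add_if False r ts = None"

fun add_target :: "int \<Rightarrow> target \<Rightarrow> target list \<Rightarrow> target list option" where
  "add_target q (L, a, b, m, h) ts = add_if (h \<le> m * q) (L, a, b, m, h) ts"

fun add_unless :: "bool \<Rightarrow> int \<Rightarrow> target \<Rightarrow> target list \<Rightarrow> target list option" where
  "add_unless True q r ts = Some ts"
| "add_unless False q r ts = add_target q r ts"

fun move :: "bool \<Rightarrow> int \<Rightarrow> target \<Rightarrow> target list option \<Rightarrow> target list option" where
  "move t q r None = None"
| "move True q (True, a, b, m, h) (Some ts) = add_unless (h \<le> 0) q (True, a, b, m, h - b) ts"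
| "move True q (False, a, b, m, h) (Some ts) = add_target q (False, a, b, m, h - b) ts"
| "move False q (True, a, b, m, h) (Some ts) = add_target q (True, a, b, m, h - a) ts"
| "move False q (False, a, b, m, h) (Some ts) = add_unless (h \<le> 0) q (False, a, b, m, h - a) ts"

primrec advance :: "bool \<Rightarrow> int \<Rightarrow> target list \<Rightarrow> target list option \<Rightarrow> target list option" where
  "advance t q [] acc = acc"
| "advance t q (r # rs) acc = advance t q rs (move t q r acc)"

fun put :: "int \<Rightarrow> target \<Rightarrow> target list option \<Rightarrow> target list option" where
  "put q r None = None"
| "put q r (Some ts) = add_target q r ts"

primrec start :: "int \<Rightarrow> target list \<Rightarrow> target list option \<Rightarrow> target list option" where
  "start q [] acc = acc"
| "start q (r # rs) acc = start q rs (put q r acc)"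

fun sweep :: "(bool list \<Rightarrow> bool) \<Rightarrow> nat \<Rightarrow> int \<Rightarrow> target list option \<Rightarrow> bool list \<Rightarrow> bool" where
  "sweep P n q None t = True"
| "sweep P 0 q (Some []) t = P (rev t)"
| "sweep P 0 q (Some (r # rs)) t = True"
| "sweep P (Suc n) q (Some ts) t =
    (sweep P n (q - 1) (advance False (q - 1) ts (Some [])) (False # t) \<and>
     sweep P n (q - 1) (advance True (q - 1) ts (Some [])) (True # t))"

fun upd :: "int option \<Rightarrow> int \<Rightarrow> int option" where
  "upd None u = Some u"
| "upd (Some v) u = Some (pick (v \<le> u) u v)"

primrec peak :: "int \<Rightarrow> int \<Rightarrow> bool \<Rightarrow> bool list \<Rightarrow> int \<Rightarrow> int option \<Rightarrow> int option \<times> int" where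
  "peak a b L [] u m = (m, u)"
| "peak a b L (t # w) u m = peak a b L w (u + pick t b a) (pick (t = L) (upd m u) m)"

type_synonym tail = "bool \<times> int \<times> int \<times> int \<times> int \<times> int"

fun add_when :: "bool \<Rightarrow> int \<Rightarrow> target \<Rightarrow> target list \<Rightarrow> target list option" where
  "add_when True q r ts = add_target q r ts"
| "add_when False q r ts = Some ts"

fun add_peak :: "tail \<Rightarrow> int \<Rightarrow> int option \<times> int \<Rightarrow> target list \<Rightarrow> target list option" where
  "add_peak D q (None, u) ts = Some ts"
| "add_peak (L, a, b, m, e, th) q (Some v, u) ts = add_when (th \<le> v) q (L, a, b, m, v + e - u) ts"

fun add_tail :: "tail \<Rightarrow> int \<Rightarrow> bool list \<Rightarrow> target list option \<Rightarrow> target list option" where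
  "add_tail D q t None = None"
| "add_tail (L, a, b, m, e, th) q t (Some ts) = add_peak (L, a, b, m, e, th) q (peak a b L t (a + b) None) ts"

primrec tails :: "tail list \<Rightarrow> int \<Rightarrow> bool list \<Rightarrow> target list option \<Rightarrow> target list option" where
  "tails [] q t acc = acc"
| "tails (D # ds) q t acc = tails ds q t (add_tail D q t acc)"

fun search :: "(bool list \<Rightarrow> bool) \<Rightarrow> tail list \<Rightarrow> nat \<Rightarrow> int \<Rightarrow> target list option \<Rightarrow> target list option \<Rightarrow> bool list \<Rightarrow> bool" where
  "search P ds n q None cs t = True"
| "search P ds n q (Some ts) None t = True"
| "search P ds n q (Some ts) (Some []) t = sweep P n q (tails ds q (rev t) (Some ts)) t"
| "search P ds 0 q (Some ts) (Some (c # cs)) t = True"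
| "search P ds (Suc n) q (Some ts) (Some (c # cs)) t =
    (search P ds n (q - 1) (advance False (q - 1) ts (Some [])) (advance False (q - 1) (c # cs) (Some [])) (False # t) \<and>
     search P ds n (q - 1) (advance True (q - 1) ts (Some [])) (advance True (q - 1) (c # cs) (Some [])) (True # t))"

type_synonym dir = "int \<times> int \<times> bool \<times> bool"

fun better :: "bool \<Rightarrow> int \<Rightarrow> bool list \<Rightarrow> (int \<times> bool list) option \<Rightarrow> (int \<times> bool list) option" where
  "better la u p None = Some (u, p)"
| "better la u p (Some (v, q)) = pick (pick la (v \<le> u) (v < u)) (Some (u, p)) (Some (v, q))"

primrec best :: "int \<Rightarrow> int \<Rightarrow> bool \<Rightarrow> bool \<Rightarrow> bool list \<Rightarrow> int \<Rightarrow> (int \<times> bool list) option \<Rightarrow> (int \<times> bool list) option" where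
  "best c d L la [] u acc = acc"
| "best c d L la (t # p) u acc = best c d L la p (u + pick t d c) (pick (t = L) (better la u p acc) acc)"

fun best_of :: "int \<times> int \<Rightarrow> bool list \<Rightarrow> dir \<Rightarrow> (int \<times> bool list) option" where
  "best_of (x, y) p (c, d, L, la) = best c d L la p (- (c * x + d * y)) None"

definition thr :: "bool \<Rightarrow> int \<Rightarrow> int" where "thr la v = pick la v (v + 1)"

fun level_entry :: "dir \<Rightarrow> (int \<times> bool list) option \<Rightarrow> (nat \<times> target) list \<Rightarrow> (nat \<times> target) list" where
  "level_entry D None r = r"
| "level_entry (c, d, L, la) (Some (v, q)) r =
     pick (thr la v \<le> pick L c 0) r ((length q, target L c d (thr la v)) # r)"

primrec levels_of :: "int \<times> int \<Rightarrow> bool list \<Rightarrow> dir list \<Rightarrow> (nat \<times> target) list" where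
  "levels_of xy p [] = []"
| "levels_of xy p (D # ds) = level_entry D (best_of xy p D) (levels_of xy p ds)"

fun tail_entry :: "dir \<Rightarrow> (int \<times> bool list) option \<Rightarrow> tail list \<Rightarrow> tail list" where
  "tail_entry D None r = r"
| "tail_entry (c, d, L, la) (Some (v, q)) r =
     (L, c, d, max 0 (max c d), thr la 0, max (thr la v) (thr la (pick L c 0))) # r"

primrec tails_of :: "int \<times> int \<Rightarrow> bool list \<Rightarrow> dir list \<Rightarrow> tail list" where
  "tails_of xy p [] = []"
| "tails_of xy p (D # ds) = tail_entry D (best_of xy p D) (tails_of xy p ds)"

fun cons_if :: "bool \<Rightarrow> target \<Rightarrow> target list \<Rightarrow> target list" where
  "cons_if True r rs = r # rs" | "cons_if False r rs = rs"

fun at_level :: "nat \<Rightarrow> (nat \<times> target) list \<Rightarrow> target list" where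
  "at_level n [] = []"
| "at_level n ((m, r) # rs) = cons_if (m = n) r (at_level n rs)"

definition attempt :: "(bool list \<Rightarrow> bool) \<Rightarrow> tail list \<Rightarrow> bool list \<Rightarrow> nat \<Rightarrow> int \<Rightarrow> bool list \<Rightarrow> target list option \<Rightarrow> bool" where
  "attempt P ds p n q r acc = search P ds n q (start q (cores r) acc) (start q (cores p) (Some [])) []"

primrec descend :: "(bool list \<Rightarrow> bool) \<Rightarrow> tail list \<Rightarrow> (nat \<times> target) list \<Rightarrow> bool list \<Rightarrow> nat \<Rightarrow> int \<Rightarrow>
    bool list list \<Rightarrow> target list option \<Rightarrow> bool" where
  "descend P ds lv p n q [] acc = attempt P ds p n q p acc"
| "descend P ds lv p n q (r # rs) acc = (case at_level (length r) lv of
      [] \<Rightarrow> descend P ds lv p n q rs acc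
    | x # xs \<Rightarrow> attempt P ds p n q r acc \<and> descend P ds lv p n q rs (start q (x # xs) acc))"

primrec suffs :: "bool list \<Rightarrow> bool list list" where
  "suffs [] = []" | "suffs (x # xs) = suffs xs @ [xs]"

definition check_prefix :: "dir list \<Rightarrow> dir list \<Rightarrow> (bool list \<Rightarrow> bool) \<Rightarrow> nat \<Rightarrow> int \<Rightarrow> bool list \<Rightarrow> bool" where
  "check_prefix dP dT P n q p =
    descend P (tails_of (endpoint p) p dT) (levels_of (endpoint p) p dP) p n q (suffs p) (Some [])"

section \<open>Soundness\<close>

fun shift :: "bool list \<Rightarrow> target \<Rightarrow> target" where
  "shift u (L, a, b, m, h) = (L, a, b, m, h - val a b u)"

definition good :: "bool list \<Rightarrow> target \<Rightarrow> bool" where "good w r \<longleftrightarrow> wf_target r \<and> hits r w"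

lemma hits_append: "hits r (u @ w) \<longleftrightarrow> hits r u \<or> hits (shift u r) w"
proof -
  obtain L a b m h where r: "r = (L, a, b, m, h)" by (cases r)
  have "(\<exists>u' x. u @ w = u' @ L # x \<and> h \<le> val a b u') \<longleftrightarrow>
     (\<exists>u' x. u = u' @ L # x \<and> h \<le> val a b u') \<or> (\<exists>u' x. w = u' @ L # x \<and> h - val a b u \<le> val a b u')" (is "?A \<longleftrightarrow> ?B \<or> ?C")
  proof
    assume ?A
    then obtain u' x where e: "u @ w = u' @ L # x" and h: "h \<le> val a b u'" by blast
    then consider us where "u = u' @ us" "us @ w = L # x" | us where "u' = u @ us" "w = us @ L # x"
      by (auto simp: append_eq_append_conv2)
    then show "?B \<or> ?C"
    proof cases
      case (1 us)
      show ?thesis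
      proof (cases us)
        case Nil
        then have "w = [] @ L # x \<and> h - val a b u \<le> val a b []" using 1 h by simp
        then show ?thesis by blast
      next
        case (Cons t us')
        then show ?thesis using 1 h by auto
      qed
    next
      case (2 us)
      then have "w = us @ L # x \<and> h - val a b u \<le> val a b us" using h by simp
      then show ?thesis by blast
    qed
  next
    assume "?B \<or> ?C"
    then show ?A
    proof
      assume ?B
      then obtain u' x where "u = u' @ L # x" "h \<le> val a b u'" by blast
      then have "u @ w = u' @ L # (x @ w) \<and> h \<le> val a b u'" by simp
      then show ?A by blast
    next
      assume ?C
      then obtain u' x where "w = u' @ L # x" "h - val a b u \<le> val a b u'" by blast
      then have "u @ w = (u @ u') @ L # x \<and> h \<le> val a b (u @ u')" by simp
      then show ?A by blast
    qed
  qed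
  then show ?thesis by (simp add: r)
qed

lemma wf_shift [simp]: "wf_target (shift u r) = wf_target r" by (cases r) auto

lemma shift_append [simp]: "shift (u @ v) r = shift v (shift u r)" by (cases r) auto

lemma add_target_good:
  assumes "good w r" "int (length w) = q + 1"
  shows "add_target q r ts = Some (r # ts)"
proof -
  obtain L a b m h where r: "r = (L, a, b, m, h)" by (cases r)
  obtain u x where u: "w = u @ L # x" "h \<le> val a b u" using assms by (auto simp: good_def r)
  have wf: "a \<le> m" "b \<le> m" "0 \<le> m" using assms by (auto simp: good_def r)
  have "val a b u \<le> m * na u + m * nb u" unfolding val_def using wf by (intro add_mono mult_right_mono) auto
  also have "\<dots> = m * (na u + nb u)" by (simp add: algebra_simps)
  also have "\<dots> \<le> m * q" using wf(3) assms(2) na_nb_length[of u] u(1) by (intro mult_left_mono) auto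
  finally show ?thesis using u(2) by (simp add: r)
qed

lemma hits_single: "hits (L, a, b, m, h) [t] \<longleftrightarrow> t = L \<and> h \<le> 0"
  by (auto simp: Cons_eq_append_conv)

lemma move_eq: "move t q r (Some ts) = (if hits r [t] then Some ts else add_target q (shift [t] r) ts)"
proof -
  obtain L a b m h where r: "r = (L, a, b, m, h)" by (cases r)
  show ?thesis unfolding r hits_single by (cases t; cases L; cases "h \<le> 0") auto
qed

lemma advance_good:
  assumes "\<And>r. r \<in> set rs \<Longrightarrow> good (t # w) r" "\<And>r. r \<in> set acc \<Longrightarrow> good w r" "int (length w) = q + 1"
  shows "\<exists>ts. advance t q rs (Some acc) = Some ts \<and> (\<forall>r\<in>set ts. good w r) \<and>
     (\<forall>r\<in>set ts. r \<in> set acc \<or> (\<exists>r'\<in>set rs. r = shift [t] r' \<and> \<not> hits r' [t]))"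
  using assms
proof (induction rs arbitrary: acc)
  case Nil
  then show ?case by auto
next
  case (Cons r rs)
  have r: "good (t # w) r" using Cons.prems(1) by simp
  define acc' where "acc' = (if hits r [t] then acc else shift [t] r # acc)"
  have g: "good w (shift [t] r)" if "\<not> hits r [t]"
    using r that hits_append[of r "[t]" w] by (auto simp: good_def)
  then have m: "move t q r (Some acc) = Some acc'"
    unfolding move_eq acc'_def using add_target_good[OF g Cons.prems(3)] by auto
  have "\<exists>ts. advance t q rs (Some acc') = Some ts \<and> (\<forall>r\<in>set ts. good w r) \<and>
     (\<forall>r\<in>set ts. r \<in> set acc' \<or> (\<exists>r'\<in>set rs. r = shift [t] r' \<and> \<not> hits r' [t]))"
    by (rule Cons.IH) (use Cons.prems g in \<open>auto simp: acc'_def split: if_splits\<close>)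
  then obtain ts where ts: "advance t q rs (Some acc') = Some ts" "\<forall>r\<in>set ts. good w r"
     "\<forall>r\<in>set ts. r \<in> set acc' \<or> (\<exists>r'\<in>set rs. r = shift [t] r' \<and> \<not> hits r' [t])" by blast
  have "\<forall>x\<in>set ts. x \<in> set acc \<or> (\<exists>r'\<in>set (r # rs). x = shift [t] r' \<and> \<not> hits r' [t])"
    using ts(3) by (auto simp: acc'_def split: if_splits)
  then show ?case using ts(1,2) m by auto
qed

lemma start_good:
  assumes "\<And>r. r \<in> set rs \<Longrightarrow> good w r" "\<And>r. r \<in> set acc \<Longrightarrow> good w r" "int (length w) = q + 1"
  shows "\<exists>ts. start q rs (Some acc) = Some ts \<and> set ts = set rs \<union> set acc"
  using assms
proof (induction rs arbitrary: acc)
  case (Cons r rs)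
  have "put q r (Some acc) = Some (r # acc)" using add_target_good[of w r q acc] Cons.prems by simp
  moreover have "\<exists>ts. start q rs (Some (r # acc)) = Some ts \<and> set ts = set rs \<union> set (r # acc)"
    by (rule Cons.IH) (use Cons.prems in auto)
  ultimately show ?case by auto
qed simp

lemma sweep_sound:
  assumes "sweep P n q (Some ts) t" "length w = n" "q = int n - 1" "\<And>r. r \<in> set ts \<Longrightarrow> good w r"
  shows "P (rev t @ w)"
  using assms
proof (induction n arbitrary: q ts t w)
  case 0
  have "ts = []"
  proof (cases ts)
    case (Cons r rs)
    then have "hits r []" using 0 by (auto simp: good_def)
    then show ?thesis by (cases r) auto
  qed simp
  then show ?case using 0 by simp
next
  case (Suc n)
  obtain x w' where w: "w = x # w'" using Suc.prems(2) by (cases w) auto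
  have "\<exists>ts'. advance x (q - 1) ts (Some []) = Some ts' \<and> (\<forall>r\<in>set ts'. good w' r) \<and>
     (\<forall>r\<in>set ts'. r \<in> set [] \<or> (\<exists>r'\<in>set ts. r = shift [x] r' \<and> \<not> hits r' [x]))"
    by (rule advance_good) (use Suc.prems w in auto)
  then obtain ts' where ts': "advance x (q - 1) ts (Some []) = Some ts'" "\<And>r. r \<in> set ts' \<Longrightarrow> good w' r" by blast
  then have "sweep P n (q - 1) (Some ts') (x # t)" using Suc.prems(1) by (cases x) auto
  from Suc.IH[OF this _ _ ts'(2)] show ?case using Suc.prems w by simp
qed

definition lexmax :: "bool list \<Rightarrow> bool \<Rightarrow> int \<Rightarrow> int \<Rightarrow> bool \<Rightarrow> bool list \<Rightarrow> bool" where
  "lexmax w L c d la u \<longleftrightarrow> (\<exists>x. w = u @ L # x) \<and> (\<forall>u' x'. w = u' @ L # x' \<longrightarrow> u' \<noteq> u \<longrightarrow>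
     val c d u' < val c d u \<or> val c d u' = val c d u \<and> (if la then length u' < length u else length u < length u'))"

lemma lexmax_strict: "lexmax w L c d la u \<Longrightarrow> \<exists>a b. strict w L a b u"
proof -
  assume l: "lexmax w L c d la u"
  define K e where "K = int (length w) + 1" and "e = (if la then 1 else -1 :: int)"
  have v: "val (K * c + e) (K * d + e) z = K * val c d z + e * int (length z)" for z
    by (simp add: val_def algebra_simps flip: na_nb_length)
  have "strict w L (K * c + e) (K * d + e) u"
    unfolding strict_def
  proof (intro conjI allI impI)
    show "\<exists>x. w = u @ L # x" using l by (simp add: lexmax_def)
    then have lu: "length u < length w" by auto
    fix u' x' assume w: "w = u' @ L # x'" and ne: "u' \<noteq> u"
    then have lu': "length u' < length w" by simp
    have "val c d u' < val c d u \<or> val c d u' = val c d u \<and> (if la then length u' < length u else length u < length u')"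
      using l w ne unfolding lexmax_def by blast
    then show "val (K * c + e) (K * d + e) u' < val (K * c + e) (K * d + e) u"
    proof (elim disjE conjE)
      assume "val c d u' < val c d u"
      then have "K * (val c d u' + 1) \<le> K * val c d u" by (intro mult_left_mono) (auto simp: K_def)
      then have "K * val c d u' + K \<le> K * val c d u" by (simp add: algebra_simps)
      moreover have "e * int (length u') < K + e * int (length u)" using lu lu' by (simp add: e_def K_def)
      ultimately show ?thesis unfolding v by linarith
    next
      assume "val c d u' = val c d u" "if la then length u' < length u else length u < length u'"
      then show ?thesis unfolding v by (auto simp: e_def split: if_splits)
    qed
  qed
  then show ?thesis by blast
qed

lemma lexmax_append:
  assumes l: "lexmax u L c d la u1"
    and t: "\<And>z y. u' = z @ L # y \<Longrightarrow> val c d u + val c d z < thr la (val c d u1)"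
  shows "lexmax (u @ u') L c d la u1"
  unfolding lexmax_def
proof (intro conjI allI impI)
  obtain x where u: "u = u1 @ L # x" using l by (auto simp: lexmax_def)
  then show "\<exists>x. u @ u' = u1 @ L # x" by simp
  fix w x' assume e: "u @ u' = w @ L # x'" and ne: "w \<noteq> u1"
  show "val c d w < val c d u1 \<or> val c d w = val c d u1 \<and> (if la then length w < length u1 else length u1 < length w)"
  proof (cases "length w < length u")
    case True
    then have "u = w @ L # take (length u - Suc (length w)) x'"
      using arg_cong[OF e, of "take (length u)"] by (simp add: take_Cons')
    then show ?thesis using l ne unfolding lexmax_def by blast
  next
    case False
    then obtain z where z: "w = u @ z" "u' = z @ L # x'" using e by (auto simp: append_eq_append_conv2)
    from t[OF z(2)] show ?thesis using u z(1) by (auto simp: thr_def pick_if split: if_splits)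
  qed
qed

lemma lexmax_snoc_better:
  assumes l: "\<And>u' x'. u = u' @ L # x' \<Longrightarrow> val c d u' < thr (\<not> la) (val c d u)"
  shows "lexmax (u @ [L]) L c d la u"
  unfolding lexmax_def
proof (intro conjI allI impI)
  show "\<exists>x. u @ [L] = u @ L # x" by simp
  fix w x' assume e: "u @ [L] = w @ L # x'" and ne: "w \<noteq> u"
  then obtain y where "x' = y @ [L]" by (cases x' rule: rev_cases) auto
  then have u: "u = w @ L # y" using e by simp
  from l[OF this] show "val c d w < val c d u \<or> val c d w = val c d u \<and> (if la then length w < length u else length u < length w)"
    using u by (auto simp: thr_def pick_if split: if_splits)
qed

declare cores.simps [simp del]

lemma lexmax_le: "lexmax w L c d la u \<Longrightarrow> w = u' @ L # x' \<Longrightarrow> val c d u' \<le> val c d u"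
proof (cases "u' = u")
  case False
  assume "lexmax w L c d la u" "w = u' @ L # x'"
  then have "val c d u' < val c d u \<or> val c d u' = val c d u" using False unfolding lexmax_def by blast
  then show ?thesis by linarith
qed simp

lemma best_aux:
  assumes "acc = None \<and> (\<forall>z y. u \<noteq> z @ L # y) \<or>
     (\<exists>q z. acc = Some (u0 + val c d z, q) \<and> u @ p = z @ L # q \<and> lexmax u L c d la z)"
  shows "best c d L la p (u0 + val c d u) acc = None \<and> (\<forall>z y. u @ p \<noteq> z @ L # y) \<or>
     (\<exists>q z. best c d L la p (u0 + val c d u) acc = Some (u0 + val c d z, q) \<and> u @ p = z @ L # q \<and> lexmax (u @ p) L c d la z)"
  using assms
proof (induction p arbitrary: u acc)
  case Nil
  then show ?case by auto
next
  case (Cons t p)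
  define acc' where "acc' = pick (t = L) (better la (u0 + val c d u) p acc) acc"
  have ih: "acc' = None \<and> (\<forall>z y. u @ [t] \<noteq> z @ L # y) \<or>
     (\<exists>q z. acc' = Some (u0 + val c d z, q) \<and> (u @ [t]) @ p = z @ L # q \<and> lexmax (u @ [t]) L c d la z)"
  proof (cases "t = L")
    case False
    then have a: "acc' = acc" by (simp add: acc'_def)
    have "lexmax (u @ [t]) L c d la z" if "lexmax u L c d la z" for z
      by (rule lexmax_append[OF that]) (use False in \<open>auto simp: Cons_eq_append_conv\<close>)
    moreover have "u @ [t] \<noteq> z @ L # y" if "\<And>z y. u \<noteq> z @ L # y" for z y
      using that False by (cases y rule: rev_cases) auto
    ultimately show ?thesis using Cons.prems unfolding a by auto
  next
    case True
    show ?thesis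
    proof (cases acc)
      case None
      then have n: "u \<noteq> z @ L # y" for z y using Cons.prems by auto
      have "lexmax (u @ [L]) L c d la u" by (rule lexmax_snoc_better) (use n in auto)
      then show ?thesis using True None by (auto simp: acc'_def)
    next
      case (Some a)
      then obtain q z where z: "acc = Some (u0 + val c d z, q)" "u @ t # p = z @ L # q" "lexmax u L c d la z"
        using Cons.prems by auto
      have le: "val c d u' \<le> val c d z" if "u = u' @ L # x'" for u' x'
        using lexmax_le[OF z(3) that] .
      show ?thesis
      proof (cases "pick la (val c d z \<le> val c d u) (val c d z < val c d u)")
        case b: True
        have "lexmax (u @ [L]) L c d la u"
          by (rule lexmax_snoc_better) (use le b in \<open>force simp: thr_def pick_if split: if_splits\<close>)
        moreover have "acc' = Some (u0 + val c d u, p)"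
          using True z(1) b by (simp add: acc'_def pick_if)
        ultimately show ?thesis using True by auto
      next
        case b: False
        have "lexmax (u @ [L]) L c d la z"
          by (rule lexmax_append[OF z(3)]) (use b in \<open>auto simp: Cons_eq_append_conv thr_def pick_if split: if_splits\<close>)
        moreover have "acc' = acc" using True z(1) b by (auto simp: acc'_def pick_if split: if_splits)
        ultimately show ?thesis using z True by auto
      qed
    qed
  qed
  have e: "best c d L la (t # p) (u0 + val c d u) acc = best c d L la p (u0 + val c d (u @ [t])) acc'"
    by (simp add: acc'_def pick_if add.assoc)
  show ?case unfolding e using Cons.IH[OF ih] by simp
qed

lemma best_of_spec:
  "best_of (endpoint p) p (c, d, L, la) = None \<and> (\<forall>z y. p \<noteq> z @ L # y) \<or>
   (\<exists>q z. best_of (endpoint p) p (c, d, L, la) = Some (val c d z - val c d p, q) \<and> p = z @ L # q \<and> lexmax p L c d la z)"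
proof -
  have "best_of (endpoint p) p (c, d, L, la) = best c d L la p (- val c d p + val c d []) None"
    by (simp add: endpoint_eq val_def)
  then show ?thesis using best_aux[of None "[]" L "- val c d p" c d p la] by (auto simp: algebra_simps)
qed

lemma lexmax_exists: "w = z @ L # y \<Longrightarrow> \<exists>u. lexmax w L c d la u"
  using best_of_spec[of w c d L la] by blast

lemma split_at:
  assumes v: "vsim (p @ False # True # s) (p @ True # False # s)"
    and l: "lexmax (p @ False # True # s) L c d la z"
  shows "(\<forall>q. p = z @ L # q \<longrightarrow> (\<forall>r\<in>set (cores q). hits r s)) \<and>
    (\<forall>z' y. s = z' @ L # y \<longrightarrow> z = p @ False # True # z' \<longrightarrow> (\<forall>r\<in>set (cores p). hits r z'))"
proof -
  obtain x where w: "p @ False # True # s = z @ L # x" using l by (auto simp: lexmax_def)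
  obtain a b where "strict (p @ False # True # s) L a b z" using lexmax_strict[OF l] by blast
  then obtain u' x' where g: "p @ True # False # s = u' @ L # x'" and e: "eq2 z u'" "eq2 x x'"
    using v w unfolding vsim_def by blast
  have lu: "length u' = length z" using eq2_length[OF e(1)] by simp
  show ?thesis
  proof (intro conjI allI impI ballI)
    fix q r assume p: "p = z @ L # q" and r: "r \<in> set (cores q)"
    have "x = q @ False # True # s" using w p by simp
    moreover have "x' = q @ True # False # s" using g p lu by simp
    ultimately show "hits r s" using e r cores_hit by blast
  next
    fix z' y r assume s: "s = z' @ L # y" and z: "z = p @ False # True # z'" and r: "r \<in> set (cores p)"
    have "u' = take (length u') (p @ True # False # s)" using g by simp
    then have "u' = p @ True # False # z'" using s z lu by simp
    then show "hits r z'" using e r z cores_hit by blast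
  qed
qed

lemma thr_add: "thr la (x + y) = x + thr la y" by (simp add: thr_def pick_if)

lemma level_fact:
  assumes v: "vsim (p @ False # True # s) (p @ True # False # s)"
    and b: "best_of (endpoint p) p (c, d, L, la) = Some (v0, q)"
    and mid: "\<not> thr la v0 \<le> pick L c 0"
  shows "hits (target L c d (thr la v0)) s \<or> (\<forall>r\<in>set (cores q). hits r s)"
proof (cases "hits (target L c d (thr la v0)) s")
  case no: False
  obtain z where z: "v0 = val c d z - val c d p" "p = z @ L # q" "lexmax p L c d la z"
    using best_of_spec[of p c d L la] b by auto
  have "lexmax (p @ False # True # s) L c d la z"
  proof (rule lexmax_append[OF z(3)])
    fix zz y assume e: "False # True # s = zz @ L # y"
    have t: "thr la (val c d z) = val c d p + thr la v0" using z(1) by (simp add: flip: thr_add)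
    consider "zz = []" "L = False" | "zz = [False]" "L = True" | zz' where "zz = False # True # zz'" "s = zz' @ L # y"
      using e by (auto simp: Cons_eq_append_conv)
    then show "val c d p + val c d zz < thr la (val c d z)"
    proof cases
      case (3 zz')
      then have "\<not> thr la v0 - (c + d) \<le> val c d zz'" using no by (auto simp: target.simps)
      then show ?thesis using 3 t by simp
    qed (use mid t in auto)
  qed
  from split_at[OF v this] show ?thesis using z(2) by blast
qed simp

lemma lexmax_prepend:
  assumes l: "lexmax t L c d la z"
    and u: "\<And>y x. u = y @ L # x \<Longrightarrow> val c d y < thr (\<not> la) (val c d u + val c d z)"
  shows "lexmax (u @ t) L c d la (u @ z)"
  unfolding lexmax_def
proof (intro conjI allI impI)
  show "\<exists>x. u @ t = (u @ z) @ L # x" using l by (auto simp: lexmax_def)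
  fix w x' assume e: "u @ t = w @ L # x'" and ne: "w \<noteq> u @ z"
  show "val c d w < val c d (u @ z) \<or> val c d w = val c d (u @ z) \<and> (if la then length w < length (u @ z) else length (u @ z) < length w)"
  proof (cases "length w < length u")
    case True
    then have "u = w @ L # take (length u - Suc (length w)) x'"
      using arg_cong[OF e, of "take (length u)"] by (simp add: take_Cons')
    from u[OF this] show ?thesis using True by (auto simp: thr_def pick_if split: if_splits)
  next
    case False
    then obtain y where y: "w = u @ y" "t = y @ L # x'" using e by (auto simp: append_eq_append_conv2)
    then have "val c d y < val c d z \<or> val c d y = val c d z \<and> (if la then length y < length z else length z < length y)"
      using l ne unfolding lexmax_def by blast
    then show ?thesis using y(1) by auto
  qed
qed

lemma tail_fact:
  assumes v: "vsim (p @ False # True # t @ w) (p @ True # False # t @ w)"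
    and b: "best_of (endpoint p) p (c, d, L, la) = Some (v0, q)"
    and z: "lexmax t L c d la z" and m: "m = c + d + val c d z"
    and big: "thr la v0 \<le> m" "thr la (pick L c 0) \<le> m"
    and core: "\<not> (\<forall>r\<in>set (cores p). hits r z)"
  shows "hits (L, c, d, mm, m + thr la 0 - (c + d + val c d t)) w"
proof (rule ccontr)
  assume no: "\<not> ?thesis"
  obtain zp where zp: "v0 = val c d zp - val c d p" "lexmax p L c d la zp"
    using best_of_spec[of p c d L la] b by auto
  have "lexmax ((p @ [False, True]) @ t) L c d la ((p @ [False, True]) @ z)"
  proof (rule lexmax_prepend[OF z])
    fix y x assume e: "p @ [False, True] = y @ L # x"
    have M: "val c d (p @ [False, True]) + val c d z = val c d p + m" by (simp add: m)
    consider "y = p" "L = False" | "y = p @ [False]" "L = True" | x' where "p = y @ L # x'"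
    proof (cases x rule: rev_cases)
      case (snoc x1 b)
      then have e1: "p @ [False] = y @ L # x1" using e by simp
      then show ?thesis using that(1,3) by (cases x1 rule: rev_cases) auto
    qed (use e that(2) in auto)
    then show "val c d y < thr (\<not> la) (val c d (p @ [False, True]) + val c d z)"
      unfolding M
    proof cases
      case (3 x')
      then have "val c d y \<le> v0 + val c d p" using lexmax_le[OF zp(2)] zp(1) by simp
      then show "val c d y < thr (\<not> la) (val c d p + m)" using big by (auto simp: thr_def pick_if split: if_splits)
    qed (use big in \<open>auto simp: thr_def pick_if split: if_splits\<close>)
  qed
  then have "lexmax (((p @ [False, True]) @ t) @ w) L c d la ((p @ [False, True]) @ z)"
  proof (rule lexmax_append)
    fix y x assume "w = y @ L # x"
    then have "\<not> m + thr la 0 - (c + d + val c d t) \<le> val c d y" using no by auto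
    moreover have "thr la (val c d ((p @ [False, True]) @ z)) = val c d p + m + thr la 0"
      using thr_add[of la "val c d p + m" 0] by (simp add: m algebra_simps)
    ultimately show "val c d ((p @ [False, True]) @ t) + val c d y < thr la (val c d ((p @ [False, True]) @ z))" by simp
  qed
  then have l: "lexmax (p @ False # True # t @ w) L c d la (p @ False # True # z)" by simp
  obtain y where "t = z @ L # y" using z by (auto simp: lexmax_def)
  then have "t @ w = z @ L # (y @ w)" by simp
  with split_at[OF v l] core show False by blast
qed

lemma peak_aux:
  assumes "m = None \<and> (\<forall>z y. u \<noteq> z @ L # y) \<or>
     (\<exists>v. m = Some v \<and> (\<exists>z y. u = z @ L # y \<and> v = u0 + val a b z) \<and> (\<forall>z y. u = z @ L # y \<longrightarrow> u0 + val a b z \<le> v))"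
  shows "\<exists>m'. peak a b L t (u0 + val a b u) m = (m', u0 + val a b (u @ t)) \<and> (m' = None \<and> (\<forall>z y. u @ t \<noteq> z @ L # y) \<or>
     (\<exists>v. m' = Some v \<and> (\<exists>z y. u @ t = z @ L # y \<and> v = u0 + val a b z) \<and> (\<forall>z y. u @ t = z @ L # y \<longrightarrow> u0 + val a b z \<le> v)))"
  using assms
proof (induction t arbitrary: u m)
  case Nil
  then show ?case by auto
next
  case (Cons x t)
  define m2 where "m2 = pick (x = L) (upd m (u0 + val a b u)) m"
  have st: "u @ [x] = z @ L # y \<longleftrightarrow> (x = L \<and> z = u \<and> y = []) \<or> (\<exists>y'. u = z @ L # y' \<and> y = y' @ [x])" for z y
    by (cases y rule: rev_cases) auto
  have "m2 = None \<and> (\<forall>z y. u @ [x] \<noteq> z @ L # y) \<or>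
     (\<exists>v. m2 = Some v \<and> (\<exists>z y. u @ [x] = z @ L # y \<and> v = u0 + val a b z) \<and> (\<forall>z y. u @ [x] = z @ L # y \<longrightarrow> u0 + val a b z \<le> v))"
  proof (cases m)
    case None
    then show ?thesis using Cons.prems unfolding st m2_def by (auto simp: pick_if)
  next
    case (Some v)
    then have v: "\<exists>z y. u = z @ L # y \<and> v = u0 + val a b z" "\<And>z y. u = z @ L # y \<Longrightarrow> u0 + val a b z \<le> v" using Cons.prems by auto
    show ?thesis
    proof (cases "x = L \<and> v \<le> u0 + val a b u")
      case True
      then have "m2 = Some (u0 + val a b u)" using Some by (simp add: m2_def)
      moreover have "u0 + val a b z \<le> u0 + val a b u" if "u @ [x] = z @ L # y" for z y
        using that v(2)[of z] True unfolding st by force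
      ultimately show ?thesis using True by auto
    next
      case False
      then have "m2 = Some v" using Some by (auto simp: m2_def pick_if)
      moreover have "u0 + val a b z \<le> v" if "u @ [x] = z @ L # y" for z y
        using that v(2)[of z] False unfolding st by force
      moreover have "\<exists>z y. u @ [x] = z @ L # y \<and> v = u0 + val a b z" using v(1) unfolding st by blast
      ultimately show ?thesis by blast
    qed
  qed
  from Cons.IH[OF this] show ?case by (simp add: m2_def pick_if add.assoc)
qed

lemma peak_spec:
  obtains "peak a b L t (a + b) None = (None, a + b + val a b t)" "\<And>z y. t \<noteq> z @ L # y"
  | z where "peak a b L t (a + b) None = (Some (a + b + val a b z), a + b + val a b t)" "lexmax t L a b la z"
proof -
  have "\<exists>m'. peak a b L t (a + b + val a b []) None = (m', a + b + val a b ([] @ t)) \<and> (m' = None \<and> (\<forall>z y. [] @ t \<noteq> z @ L # y) \<or>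
     (\<exists>v. m' = Some v \<and> (\<exists>z y. [] @ t = z @ L # y \<and> v = a + b + val a b z) \<and> (\<forall>z y. [] @ t = z @ L # y \<longrightarrow> a + b + val a b z \<le> v)))"
    by (rule peak_aux) simp
  then obtain m' where m': "peak a b L t (a + b) None = (m', a + b + val a b t)" and
    d: "m' = None \<and> (\<forall>z y. t \<noteq> z @ L # y) \<or>
     (\<exists>v. m' = Some v \<and> (\<exists>z y. t = z @ L # y \<and> v = a + b + val a b z) \<and> (\<forall>z y. t = z @ L # y \<longrightarrow> a + b + val a b z \<le> v))" by auto
  from d show ?thesis
  proof (elim disjE exE conjE)
    assume "m' = None" "\<forall>z y. t \<noteq> z @ L # y"
    then show ?thesis using m' that(1) by blast
  next
    fix v z y assume v: "m' = Some v" "\<forall>z y. t = z @ L # y \<longrightarrow> a + b + val a b z \<le> v" "t = z @ L # y" "v = a + b + val a b z"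
    obtain z' where z': "lexmax t L a b la z'" using lexmax_exists[OF v(3)] by blast
    then obtain y' where "t = z' @ L # y'" by (auto simp: lexmax_def)
    then have "a + b + val a b z' \<le> v" using v(2) by blast
    moreover have "v \<le> a + b + val a b z'" using lexmax_le[OF z' v(3)] v(4) by simp
    ultimately show ?thesis using that(2)[OF _ z'] m' v(1) by simp
  qed
qed

definition tail_ok :: "bool list \<Rightarrow> tail \<Rightarrow> bool" where
  "tail_ok p D \<longleftrightarrow> (\<exists>c d L la v0 q. best_of (endpoint p) p (c, d, L, la) = Some (v0, q) \<and>
     D = (L, c, d, max 0 (max c d), thr la 0, max (thr la v0) (thr la (pick L c 0))))"

lemma tails_of_ok: "D \<in> set (tails_of (endpoint p) p ds) \<Longrightarrow> tail_ok p D"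
proof (induction ds)
  case (Cons E ds)
  obtain c d L la where E: "E = (c, d, L, la)" by (cases E)
  show ?case
  proof (cases "best_of (endpoint p) p E")
    case None
    then show ?thesis using Cons by simp
  next
    case (Some a)
    obtain v0 q where "a = (v0, q)" by (cases a)
    then have b: "best_of (endpoint p) p (c, d, L, la) = Some (v0, q)" using Some E by simp
    have "set (tails_of (endpoint p) p (E # ds)) = insert (L, c, d, max 0 (max c d), thr la 0, max (thr la v0) (thr la (pick L c 0))) (set (tails_of (endpoint p) p ds))"
      by (simp add: E b)
    then have "D = (L, c, d, max 0 (max c d), thr la 0, max (thr la v0) (thr la (pick L c 0))) \<or> D \<in> set (tails_of (endpoint p) p ds)"
      using Cons.prems by simp
    then show ?thesis
    proof
      assume "D = (L, c, d, max 0 (max c d), thr la 0, max (thr la v0) (thr la (pick L c 0)))"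
      then show ?thesis unfolding tail_ok_def using b by blast
    qed (rule Cons.IH)
  qed
qed simp

lemma add_tail_good:
  assumes v: "vsim (p @ False # True # t @ w) (p @ True # False # t @ w)" and D: "tail_ok p D"
    and core: "\<forall>z x. t = z @ x \<longrightarrow> x \<noteq> [] \<longrightarrow> (\<exists>r\<in>set (cores p). \<not> hits r z)"
    and ts: "\<And>r. r \<in> set ts \<Longrightarrow> good w r" and q: "int (length w) = q + 1"
  shows "\<exists>ts'. add_tail D q t (Some ts) = Some ts' \<and> (\<forall>r\<in>set ts'. good w r)"
proof -
  obtain c d L la v0 q0 where b: "best_of (endpoint p) p (c, d, L, la) = Some (v0, q0)" and
    D: "D = (L, c, d, max 0 (max c d), thr la 0, max (thr la v0) (thr la (pick L c 0)))" using D unfolding tail_ok_def by blast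
  show ?thesis
  proof (rule peak_spec[where a = c and b = d and L = L and t = t and la = la])
    assume "peak c d L t (c + d) None = (None, c + d + val c d t)"
    then show ?thesis using ts by (simp add: D)
  next
    fix z assume 2: "peak c d L t (c + d) None = (Some (c + d + val c d z), c + d + val c d t)" "lexmax t L c d la z"
    define m where "m = c + d + val c d z"
    obtain y where y: "t = z @ L # y" using 2 by (auto simp: lexmax_def)
    have e: "add_tail D q t (Some ts) = add_when (max (thr la v0) (thr la (pick L c 0)) \<le> m) q
        (L, c, d, max 0 (max c d), m + thr la 0 - (c + d + val c d t)) ts" using 2 by (simp add: D m_def)
    show ?thesis
    proof (cases "max (thr la v0) (thr la (pick L c 0)) \<le> m")
      case False
      then show ?thesis using ts unfolding e by auto
    next
      case True
      then have big: "thr la v0 \<le> m" "thr la (pick L c 0) \<le> m" by auto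
      have "\<not> (\<forall>r\<in>set (cores p). hits r z)" using core y by blast
      from tail_fact[OF v b 2(2) m_def big this, of "max 0 (max c d)"]
      have g: "good w (L, c, d, max 0 (max c d), m + thr la 0 - (c + d + val c d t))" by (auto simp: good_def)
      have "add_tail D q t (Some ts) = Some ((L, c, d, max 0 (max c d), m + thr la 0 - (c + d + val c d t)) # ts)"
        unfolding e using True add_target_good[OF g q] by (simp del: add_target.simps)
      then show ?thesis using g ts by auto
    qed
  qed
qed

lemma tails_good:
  assumes v: "vsim (p @ False # True # t @ w) (p @ True # False # t @ w)" and D: "\<And>D. D \<in> set ds \<Longrightarrow> tail_ok p D"
    and core: "\<forall>z x. t = z @ x \<longrightarrow> x \<noteq> [] \<longrightarrow> (\<exists>r\<in>set (cores p). \<not> hits r z)"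
    and ts: "\<And>r. r \<in> set ts \<Longrightarrow> good w r" and q: "int (length w) = q + 1"
  shows "\<exists>ts'. tails ds q t (Some ts) = Some ts' \<and> (\<forall>r\<in>set ts'. good w r)"
  using D ts
proof (induction ds arbitrary: ts)
  case (Cons D ds)
  obtain ts' where ts': "add_tail D q t (Some ts) = Some ts'" "\<forall>r\<in>set ts'. good w r"
    using add_tail_good[of p t w D ts q, OF v _ core Cons.prems(2) q] Cons.prems(1)[of D] by auto
  have "\<exists>ts''. tails ds q t (Some ts') = Some ts'' \<and> (\<forall>r\<in>set ts''. good w r)"
    by (rule Cons.IH) (use Cons.prems ts' in auto)
  then show ?case using ts'(1) by simp
qed auto

lemma search_sound:
  assumes "search P ds n q (Some ts) (Some cs) t" "length w = n" "q = int n - 1"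
    and v: "vsim (p @ False # True # rev t @ w) (p @ True # False # rev t @ w)" and ds: "\<And>D. D \<in> set ds \<Longrightarrow> tail_ok p D"
    and "\<And>r. r \<in> set ts \<Longrightarrow> good w r" "\<And>r. r \<in> set cs \<Longrightarrow> good w r"
    and "\<And>c. c \<in> set cs \<Longrightarrow> \<exists>r\<in>set (cores p). c = shift (rev t) r \<and> \<not> hits r (rev t)"
    and "\<And>z x. rev t = z @ x \<Longrightarrow> x \<noteq> [] \<Longrightarrow> \<exists>r\<in>set (cores p). \<not> hits r z"
  shows "P (rev t @ w)"
  using assms
proof (induction n arbitrary: q ts cs t w)
  case 0
  show ?case
  proof (cases cs)
    case Nil
    obtain ts' where "tails ds q (rev t) (Some ts) = Some ts'" "\<forall>r\<in>set ts'. good w r"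
      using tails_good[of p "rev t" w ds ts q, OF 0(4,5) _ 0(6)] 0(2,3,9) by auto
    then show ?thesis using 0 Nil sweep_sound[of P 0 q ts' t w] by auto
  next
    case (Cons c cs')
    then have "hits c []" using 0 by (auto simp: good_def)
    then show ?thesis by (cases c) auto
  qed
next
  case (Suc n)
  show ?case
  proof (cases cs)
    case Nil
    obtain ts' where "tails ds q (rev t) (Some ts) = Some ts'" "\<forall>r\<in>set ts'. good w r"
      using tails_good[of p "rev t" w ds ts q, OF Suc.prems(4,5) _ Suc.prems(6)] Suc.prems(2,3,9) by auto
    then show ?thesis using Suc.prems Nil sweep_sound[of P "Suc n" q ts' t w] by auto
  next
    case (Cons c cs')
    obtain x w' where w: "w = x # w'" using Suc.prems(2) by (cases w) auto
    have lw: "int (length w') = (q - 1) + 1" using Suc.prems w by simp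
    have "\<exists>ts'. advance x (q - 1) ts (Some []) = Some ts' \<and> (\<forall>r\<in>set ts'. good w' r) \<and>
       (\<forall>r\<in>set ts'. r \<in> set [] \<or> (\<exists>r'\<in>set ts. r = shift [x] r' \<and> \<not> hits r' [x]))"
      by (rule advance_good) (use Suc.prems w lw in auto)
    then obtain ts' where ts': "advance x (q - 1) ts (Some []) = Some ts'" "\<And>r. r \<in> set ts' \<Longrightarrow> good w' r" by blast
    have "\<exists>cs'. advance x (q - 1) cs (Some []) = Some cs' \<and> (\<forall>r\<in>set cs'. good w' r) \<and>
       (\<forall>r\<in>set cs'. r \<in> set [] \<or> (\<exists>r'\<in>set cs. r = shift [x] r' \<and> \<not> hits r' [x]))"
      by (rule advance_good) (use Suc.prems w lw in auto)
    then obtain cs2 where cs2: "advance x (q - 1) cs (Some []) = Some cs2" "\<And>r. r \<in> set cs2 \<Longrightarrow> good w' r"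
      "\<And>r. r \<in> set cs2 \<Longrightarrow> \<exists>r'\<in>set cs. r = shift [x] r' \<and> \<not> hits r' [x]" by auto
    have s: "search P ds n (q - 1) (Some ts') (Some cs2) (x # t)"
      using Suc.prems(1) ts'(1) cs2(1) unfolding Cons by (cases x) auto
    have v: "vsim (p @ False # True # rev (x # t) @ w') (p @ True # False # rev (x # t) @ w')" using Suc.prems(4) w by simp
    have 1: "\<exists>r\<in>set (cores p). c = shift (rev (x # t)) r \<and> \<not> hits r (rev (x # t))" if c: "c \<in> set cs2" for c
    proof -
      obtain c' where c': "c' \<in> set cs" "c = shift [x] c'" "\<not> hits c' [x]" using cs2(3)[OF c] by blast
      obtain r where r: "r \<in> set (cores p)" "c' = shift (rev t) r" "\<not> hits r (rev t)" using Suc.prems(8)[OF c'(1)] by blast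
      then have "c = shift (rev (x # t)) r \<and> \<not> hits r (rev (x # t))" using c' by (simp add: hits_append)
      then show ?thesis using r(1) by blast
    qed
    have 2: "\<exists>r\<in>set (cores p). \<not> hits r z" if e: "rev (x # t) = z @ y" "y \<noteq> []" for z y
    proof -
      obtain y' where y: "y = y' @ [x]" "rev t = z @ y'" using e by (cases y rule: rev_cases) auto
      show ?thesis
      proof (cases "y' = []")
        case True
        then have z: "z = rev t" using y by simp
        have "c \<in> set cs" using Cons by simp
        from Suc.prems(8)[OF this] show ?thesis unfolding z by blast
      next
        case False
        from Suc.prems(9)[OF y(2) this] show ?thesis .
      qed
    qed
    have l: "length w' = n" "q - 1 = int n - 1" using Suc.prems(2,3) w by simp_all
    have "P (rev (x # t) @ w')" by (rule Suc.IH[OF s l v Suc.prems(5) ts'(2) cs2(2) 1 2])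
    then show ?thesis using w by simp
  qed
qed

lemma attempt_sound:
  assumes a: "attempt P ds p n q r (Some acc)" and l: "length s = n" "q = int n - 1"
    and v: "vsim (p @ False # True # s) (p @ True # False # s)" and ds: "\<And>D. D \<in> set ds \<Longrightarrow> tail_ok p D"
    and acc: "\<And>r. r \<in> set acc \<Longrightarrow> good s r" and r: "\<And>x. x \<in> set (cores r) \<Longrightarrow> hits x s"
  shows "P s"
proof -
  have q: "int (length s) = q + 1" using l by simp
  have cp: "hits x s" if "x \<in> set (cores p)" for x using cores_hit[OF _ that] v by (simp add: vsim_def)
  obtain ts where ts: "start q (cores r) (Some acc) = Some ts" "set ts = set (cores r) \<union> set acc"
    using start_good[of "cores r" s acc q] r acc wf_cores q by (fastforce simp: good_def)
  obtain cs where cs: "start q (cores p) (Some []) = Some cs" "set cs = set (cores p)"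
    using start_good[of "cores p" s "[]" q] cp wf_cores q by (fastforce simp: good_def)
  have nil: "\<not> hits x []" for x by (cases x) auto
  have sh: "shift [] x = x" for x by (cases x) auto
  have "P (rev [] @ s)"
    by (rule search_sound[of P ds n q ts cs "[]" s p])
      (use a l v ds ts cs acc r cp wf_cores nil sh in \<open>auto simp: attempt_def good_def\<close>)
  then show ?thesis by simp
qed

definition level_ok :: "bool list \<Rightarrow> bool list \<Rightarrow> nat \<times> target \<Rightarrow> bool" where
  "level_ok p s e \<longleftrightarrow> wf_target (snd e) \<and> (hits (snd e) s \<or>
     (\<forall>y q. p = y @ q \<longrightarrow> length q = fst e \<longrightarrow> (\<forall>x\<in>set (cores q). hits x s)))"

lemma levels_of_ok:
  assumes v: "vsim (p @ False # True # s) (p @ True # False # s)"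
  shows "e \<in> set (levels_of (endpoint p) p ds) \<Longrightarrow> level_ok p s e"
proof (induction ds)
  case (Cons E ds)
  obtain c d L la where E: "E = (c, d, L, la)" by (cases E)
  show ?case
  proof (cases "best_of (endpoint p) p E")
    case None
    then show ?thesis using Cons by simp
  next
    case (Some a)
    obtain v0 q where "a = (v0, q)" by (cases a)
    then have b: "best_of (endpoint p) p (c, d, L, la) = Some (v0, q)" using Some E by simp
    show ?thesis
    proof (cases "thr la v0 \<le> pick L c 0")
      case True
      then show ?thesis using Cons by (simp add: E b)
    next
      case False
      then have "e = (length q, target L c d (thr la v0)) \<or> e \<in> set (levels_of (endpoint p) p ds)"
        using Cons.prems by (simp add: E b)
      moreover have "level_ok p s (length q, target L c d (thr la v0))"
      proof -
        obtain y where "p = y @ q" using best_of_spec[of p c d L la] b by auto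
        then have "p = y' @ q' \<Longrightarrow> length q' = length q \<Longrightarrow> q' = q" for y' q' by simp
        then show ?thesis unfolding level_ok_def using level_fact[OF v b False] wf_target by fastforce
      qed
      ultimately show ?thesis using Cons.IH by blast
    qed
  qed
qed simp

lemma at_level_mem: "r \<in> set (at_level n lv) \<Longrightarrow> (n, r) \<in> set lv"
proof (induction lv)
  case (Cons e lv)
  obtain m x where "e = (m, x)" by (cases e)
  then show ?case using Cons by (cases "m = n") auto
qed simp

lemma descend_sound:
  assumes "descend P ds lv p n q rs (Some acc)" and l: "length s = n" "q = int n - 1"
    and v: "vsim (p @ False # True # s) (p @ True # False # s)" and ds: "\<And>D. D \<in> set ds \<Longrightarrow> tail_ok p D"
    and lv: "\<And>e. e \<in> set lv \<Longrightarrow> level_ok p s e"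
    and "\<And>r. r \<in> set acc \<Longrightarrow> good s r" and "\<And>r. r \<in> set rs \<Longrightarrow> \<exists>y. p = y @ r"
  shows "P s"
  using assms(1,7,8)
proof (induction rs arbitrary: acc)
  case Nil
  have "hits x s" if "x \<in> set (cores p)" for x using cores_hit[OF _ that] v by (simp add: vsim_def)
  moreover have "attempt P ds p n q p (Some acc)" using Nil(1) by simp
  ultimately show ?case using attempt_sound[where P = P and ds = ds and p = p and n = n and q = q and r = p and acc = acc and s = s] l v ds Nil(2)
    by blast
next
  case (Cons r rs)
  show ?case
  proof (cases "at_level (length r) lv")
    case Nil
    then show ?thesis using Cons by simp
  next
    case at: (Cons x xs)
    have d: "attempt P ds p n q r (Some acc)" "descend P ds lv p n q rs (start q (x # xs) (Some acc))"
      using Cons.prems(1) unfolding descend.simps at list.case by blast+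
    have ok: "level_ok p s (length r, y)" if "y \<in> set (x # xs)" for y
      using that at_level_mem[of y "length r" lv] lv unfolding at by blast
    show ?thesis
    proof (cases "\<forall>y\<in>set (x # xs). hits y s")
      case True
      then have "\<And>y. y \<in> set (x # xs) \<Longrightarrow> good s y" using ok by (auto simp: good_def level_ok_def)
      then obtain ts where ts: "start q (x # xs) (Some acc) = Some ts" "set ts = set (x # xs) \<union> set acc"
        using start_good[of "x # xs" s acc q] Cons.prems(2) l by fastforce
      have "descend P ds lv p n q rs (Some ts)" using d(2) ts(1) by simp
      moreover have "\<And>y. y \<in> set ts \<Longrightarrow> good s y"
        using ts(2) \<open>\<And>y. y \<in> set (x # xs) \<Longrightarrow> good s y\<close> Cons.prems(2) by blast
      moreover have "\<And>r. r \<in> set rs \<Longrightarrow> \<exists>y. p = y @ r" using Cons.prems(3) by simp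
      ultimately show ?thesis using Cons.IH by blast
    next
      case False
      then obtain y where y: "y \<in> set (x # xs)" "\<not> hits y s" by blast
      have "\<And>x. x \<in> set (cores r) \<Longrightarrow> hits x s"
        using ok[OF y(1)] y(2) Cons.prems(3)[of r] unfolding level_ok_def by force
      then show ?thesis using attempt_sound[OF d(1) l v ds Cons.prems(2)] by blast
    qed
  qed
qed

lemma suffs_suffix: "r \<in> set (suffs p) \<Longrightarrow> \<exists>y. p = y @ r"
proof (induction p)
  case (Cons x p)
  show ?case
  proof (cases "r = p")
    case True
    then show ?thesis by (intro exI[of _ "[x]"]) simp
  next
    case False
    then obtain y where "p = y @ r" using Cons by auto
    then show ?thesis by (intro exI[of _ "x # y"]) simp
  qed
qed simp

theorem check_prefix_sound:
  assumes "check_prefix dP dT P n q p" "length s = n" "q = int n - 1"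
    and v: "vsim (p @ False # True # s) (p @ True # False # s)"
  shows "P s"
  using assms(1) unfolding check_prefix_def
  by (rule descend_sound[OF _ assms(2,3) v]) (use tails_of_ok levels_of_ok[OF v] suffs_suffix in auto)

section \<open>Leaves\<close>

type_synonym weight = "int \<times> int \<times> int \<times> int \<times> bool \<times> bool"

definition dirsP :: "dir list" where "dirsP = [(-3, 1, False, True),
    (-3, 1, True, True),
    (-3, 1, False, False),
    (-3, 2, False, True),
    (-3, 2, True, True),
    (-2, 1, False, True),
    (-2, 1, True, True),
    (-2, 3, True, True),
    (-1, 0, True, True),
    (-1, 1, True, True),
    (-1, 1, False, False),
    (-1, 2, True, True),
    (1, -3, True, True),
    (1, -2, True, True),
    (1, -1, True, True),
    (1, -1, True, False),
    (2, -3, True, True),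
    (3, -2, False, True)]"
definition dirsT :: "dir list" where "dirsT = [(-2, 3, False, False),
    (-1, 1, True, True),
    (-1, 1, False, False),
    (-1, 2, False, False),
    (1, -2, True, False),
    (1, -1, True, True),
    (1, -1, True, False),
    (2, -3, True, False),
    (2, -1, False, True),
    (2, -1, True, False),
    (3, -2, True, False)]"
definition weights :: "weight list" where "weights = [(1, -1, -2, 2, True, True),
    (2, -1, 2, -2, True, False),
    (2, 1, -1, -2, True, False),
    (-1, 2, -2, 2, False, True),
    (-1, 2, 1, -2, True, True),
    (1, 2, -2, -1, False, True),
    (4, 6, 0, -11, True, False),
    (7, -2, -10, 4, True, True),
    (-1, 8, -5, -3, False, True),
    (-1, 10, -5, -3, False, True),
    (11, -4, 5, -11, True, True),
    (6, 11, -9, -4, False, True),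
    (-2, 6, -6, 1, True, True),
    (3, 5, 4, -11, False, False),
    (8, -3, -11, 4, True, True),
    (5, 0, -7, 6, True, True),
    (2, 5, -7, -1, False, True),
    (9, -1, -1, -6, True, False),
    (10, 0, -6, -7, True, False),
    (-4, 3, -6, 3, True, True),
    (-3, 6, -4, 1, False, False),
    (-5, 9, 2, -5, False, False),
    (-4, 7, -7, 5, False, False),
    (7, -3, -8, 2, True, True),
    (3, 9, -7, -4, False, True),
    (4, -2, 1, -3, True, True),
    (6, -3, 4, -8, True, False),
    (-1, 8, -8, 11, False, True),
    (2, 5, -7, -2, False, True),
    (-2, 5, -4, 0, True, True),
    (3, 6, -5, -5, False, False),
    (3, 6, -9, 1, False, True),
    (6, 4, -1, -10, True, False),
    (2, 1, 0, -2, True, False),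
    (-5, 6, 3, -6, True, False),
    (2, 1, -3, 1, True, True),
    (11, -4, 5, -11, True, False),
    (-1, 4, -4, 8, False, True),
    (12, -4, 12, -5, False, False),
    (-2, 5, -4, 11, False, False),
    (-1, 4, 1, -4, False, False),
    (2, 9, -11, 2, False, True),
    (-7, 15, -14, 7, False, False),
    (6, -3, 1, -4, True, True),
    (-1, 10, -10, 2, False, False),
    (7, 0, 0, -10, True, False),
    (7, 1, 1, -12, True, False),
    (-5, 11, -15, 5, True, True),
    (-5, 9, -12, 9, False, True),
    (-3, 10, -10, 6, False, False),
    (-12, 19, -12, 7, False, True),
    (17, -12, 7, -14, True, False),
    (0, 18, -19, 5, False, False)]"
definition sols :: "(bool list \<times> bool list) list" where "sols = [([False,True,True,False,False,True,True,False,False,True,True,False,False,True,False,True,True,True,True,False,True,False],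
     [False,True,True,False,False,True,True,False,True,False,True,False,False,True,False,True,True,True,True,False,True,False]),
    ([False,True,False,True,True,False,True,False,False,True,False,True,False,True,False,True,True,False,False,True,True,False],
     [False,True,False,True,True,False,True,False,False,True,True,False,False,True,False,True,True,False,False,True,True,False]),
    ([False,True,False,True,True,False,True,False,False,True,False,True,False,True,False,True,True,False,True,False,False,True],
     [False,True,False,True,True,False,True,False,False,True,True,False,False,True,False,True,True,False,True,False,False,True]),
    ([False,True,False,True,True,False,True,False,False,True,False,True,False,True,True,False,True,False,False,True,False,True],
     [False,True,False,True,True,False,True,False,False,True,True,False,False,True,True,False,True,False,False,True,False,True]),
    ([False,True,False,True,True,False,True,False,False,True,False,True,True,False,False,True,False,True,True,False,True,False],
     [False,True,False,True,True,False,True,False,False,True,True,False,True,False,False,True,False,True,True,False,True,False]),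
    ([False,True,False,True,True,False,True,False,False,True,False,True,True,False,True,False,False,True,False,True,True,False],
     [False,True,False,True,True,False,True,False,False,True,True,False,True,False,True,False,False,True,False,True,True,False]),
    ([False,True,True,False,False,True,True,False,True,False,False,True,True,False,False,True,False,True,True,False,True,False],
     [False,True,True,False,False,True,True,False,True,False,True,False,True,False,False,True,False,True,True,False,True,False]),
    ([False,True,True,False,False,True,True,False,True,False,False,True,True,False,True,False,False,True,False,True,True,False],
     [False,True,True,False,False,True,True,False,True,False,True,False,True,False,True,False,False,True,False,True,True,False]),
    ([False,True,True,False,False,True,True,False,True,False,False,True,True,False,True,False,False,True,True,False,False,True],
     [False,True,True,False,False,True,True,False,True,False,True,False,True,False,True,False,False,True,True,False,False,True]),
    ([False,True,True,False,True,False,False,True,False,True,False,True,False,True,False,True,True,False,False,True,True,False],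
     [False,True,True,False,True,False,False,True,False,True,True,False,False,True,False,True,True,False,False,True,True,False]),
    ([False,True,True,False,True,False,False,True,False,True,False,True,False,True,False,True,True,False,True,False,False,True],
     [False,True,True,False,True,False,False,True,False,True,True,False,False,True,False,True,True,False,True,False,False,True]),
    ([False,True,True,False,True,False,False,True,False,True,False,True,False,True,True,False,True,False,False,True,False,True],
     [False,True,True,False,True,False,False,True,False,True,True,False,False,True,True,False,True,False,False,True,False,True]),
    ([False,True,True,False,True,False,False,True,False,True,False,True,True,False,False,True,False,True,True,False,True,False],
     [False,True,True,False,True,False,False,True,False,True,True,False,True,False,False,True,False,True,True,False,True,False]),
    ([False,True,True,False,True,False,False,True,False,True,False,True,True,False,True,False,False,True,False,True,True,False],
     [False,True,True,False,True,False,False,True,False,True,True,False,True,False,True,False,False,True,False,True,True,False])]"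

fun raise_if :: "bool \<Rightarrow> int \<Rightarrow> int \<Rightarrow> int" where
  "raise_if True m u = pick (m \<le> u) u m" | "raise_if False m u = m"
fun raise_unless :: "bool \<Rightarrow> int \<Rightarrow> int \<Rightarrow> int" where
  "raise_unless False m u = pick (m \<le> u) u m" | "raise_unless True m u = m"

fun ev_step :: "weight \<Rightarrow> bool \<Rightarrow> int \<times> int \<times> int \<times> int \<Rightarrow> int \<times> int \<times> int \<times> int" where
  "ev_step (c1, c2, d1, d2, S, T) True (u, v, m, M) = (u + c2, v + d2, raise_if S m u, raise_if T M (m + v))"
| "ev_step (c1, c2, d1, d2, S, T) False (u, v, m, M) = (u + c1, v + d1, raise_unless S m u, raise_unless T M (m + v))"

primrec ev :: "weight \<Rightarrow> bool list \<Rightarrow> int \<times> int \<times> int \<times> int \<Rightarrow> int \<times> int \<times> int \<times> int" where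
  "ev F [] st = st"
| "ev F (t # w) st = ev F w (ev_step F t st)"

fun fourth :: "int \<times> int \<times> int \<times> int \<Rightarrow> int" where "fourth (u, v, m, M) = M"

fun cons_when :: "bool \<Rightarrow> bool list \<Rightarrow> bool list list \<Rightarrow> bool list list" where
  "cons_when True y ys = y # ys" | "cons_when False y ys = ys"

primrec keep :: "weight \<Rightarrow> int \<times> int \<times> int \<times> int \<Rightarrow> int \<Rightarrow> bool list list \<Rightarrow> bool list list" where
  "keep F st M [] = []"
| "keep F st M (y # ys) = cons_when (fourth (ev F y st) = M) y (keep F st M ys)"

fun agreeing :: "weight \<Rightarrow> int \<times> int \<times> int \<times> int \<Rightarrow> bool list \<Rightarrow> bool list list \<Rightarrow> bool list list" where
  "agreeing F st w ys = keep F st (fourth (ev F w st)) ys"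

primrec member :: "bool list \<times> bool list \<Rightarrow> (bool list \<times> bool list) list \<Rightarrow> bool" where
  "member x [] = False" | "member x (y # ys) = (x = y \<or> member x ys)"

fun kill :: "bool list \<Rightarrow> bool list \<Rightarrow> bool list list \<Rightarrow> weight list \<Rightarrow> bool" where
  "kill p w [] fs = True"
| "kill p w (y # ys) [] = list_all (\<lambda>z. member (p @ w, p @ z) sols) (y # ys)"
| "kill p w (y # ys) (F # fs) = kill p w (agreeing F (ev F p (0, 0, -9999, -99999)) w (y # ys)) fs"

fun arrangements :: "nat \<Rightarrow> nat \<Rightarrow> bool list \<Rightarrow> bool list list" where
  "arrangements 0 0 r = [r]"
| "arrangements 0 (Suc n) r = map (Cons True) (arrangements 0 n r)"
| "arrangements (Suc m) 0 r = map (Cons False) (arrangements m 0 r)"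
| "arrangements (Suc m) (Suc n) r = map (Cons False) (arrangements m (Suc n) r) @ map (Cons True) (arrangements (Suc m) n r)"

fun bump_nat :: "bool \<Rightarrow> nat \<times> nat \<Rightarrow> nat \<times> nat" where
  "bump_nat True (x, y) = (x, Suc y)" | "bump_nat False (x, y) = (Suc x, y)"
primrec counts :: "bool list \<Rightarrow> nat \<times> nat" where
  "counts [] = (0, 0)"
| "counts (t # w) = bump_nat t (counts w)"

fun rivals :: "bool list \<Rightarrow> bool list \<Rightarrow> bool list \<Rightarrow> nat \<times> nat \<Rightarrow> bool" where
  "rivals p w r (x, 0) = True"
| "rivals p w r (x, Suc y) = kill p w (map (Cons True) (arrangements x y r)) weights"

fun window :: "bool list \<Rightarrow> nat \<Rightarrow> bool list \<Rightarrow> bool" where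
  "window p n w = rivals p w (drop n w) (counts (take n w))"

fun leaf_from :: "bool list \<Rightarrow> nat \<Rightarrow> bool list \<Rightarrow> bool list \<Rightarrow> bool" where
  "leaf_from p n as [] = window p n (as @ [True])"
| "leaf_from p n as (True # s) = window p n (as @ True # True # s)"
| "leaf_from p n as (False # s) = (window p n (as @ True # False # s) \<and> leaf_from p n (False # as) s)"

fun leaf :: "bool list \<Rightarrow> nat \<Rightarrow> bool list \<Rightarrow> bool" where "leaf p n s = leaf_from p n [False] s"

primrec checks :: "nat \<Rightarrow> nat \<Rightarrow> nat \<Rightarrow> int \<Rightarrow> bool list \<Rightarrow> bool" where
  "checks 0 m n q p = check_prefix dirsP dirsT (leaf p m) n q p"
| "checks (Suc k) m n q p = (checks k m n q (p @ [False]) \<and> checks k m n q (p @ [True]))"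

section \<open>Soundness\<close>

lemma ev_spec:
  "\<exists>m' M'. ev (c1, c2, d1, d2, S, T) w (u, v, m, M) = (u + val c1 c2 w, v + val d1 d2 w, m', M') \<and>
     (\<forall>K. M' \<le> K \<longleftrightarrow> M \<le> K \<and> (\<forall>y z. w = y @ T # z \<longrightarrow> m + v + val d1 d2 y \<le> K) \<and>
       (\<forall>x y z. w = x @ S # y @ T # z \<longrightarrow> u + val c1 c2 x + v + val d1 d2 (x @ S # y) \<le> K))"
proof (induction w arbitrary: u v m M)
  case (Cons t w)
  define m1 M1 u1 v1 where d: "m1 = (if t = S \<and> m \<le> u then u else m)" "M1 = (if t = T \<and> M \<le> m + v then m + v else M)"
    "u1 = u + (if t then c2 else c1)" "v1 = v + (if t then d2 else d1)"
  have s: "ev_step (c1, c2, d1, d2, S, T) t (u, v, m, M) = (u1, v1, m1, M1)"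
    by (cases t; cases S; cases T) (auto simp: d)
  obtain m' M' where e: "ev (c1, c2, d1, d2, S, T) w (u1, v1, m1, M1) = (u1 + val c1 c2 w, v1 + val d1 d2 w, m', M')"
    and M': "\<And>K. M' \<le> K \<longleftrightarrow> M1 \<le> K \<and> (\<forall>y z. w = y @ T # z \<longrightarrow> m1 + v1 + val d1 d2 y \<le> K) \<and>
       (\<forall>x y z. w = x @ S # y @ T # z \<longrightarrow> u1 + val c1 c2 x + v1 + val d1 d2 (x @ S # y) \<le> K)"
    using Cons.IH by blast
  have 1: "(\<forall>y z. t # w = y @ T # z \<longrightarrow> P y) \<longleftrightarrow> (t = T \<longrightarrow> P []) \<and> (\<forall>y z. w = y @ T # z \<longrightarrow> P (t # y))" for P
    by (auto simp: Cons_eq_append_conv)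
  have 2: "(\<forall>x y z. t # w = x @ S # y @ T # z \<longrightarrow> P x y) \<longleftrightarrow> (t = S \<longrightarrow> (\<forall>y z. w = y @ T # z \<longrightarrow> P [] y)) \<and>
     (\<forall>x y z. w = x @ S # y @ T # z \<longrightarrow> P (t # x) y)" for P
    by (auto simp: Cons_eq_append_conv)
  have "M' \<le> K \<longleftrightarrow> M \<le> K \<and> (\<forall>y z. t # w = y @ T # z \<longrightarrow> m + v + val d1 d2 y \<le> K) \<and>
       (\<forall>x y z. t # w = x @ S # y @ T # z \<longrightarrow> u + val c1 c2 x + v + val d1 d2 (x @ S # y) \<le> K)" for K
  proof -
    have M1: "M1 \<le> K \<longleftrightarrow> M \<le> K \<and> (t = T \<longrightarrow> m + v \<le> K)" by (auto simp: d)
    have m1: "m1 + v1 + k \<le> K \<longleftrightarrow> m + v1 + k \<le> K \<and> (t = S \<longrightarrow> u + v1 + k \<le> K)" for k by (auto simp: d)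
    show ?thesis unfolding M' 1 2 M1 m1 by (auto simp: d(3,4) add_ac)
  qed
  then show ?case using e by (auto simp: s d(3,4) add_ac)
qed auto

lemma equiv3_ev:
  assumes e: "equiv3 w v"
  shows "fourth (ev F w (0, 0, m, M)) = fourth (ev F v (0, 0, m, M))"
proof -
  obtain c1 c2 d1 d2 S T where F: "F = (c1, c2, d1, d2, S, T)" by (cases F)
  have le: "fourth (ev F x (0, 0, m, M)) \<le> fourth (ev F y (0, 0, m, M))" if d1: "dom1 x y" and d2: "dom2 x y" for x y
  proof -
    obtain m1 M1 where 1: "ev F x (0, 0, m, M) = (0 + val c1 c2 x, 0 + val d1 d2 x, m1, M1)"
      "\<And>K. M1 \<le> K \<longleftrightarrow> M \<le> K \<and> (\<forall>y z. x = y @ T # z \<longrightarrow> m + 0 + val d1 d2 y \<le> K) \<and>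
       (\<forall>x' y z. x = x' @ S # y @ T # z \<longrightarrow> 0 + val c1 c2 x' + 0 + val d1 d2 (x' @ S # y) \<le> K)"
      using ev_spec[of c1 c2 d1 d2 S T x 0 0 m M] unfolding F by blast
    obtain m2 M2 where 2: "ev F y (0, 0, m, M) = (0 + val c1 c2 y, 0 + val d1 d2 y, m2, M2)"
      "\<And>K. M2 \<le> K \<longleftrightarrow> M \<le> K \<and> (\<forall>x z. y = x @ T # z \<longrightarrow> m + 0 + val d1 d2 x \<le> K) \<and>
       (\<forall>x' x z. y = x' @ S # x @ T # z \<longrightarrow> 0 + val c1 c2 x' + 0 + val d1 d2 (x' @ S # x) \<le> K)"
      using ev_spec[of c1 c2 d1 d2 S T y 0 0 m M] unfolding F by blast
    have M2: "M \<le> M2" "\<And>x z. y = x @ T # z \<Longrightarrow> m + val d1 d2 x \<le> M2"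
       "\<And>x' x z. y = x' @ S # x @ T # z \<Longrightarrow> val c1 c2 x' + val d1 d2 (x' @ S # x) \<le> M2"
      using 2(2)[of M2] by auto
    have "M1 \<le> M2" unfolding 1(2)
    proof (intro conjI allI impI)
      fix r z assume "x = r @ T # z"
      then obtain r' z' where "y = r' @ T # z'" "val d1 d2 r \<le> val d1 d2 r'" using dom1D[OF d1] by blast
      then show "m + 0 + val d1 d2 r \<le> M2" using M2(2) by fastforce
    next
      fix r s z assume "x = r @ S # s @ T # z"
      then obtain r' s' z' where y: "y = r' @ S # s' @ T # z'"
        and "val (c1 + d1) (c2 + d2) r + val d1 d2 s \<le> val (c1 + d1) (c2 + d2) r' + val d1 d2 s'"
        using d2[unfolded dom2_def] by blast
      then show "0 + val c1 c2 r + 0 + val d1 d2 (r @ S # s) \<le> M2"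
        using M2(3)[OF y] by (auto simp: val_def algebra_simps)
    qed (use M2 in auto)
    then show ?thesis using 1(1) 2(1) by simp
  qed
  show ?thesis using le[of w v] le[of v w] e unfolding equiv3_def eq2_def by auto
qed

lemma ev_append: "ev F (p @ w) st = ev F w (ev F p st)"
  by (induction p arbitrary: st) auto

lemma keep_mem: "y \<in> set (keep F st M ys) \<longleftrightarrow> y \<in> set ys \<and> fourth (ev F y st) = M"
proof (induction ys)
  case (Cons z ys)
  then show ?case by (cases "fourth (ev F z st) = M") auto
qed auto

lemma member_iff: "member x xs \<longleftrightarrow> x \<in> set xs"
  by (induction xs) auto

lemma kill_sound: "kill p w ys fs \<Longrightarrow> z \<in> set ys \<Longrightarrow> equiv3 (p @ w) (p @ z) \<Longrightarrow> (p @ w, p @ z) \<in> set sols"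
proof (induction fs arbitrary: ys)
  case Nil
  then show ?case by (cases ys) (auto simp: list_all_iff member_iff)
next
  case (Cons F fs)
  obtain y ys' where ys: "ys = y # ys'" using Cons.prems by (cases ys) auto
  have "fourth (ev F w (ev F p (0, 0, -9999, -99999))) = fourth (ev F z (ev F p (0, 0, -9999, -99999)))"
    using equiv3_ev[OF Cons.prems(3), of F] by (simp only: ev_append)
  then have "z \<in> set (agreeing F (ev F p (0, 0, -9999, -99999)) w ys)"
    using Cons.prems(2) by (simp add: keep_mem)
  then show ?case using Cons.IH Cons.prems(1,3) unfolding ys kill.simps by blast
qed

lemma counts_eq: "counts w = (count_list w False, count_list w True)"
proof (induction w)
  case (Cons t w)
  then show ?case by (cases t) auto
qed auto

lemma arrangements_mem: "u @ r \<in> set (arrangements (count_list u False) (count_list u True) r)"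
proof (induction u)
  case (Cons t u)
  then show ?case by (cases t; cases "count_list u False"; cases "count_list u True") auto
qed auto

lemma window_sound:
  assumes "window p n w" "length w = length (True # z)" "drop n w = drop n (True # z)" "0 < n" "equiv3 (p @ w) (p @ True # z)"
  shows "(p @ w, p @ True # z) \<in> set sols"
proof -
  obtain n' where n: "n = Suc n'" using assms(4) by (cases n) auto
  have cut: "p @ w = p @ take n w @ drop n w" "p @ True # z = p @ take n (True # z) @ drop n w"
    by (simp only: append_take_drop_id, simp only: assms(3) append_take_drop_id)
  have "na (p @ take n w @ drop n w) = na (p @ take n (True # z) @ drop n w)"
    "nb (p @ take n w @ drop n w) = nb (p @ take n (True # z) @ drop n w)"
    using assms(5) unfolding cut[symmetric] equiv3_def eq2_def by blast+
  then have "na (take n w) = na (take n (True # z))" "nb (take n w) = nb (take n (True # z))"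
    unfolding na_simps(3) nb_simps(3) by linarith+
  then have c: "count_list (take n w) False = count_list (take n' z) False" "count_list (take n w) True = Suc (count_list (take n' z) True)"
    by (auto simp: na_def nb_def n)
  have "take n' z @ drop n w \<in> set (arrangements (count_list (take n' z) False) (count_list (take n' z) True) (drop n w))"
    by (rule arrangements_mem)
  moreover have "take n' z @ drop n w = z" using assms(3) by (simp add: n)
  ultimately have "True # z \<in> set (map (Cons True) (arrangements (count_list (take n' z) False) (count_list (take n' z) True) (drop n w)))"
    by auto
  moreover have "kill p w (map (Cons True) (arrangements (count_list (take n' z) False) (count_list (take n' z) True) (drop n w))) weights"
    using assms(1) by (simp add: counts_eq c)
  ultimately show ?thesis using kill_sound assms(5) by blast
qed

lemma leaf_from_sound: "leaf_from p n as (replicate i False @ x) \<Longrightarrow> window p n (replicate i False @ as @ True # x)"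
proof (induction i arbitrary: as)
  case 0
  then show ?case
  proof (cases x)
    case (Cons t x')
    then show ?thesis using 0 by (cases t) (auto simp del: window.simps)
  qed (simp del: window.simps)
next
  case (Suc i)
  then have "leaf_from p n (False # as) (replicate i False @ x)" by simp
  from Suc.IH[OF this] show ?case by (simp add: replicate_app_Cons_same del: window.simps)
qed

lemma checks_sound: "checks k m n q p \<Longrightarrow> length r = k \<Longrightarrow> check_prefix dirsP dirsT (leaf (p @ r) m) n q (p @ r)"
proof (induction k arbitrary: p r)
  case (Suc k)
  then obtain t r' where r: "r = t # r'" by (cases r) auto
  then have "checks k m n q (p @ [t])" using Suc.prems by (cases t) auto
  from Suc.IH[OF this, of r'] show ?case using Suc.prems r by simp
qed simp

lemma prefix_classified:
  assumes c: "check_prefix dirsP dirsT (leaf p m) n q p" and l: "length p + n + 2 = length w" "q = int n - 1"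
    and w: "w = p @ replicate (Suc i) False @ True # x" and v: "v = p @ True # z" and e: "equiv3 w v" and m: "0 < m"
    and d: "drop (length p + m) w = drop (length p + m) v"
  shows "(w, v) \<in> set sols"
proof -
  let ?s = "replicate i False @ x"
  have "vsim (p @ False # True # ?s) (p @ True # False # ?s)" using adjacent_exists[OF equiv3_vsim[OF e] w v] .
  moreover have "length ?s = n" using l w by simp
  ultimately have "leaf p m ?s" using check_prefix_sound[OF c _ l(2)] by blast
  then have "window p m (replicate i False @ [False] @ True # x)" using leaf_from_sound[of p m "[False]" i x] by (simp del: window.simps)
  moreover have r: "replicate i False @ [False] @ True # x = replicate (Suc i) False @ True # x"
    by (simp add: replicate_app_Cons_same)
  ultimately have "window p m (replicate (Suc i) False @ True # x)" by (simp only:)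
  moreover have "length w = length v" using e eq2_length by (auto simp: equiv3_def)
  ultimately show ?thesis using window_sound[of p m "replicate (Suc i) False @ True # x" z] w v e m d
    by (simp del: window.simps replicate.simps)
qed

section \<open>Certificates\<close>

fun push :: "bool \<Rightarrow> int \<times> int \<Rightarrow> bool list \<times> int list \<Rightarrow> bool list \<times> int list" where
  "push S (x, y) (ls, cs) = (S # ls, x # y # cs)"

fun flat :: "int \<times> int \<Rightarrow> int list" where "flat (x, y) = [x, y]"

primrec point :: "nat list \<Rightarrow> bool list \<Rightarrow> bool list \<times> int list" where
  "point [] w = ([], flat (endpoint w))"
| "point (g # gs) w = push (hd (drop g w)) (endpoint (take g w)) (point gs (tl (drop g w)))"

primrec fits :: "nat list \<Rightarrow> bool list \<Rightarrow> bool" where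
  "fits [] w = True"
| "fits (g # gs) w = (g < length w \<and> fits gs (drop (Suc g) w))"

definition vadd :: "int list \<Rightarrow> int list \<Rightarrow> int list" where "vadd xs ys = map2 (+) xs ys"
definition vsub :: "int list \<Rightarrow> int list \<Rightarrow> int list" where "vsub xs ys = map2 (-) xs ys"

primrec drift :: "int list \<Rightarrow> int list list \<Rightarrow> int list" where
  "drift z [] = vsub z z"
| "drift z (q # qs) = vadd (vsub q z) (drift z qs)"

fun balanced :: "bool list \<times> int list \<Rightarrow> (bool list \<times> int list) list \<Rightarrow> bool" where
  "balanced (ls, z) qs = (qs \<noteq> [] \<and> list_all (\<lambda>q. fst q = ls) qs \<and> list_all (\<lambda>x. x = 0) (drift z (map snd qs)))"

type_synonym entry = "nat list \<times> nat list list \<times> nat list list"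

fun entry_ok :: "bool list \<Rightarrow> bool list \<Rightarrow> nat list list \<Rightarrow> entry \<Rightarrow> bool" where
  "entry_ok v w known (m, own, other) = (list_all (\<lambda>o1. o1 \<in> set known) own \<and> list_all (\<lambda>q. fits q v) other \<and>
     balanced (point m w) (map (\<lambda>q. point q w) own @ map (\<lambda>q. point q v) other))"

definition marks :: "nat \<Rightarrow> nat list list" where
  "marks n = map (\<lambda>i. [i]) [0..<n] @ concat (map (\<lambda>i. map (\<lambda>g. [i, g]) [0..<n - Suc i]) [0..<n])"

primrec certified :: "bool list \<Rightarrow> bool list \<Rightarrow> entry list \<Rightarrow> nat list list \<Rightarrow> bool" where
  "certified v w [] known = list_all (\<lambda>m. fits m v \<and> point m w = point m v \<or> m \<in> set known) (marks (length w))"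
| "certified v w (e # es) known = (entry_ok v w known e \<and> certified v w es (fst e # known))"

definition monom :: "(nat \<Rightarrow> trop) \<Rightarrow> int list \<Rightarrow> trop" where
  "monom h xs = (\<Prod>k<length xs. h k ^ nat (xs ! k))"

definition below :: "bool list \<Rightarrow> bool list \<times> int list \<Rightarrow> bool" where
  "below v z \<longleftrightarrow> (\<forall>h. \<exists>gs. fits gs v \<and> fst (point gs v) = fst z \<and> tle (monom h (snd z)) (monom h (snd (point gs v))))"

lemma prod_list_small:
  assumes "ys \<noteq> []" "\<forall>y\<in>set ys. \<not> tle (Fin a) y"
  shows "prod_list ys = MInfty \<or> (\<exists>b. prod_list ys = Fin b \<and> b < real (length ys) * a)"
  using assms
proof (induction ys rule: list_nonempty_induct)
  case (single y)
  then show ?case by (cases y) (auto simp: one_trop_def)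
next
  case (cons y ys)
  then show ?case by (cases y) (auto simp: algebra_simps)
qed

lemma power_Fin: "Fin a ^ n = Fin (real n * a)"
  by (induction n) (auto simp: one_trop_def algebra_simps)

lemma factor_above:
  assumes "x ^ length ys = prod_list ys" "ys \<noteq> []"
  shows "\<exists>y\<in>set ys. tle x y"
proof (cases x)
  case MInfty
  then show ?thesis using assms(2) by (cases ys) auto
next
  case (Fin a)
  have "prod_list ys = Fin (real (length ys) * a)" using assms(1) Fin by (simp add: power_Fin)
  then show ?thesis using assms(2) Fin prod_list_small[of ys a] by auto
qed

lemma drift_nth:
  assumes "\<forall>q\<in>set qs. length q = length z"
  shows "length (drift z qs) = length z \<and> (\<forall>k<length z. drift z qs ! k = (\<Sum>q\<leftarrow>qs. q ! k - z ! k))"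
  using assms by (induction qs) (auto simp: vadd_def vsub_def)

lemma prod_monom:
  assumes "\<forall>q\<in>set qs. length q = n"
  shows "prod_list (map (monom h) qs) = (\<Prod>k<n. h k ^ (\<Sum>q\<leftarrow>qs. nat (q ! k)))"
  using assms by (induction qs) (auto simp: monom_def power_add prod.distrib)

lemma balanced_monom:
  assumes "balanced (ls, z) qs" "\<forall>q\<in>set qs. length (snd q) = length z" "\<forall>x\<in>set z. 0 \<le> x" "\<forall>q\<in>set qs. \<forall>x\<in>set (snd q). 0 \<le> x"
  shows "\<exists>q\<in>set qs. fst q = ls \<and> tle (monom h z) (monom h (snd q))"
proof -
  have d: "\<forall>k<length z. drift z (map snd qs) ! k = (\<Sum>q\<leftarrow>map snd qs. q ! k - z ! k)" "length (drift z (map snd qs)) = length z"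
    using drift_nth[of "map snd qs" z] assms(2) by auto
  have e: "(\<Sum>q\<leftarrow>map snd qs. nat (q ! k)) = length qs * nat (z ! k)" if k: "k < length z" for k
  proof -
    have "drift z (map snd qs) ! k = 0" using assms(1) k d(2) by (auto simp: list_all_iff)
    then have "(\<Sum>q\<leftarrow>map snd qs. q ! k) = int (length qs) * z ! k"
      using d(1) k by (simp add: sum_list_subtractf[of "\<lambda>q. q ! k" "\<lambda>q. z ! k" "map snd qs"] sum_list_triv del: map_map)
    moreover have "(\<Sum>q\<leftarrow>map snd qs. q ! k) = int (\<Sum>q\<leftarrow>map snd qs. nat (q ! k))"
      using assms(2,4) k by (induction qs) auto
    moreover have "0 \<le> z ! k" using assms(3) k by auto
    ultimately have "int (\<Sum>q\<leftarrow>map snd qs. nat (q ! k)) = int (length qs * nat (z ! k))" by simp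
    then show ?thesis by (simp only: of_nat_eq_iff)
  qed
  have "prod_list (map (monom h) (map snd qs)) = (\<Prod>k<length z. h k ^ (\<Sum>q\<leftarrow>map snd qs. nat (q ! k)))"
    by (rule prod_monom) (use assms(2) in auto)
  also have "\<dots> = (\<Prod>k<length z. (h k ^ nat (z ! k)) ^ length qs)"
    by (rule prod.cong) (auto simp only: e power_mult[symmetric] mult.commute lessThan_iff)
  also have "\<dots> = monom h z ^ length (map (monom h) (map snd qs))" by (simp add: monom_def prod_power_distrib)
  finally show ?thesis
    using factor_above[of "monom h z" "map (monom h) (map snd qs)"] assms(1) by (auto simp: list_all_iff)
qed

lemma point_Cons: "point (g # gs) w =
    (hd (drop g w) # fst (point gs (tl (drop g w))), na (take g w) # nb (take g w) # snd (point gs (tl (drop g w))))"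
  by (cases "point gs (tl (drop g w))") (simp add: endpoint_eq)

lemma point_Nil: "point [] w = ([], [na w, nb w])"
  by (simp add: endpoint_eq)

lemma point_length: "length (snd (point gs w)) = 2 * length (fst (point gs w)) + 2"
  by (induction gs arbitrary: w) (simp_all add: point_Cons point_Nil del: point.simps)

lemma point_nonneg: "x \<in> set (snd (point gs w)) \<Longrightarrow> 0 \<le> x"
  by (induction gs arbitrary: w) (auto simp: point_Cons point_Nil simp del: point.simps)

lemma certified_sound:
  assumes "certified v w es known" "\<forall>m\<in>set known. below v (point m w)" "m \<in> set (marks (length w))" "fits m w"
  shows "below v (point m w)"
  using assms(1,2)
proof (induction es arbitrary: known)
  case Nil
  then have "fits m v \<and> point m w = point m v \<or> m \<in> set known" using assms(3,4) by (auto simp: list_all_iff)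
  moreover have "tle (monom h z) (monom h z)" for h z by simp
  ultimately show ?case using Nil(2) unfolding below_def by metis
next
  case (Cons e es)
  obtain z own other where e: "e = (z, own, other)" by (cases e)
  have ok: "entry_ok v w known (z, own, other)" using Cons.prems(1) e by simp
  let ?qs = "map (\<lambda>q. point q w) own @ map (\<lambda>q. point q v) other"
  obtain ls cs where z: "point z w = (ls, cs)" by (cases "point z w")
  have b: "balanced (ls, cs) ?qs" using ok z by simp
  have l: "\<forall>q\<in>set ?qs. length (snd q) = length cs"
  proof
    fix q assume q: "q \<in> set ?qs"
    then obtain y x where "q = point y x" by auto
    moreover have "fst q = ls" using b q by (auto simp: list_all_iff)
    ultimately show "length (snd q) = length cs" using point_length[of y x] point_length[of z w] z by simp
  qed
  have "below v (point z w)" unfolding below_def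
  proof
    fix h
    have "\<exists>q\<in>set ?qs. fst q = ls \<and> tle (monom h cs) (monom h (snd q))"
      by (rule balanced_monom[OF b l]) (use point_nonneg[of _ z w] z point_nonneg in auto)
    then obtain q where q: "q \<in> set ?qs" "fst q = ls" "tle (monom h cs) (monom h (snd q))" by blast
    then consider y where "y \<in> set own" "q = point y w" | y where "y \<in> set other" "q = point y v" by auto
    then show "\<exists>gs. fits gs v \<and> fst (point gs v) = fst (point z w) \<and> tle (monom h (snd (point z w))) (monom h (snd (point gs v)))"
    proof cases
      case 1
      then have "below v q" using ok Cons.prems(2) by (auto simp: list_all_iff)
      then show ?thesis using q tle_trans unfolding z below_def fst_conv snd_conv by metis
    next
      case 2
      then show ?thesis using q ok unfolding z by (auto simp: list_all_iff)
    qed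
  qed
  then have "\<forall>m\<in>set (z # known). below v (point m w)" using Cons.prems(2) by auto
  moreover have "certified v w es (z # known)" using Cons.prems(1) e by simp
  ultimately show ?case by (rule Cons.IH[rotated])
qed

context
  fixes f :: "bool \<Rightarrow> trop mat"
  assumes f: "\<And>t. f t \<in> UT 3"
begin

lemma mon_power: "mon f i u = (f False $$ (i, i)) ^ nat (na u) * (f True $$ (i, i)) ^ nat (nb u)"
proof (induction u)
  case (Cons t u)
  have "nat (1 + na u) = Suc (nat (na u))" "nat (1 + nb u) = Suc (nat (nb u))" by (simp_all add: nat_add_distrib)
  then show ?case using Cons by (cases t) (simp_all add: mult_ac)
qed simp

lemma point1: "point [length u] (u @ S # x) = ([S], [na u, nb u, na x, nb x])"
  by (simp add: point_Cons point_Nil del: point.simps)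

lemma point2: "point [length u, length x] (u @ S # x @ T # y) = ([S, T], [na u, nb u, na x, nb x, na y, nb y])"
  by (simp add: point_Cons point_Nil del: point.simps)

declare point.simps [simp del]

lemma point_letters: "length (fst (point gs v)) = length gs"
  by (induction gs arbitrary: v) (simp_all add: point_Cons point_Nil del: point.simps)

lemma marks_mem: "i < n \<Longrightarrow> [i] \<in> set (marks n)" "i + Suc g < n \<Longrightarrow> [i, g] \<in> set (marks n)"
  by (simp_all add: marks_def image_iff)

lemma fits_cases:
  assumes "fits gs v"
  obtains "gs = []" | u S x where "gs = [length u]" "v = u @ S # x"
  | u S x T y where "gs = [length u, length x]" "v = u @ S # x @ T # y" | "2 < length gs"
proof -
  have c: "\<exists>u S x. v = u @ S # x \<and> length u = g \<and> drop (Suc g) v = x" if "g < length v" for g and v :: "bool list"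
    using that id_take_nth_drop[of g v] by (metis length_take min.absorb4)
  consider "gs = []" | g where "gs = [g]" | g h where "gs = [g, h]" | "2 < length gs"
    by (metis One_nat_def Suc_1 Suc_lessI length_0_conv length_Suc_conv less_Suc_eq_0_disj linorder_neqE_nat not_less_eq)
  then show thesis
  proof cases
    case 2
    then show thesis using that(2) c[of g v] assms by auto
  next
    case 3
    then obtain u S x where 1: "v = u @ S # x" "length u = g" "drop (Suc g) v = x" using c[of g v] assms by auto
    then obtain u' T y where 2: "x = u' @ T # y" "length u' = h" using c[of h x] assms 3 by auto
    show thesis using that(3)[of u u' S T y] 3 1 2 by simp
  qed (use that in auto)
qed

lemma entry_le:
  assumes i: "i < 2" and b: "\<And>gs. fits gs w \<Longrightarrow> gs \<in> set (marks (length w)) \<Longrightarrow> below v (point gs w)"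
  shows "tle (matprod f w $$ (i, Suc i)) (matprod f v $$ (i, Suc i))"
proof -
  consider "matprod f w $$ (i, Suc i) = 0" | u S x where "w = u @ S # x"
    "matprod f w $$ (i, Suc i) = mon f i u * f S $$ (i, Suc i) * mon f (Suc i) x"
    using entry_01_attained[where f = f and w = w, OF f i] by blast
  then show ?thesis
  proof cases
    case (2 u S x)
    define h where "h k = [f False $$ (i, i), f True $$ (i, i), f False $$ (Suc i, Suc i), f True $$ (Suc i, Suc i)] ! k" for k
    have m: "monom h [na u, nb u, na x, nb x] = mon f i u * mon f (Suc i) x" for u x
      by (simp add: monom_def h_def mon_power numeral_eq_Suc lessThan_Suc mult_ac)
    have "below v ([S], [na u, nb u, na x, nb x])"
      using b[of "[length u]"] marks_mem(1)[of "length u" "length w"] point1[of u S x] 2(1) by simp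
    then obtain gs where gs: "fits gs v" "fst (point gs v) = [S]"
      "tle (monom h [na u, nb u, na x, nb x]) (monom h (snd (point gs v)))" unfolding below_def by auto
    from gs(1) obtain u' x' where v: "v = u' @ S # x'" "gs = [length u']"
    proof (cases rule: fits_cases)
      case (2 u S' x)
      then show thesis using that gs(2) point1 by auto
    qed (use gs(2) point_letters[of gs v] in auto)
    have "tle (mon f i u * mon f (Suc i) x) (mon f i u' * mon f (Suc i) x')" using gs(3) unfolding v point1 snd_conv m .
    then have "tle (f S $$ (i, Suc i) * (mon f i u * mon f (Suc i) x)) (f S $$ (i, Suc i) * (mon f i u' * mon f (Suc i) x'))"
      by (rule tle_mult)
    moreover have "tle (mon f i u' * f S $$ (i, Suc i) * mon f (Suc i) x') (matprod f v $$ (i, Suc i))"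
      unfolding v by (rule entry_01_ge[where f = f, OF f i])
    moreover have "f S $$ (i, Suc i) * (mon f i u * mon f (Suc i) x) = mon f i u * f S $$ (i, Suc i) * mon f (Suc i) x" for u x
      by (simp only: mult_ac)
    ultimately show ?thesis unfolding 2(2) by (simp only:) (rule tle_trans)
  qed simp
qed

lemma corner_le:
  assumes b: "\<And>gs. fits gs w \<Longrightarrow> gs \<in> set (marks (length w)) \<Longrightarrow> below v (point gs w)"
  shows "tle (matprod f w $$ (0, 2)) (matprod f v $$ (0, 2))"
proof -
  consider "matprod f w $$ (0, 2) = 0" | u S x where "w = u @ S # x" "matprod f w $$ (0, 2) = mon f 0 u * f S $$ (0, 2) * mon f 2 x"
    | u S x T y where "w = u @ S # x @ T # y"
       "matprod f w $$ (0, 2) = mon f 0 u * f S $$ (0, 1) * mon f 1 x * f T $$ (1, 2) * mon f 2 y"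
    using entry_02_attained[where f = f and w = w, OF f] by blast
  then show ?thesis
  proof cases
    case (2 u S x)
    define h where "h k = [f False $$ (0, 0), f True $$ (0, 0), f False $$ (2, 2), f True $$ (2, 2)] ! k" for k
    have m: "monom h [na u, nb u, na x, nb x] = mon f 0 u * mon f 2 x" for u x
      by (simp add: monom_def h_def mon_power numeral_eq_Suc lessThan_Suc mult_ac)
    have "below v ([S], [na u, nb u, na x, nb x])"
      using b[of "[length u]"] marks_mem(1)[of "length u" "length w"] point1[of u S x] 2(1) by simp
    then obtain gs where gs: "fits gs v" "fst (point gs v) = [S]"
      "tle (monom h [na u, nb u, na x, nb x]) (monom h (snd (point gs v)))" unfolding below_def by auto
    from gs(1) obtain u' x' where v: "v = u' @ S # x'" "gs = [length u']"
    proof (cases rule: fits_cases)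
      case (2 u S' x)
      then show thesis using that gs(2) point1 by auto
    qed (use gs(2) point_letters[of gs v] in auto)
    have "tle (mon f 0 u * mon f 2 x) (mon f 0 u' * mon f 2 x')" using gs(3) unfolding v point1 snd_conv m .
    then have "tle (f S $$ (0, 2) * (mon f 0 u * mon f 2 x)) (f S $$ (0, 2) * (mon f 0 u' * mon f 2 x'))"
      by (rule tle_mult)
    moreover have "tle (mon f 0 u' * f S $$ (0, 2) * mon f 2 x') (matprod f v $$ (0, 2))"
      unfolding v by (rule entry_02_ge1[where f = f, OF f])
    moreover have "f S $$ (0, 2) * (mon f 0 u * mon f 2 x) = mon f 0 u * f S $$ (0, 2) * mon f 2 x" for u x
      by (simp only: mult_ac)
    ultimately show ?thesis unfolding 2(2) by (simp only:) (rule tle_trans)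
  next
    case (3 u S x T y)
    define h where "h k = [f False $$ (0, 0), f True $$ (0, 0), f False $$ (1, 1), f True $$ (1, 1), f False $$ (2, 2), f True $$ (2, 2)] ! k" for k
    have m: "monom h [na u, nb u, na x, nb x, na y, nb y] = mon f 0 u * mon f 1 x * mon f 2 y" for u x y
      by (simp add: monom_def h_def mon_power numeral_eq_Suc lessThan_Suc mult_ac)
    have "below v ([S, T], [na u, nb u, na x, nb x, na y, nb y])"
      using b[of "[length u, length x]"] marks_mem(2)[of "length u" "length x" "length w"] point2[of u x S T y] 3(1) by simp
    then obtain gs where gs: "fits gs v" "fst (point gs v) = [S, T]"
      "tle (monom h [na u, nb u, na x, nb x, na y, nb y]) (monom h (snd (point gs v)))" unfolding below_def by auto
    from gs(1) obtain u' x' y' where v: "v = u' @ S # x' @ T # y'" "gs = [length u', length x']"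
    proof (cases rule: fits_cases)
      case (3 u S' x T' y)
      then show thesis using that gs(2) point2 by auto
    qed (use gs(2) point_letters[of gs v] in auto)
    let ?k = "f S $$ (0, 1) * f T $$ (1, 2)"
    have "tle (mon f 0 u * mon f 1 x * mon f 2 y) (mon f 0 u' * mon f 1 x' * mon f 2 y')" using gs(3) unfolding v point2 snd_conv m .
    then have "tle (?k * (mon f 0 u * mon f 1 x * mon f 2 y)) (?k * (mon f 0 u' * mon f 1 x' * mon f 2 y'))"
      by (rule tle_mult)
    moreover have "tle (mon f 0 u' * f S $$ (0, 1) * mon f 1 x' * f T $$ (1, 2) * mon f 2 y') (matprod f v $$ (0, 2))"
      unfolding v by (rule entry_02_ge2[where f = f, OF f])
    moreover have "?k * (mon f 0 u' * mon f 1 x' * mon f 2 y') = mon f 0 u' * f S $$ (0, 1) * mon f 1 x' * f T $$ (1, 2) * mon f 2 y'"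
      "?k * (mon f 0 u * mon f 1 x * mon f 2 y) = mon f 0 u * f S $$ (0, 1) * mon f 1 x * f T $$ (1, 2) * mon f 2 y"
      by (simp_all only: mult_ac)
    ultimately show ?thesis unfolding 3(2) by (simp only:) (rule tle_trans)
  qed simp
qed

end

lemma certified_ident:
  assumes "certified v w es []" "certified w v es' []" "na w = na v" "nb w = nb v"
  shows "ident w v"
  unfolding ident_def
proof (intro allI impI)
  fix f :: "bool \<Rightarrow> trop mat" assume "\<forall>t. f t \<in> UT 3"
  then have f: "\<And>t. f t \<in> UT 3" by blast
  have b: "below v (point gs w)" if "fits gs w" "gs \<in> set (marks (length w))" for gs
    using certified_sound[OF assms(1)] that by simp
  have b': "below w (point gs v)" if "fits gs v" "gs \<in> set (marks (length v))" for gs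
    using certified_sound[OF assms(2)] that by simp
  have off: "matprod f w $$ (i, Suc i) = matprod f v $$ (i, Suc i)" if "i < 2" for i
    using entry_le[where f = f and w = w and v = v, OF f that] entry_le[where f = f and w = v and v = w, OF f that] b b' tle_antisym by blast
  have corner: "matprod f w $$ (0, 2) = matprod f v $$ (0, 2)"
    using corner_le[where f = f and w = w and v = v, OF f] corner_le[where f = f and w = v and v = w, OF f] b b' tle_antisym by blast
  have diag: "matprod f w $$ (i, i) = matprod f v $$ (i, i)" if "i < 3" for i
    using entry_diag[where f = f and w = w, OF f that] entry_diag[where f = f and w = v, OF f that]
    by (simp add: mon_power[where f = f, OF f] assms(3,4))
  have u: "matprod f w \<in> UT 3" "matprod f v \<in> UT 3" using matprod_UT'[where f = f, OF f] by blast+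
  show "matprod f w = matprod f v"
  proof (rule eq_matI)
    fix i j assume "i < dim_row (matprod f v)" "j < dim_col (matprod f v)"
    then have ij: "i < 3" "j < 3" using UT_carrier[OF u(2)] by auto
    consider "i = j" | "j = Suc i" "i < 2" | "i = 0" "j = 2" | "i = 1" "j = 0" | "i = 2" "j = 0" | "i = 2" "j = 1" using ij by linarith
    then show "matprod f w $$ (i, j) = matprod f v $$ (i, j)"
    proof cases
      case 1
      then show ?thesis using diag ij by simp
    qed (use off corner UT_entries[where f = f, OF f u(1)] UT_entries[where f = f, OF f u(2)] in simp_all)
  qed (use UT_carrier[OF u(1)] UT_carrier[OF u(2)] in auto)
qed


lemma check_0: "check_prefix dirsP dirsT (leaf [] 22) 20 19 []" by code_simp
lemma check_1_a: "checks 0 20 19 18 [False]" by code_simp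
lemma check_2_a: "checks 1 18 18 17 [False]" by code_simp
lemma check_3_a: "checks 2 16 17 16 [False]" by code_simp
lemma check_4_a: "checks 3 14 16 15 [False]" by code_simp
lemma check_5_a: "checks 4 12 15 14 [False]" by code_simp
lemma check_6_a: "checks 5 10 14 13 [False]" by code_simp
lemma check_7_a: "checks 6 8 13 12 [False]" by code_simp
lemma check_8_aa: "checks 6 6 12 11 [False, False]" by code_simp
lemma check_8_ab: "checks 6 6 12 11 [False, True]" by code_simp
lemma check_9_aa: "checks 7 4 11 10 [False, False]" by code_simp
lemma check_9_aba: "checks 6 4 11 10 [False, True, False]" by code_simp
lemma check_9_abb: "checks 6 4 11 10 [False, True, True]" by code_simp
lemma check_10_aaa: "checks 7 2 10 9 [False, False, False]" by code_simp
lemma check_10_aab: "checks 7 2 10 9 [False, False, True]" by code_simp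
lemma check_10_abaa: "checks 6 2 10 9 [False, True, False, False]" by code_simp
lemma check_10_abab: "checks 6 2 10 9 [False, True, False, True]" by code_simp
lemma check_10_abba: "checks 6 2 10 9 [False, True, True, False]" by code_simp
lemma check_10_abbb: "checks 6 2 10 9 [False, True, True, True]" by code_simp


definition word :: "string \<Rightarrow> bool list" where "word s = map (\<lambda>c. c = CHR ''b'') s"

lemma ident_1: "ident (word ''abbaabbaabbaababbbbaba'') (word ''abbaabbababaababbbbaba'')"
proof (rule certified_ident)
  show "certified (word ''abbaabbababaababbbbaba'') (word ''abbaabbaabbaababbbbaba'')
[([8],[],[[4],[12]]),
([9],[],[[5],[13]]),
([0,8],[],[[0,4],[0,12]]),
([3,5],[],[[3,1],[3,9]]),
([4,4],[],[[4,0],[4,8]]),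
([7,1],[],[[3,1],[11,1]]),
([8,0],[],[[4,0],[12,0]]),
([8,4],[],[[4,8],[12,0]]),
([8,6],[],[[4,10],[12,2]]),
([8,7],[],[[4,10],[12,4]]),
([8,8],[],[[4,11],[12,5]]),
([8,9],[],[[4,13],[12,5]]),
([8,11],[],[[4,15],[12,7]]),
([8,1],[],[[0,0],[4,0],[14,1],[14,3]]),
([0,7],[],[[0,3],[0,11]]),
([3,4],[],[[3,0],[3,8]]),
([7,0],[],[[3,0],[11,0]]),
([8,5],[],[[4,9],[12,1]]),
([8,10],[],[[4,14],[12,6]]),
([8,12],[],[[4,16],[12,8]]),
([8,3],[[0,7]],[[12,1],[12,1]]),
([4,3],[[8,3]],[[0,3]]),
([8,2],[],[[12,1],[12,1],[12,1],[12,1],[4,2],[4,2],[4,2],[4,2],[4,2],[4,2],[4,2],[14,4],[14,4]]),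
([1,7],[],[[1,3],[1,11]]),
([2,6],[],[[2,2],[2,10]]),
([6,2],[],[[2,2],[10,2]]),
([9,5],[],[[5,9],[13,1]]),
([9,6],[],[[5,9],[13,3]]),
([9,7],[],[[5,10],[13,4]]),
([9,8],[],[[5,12],[13,4]]),
([9,10],[],[[5,14],[13,6]]),
([9,3],[[1,7]],[[13,1],[13,1]]),
([5,3],[[9,3]],[[1,3]]),
([9,0],[],[[1,0],[5,0],[15,0],[15,0]]),
([1,6],[],[[1,2],[1,10]]),
([2,5],[],[[2,1],[2,9]]),
([6,1],[],[[2,1],[10,1]]),
([9,4],[],[[5,8],[13,0]]),
([9,9],[],[[5,13],[13,5]]),
([9,11],[],[[5,15],[13,7]]),
([9,2],[[1,6]],[[13,0],[13,0]]),
([5,2],[[9,2]],[[1,2]]),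
([9,1],[],[[15,3],[15,3],[5,1],[5,1],[5,1],[5,1],[5,1],[5,1],[5,1],[13,0],[13,0],[13,0],[13,0]])] []" by code_simp
  show "certified (word ''abbaabbaabbaababbbbaba'') (word ''abbaabbababaababbbbaba'')
[([9],[],[[7],[11]]),
([8],[],[[6],[10]]),
([0,7],[],[[0,5],[0,9]]),
([3,4],[],[[3,2],[3,6]]),
([4,3],[],[[0,5],[8,1]]),
([9,3],[],[[7,5],[11,1]]),
([9,5],[],[[7,7],[11,3]]),
([9,6],[],[[7,7],[11,5]]),
([9,7],[],[[7,8],[11,6]]),
([9,8],[],[[7,10],[11,6]]),
([9,10],[],[[7,12],[11,8]]),
([9,0],[],[[0,0],[8,0],[19,0]]),
([7,0],[[9,0]],[[0,0],[0,0],[19,0]]),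
([0,8],[],[[0,6],[0,10]]),
([3,5],[],[[3,3],[3,7]]),
([4,4],[],[[0,6],[8,2]]),
([9,2],[],[[7,4],[11,0]]),
([9,4],[],[[7,6],[11,2]]),
([9,9],[],[[7,11],[11,7]]),
([9,11],[],[[7,13],[11,9]]),
([9,1],[],[[0,2],[4,2],[11,0],[11,0],[19,1]]),
([7,1],[[9,1]],[[0,2],[0,2],[3,0],[11,0],[19,1]]),
([1,6],[],[[1,4],[1,8]]),
([2,5],[],[[2,3],[2,7]]),
([5,2],[],[[1,4],[9,0]]),
([8,4],[],[[6,6],[10,2]]),
([8,6],[],[[6,8],[10,4]]),
([8,7],[],[[6,8],[10,6]]),
([8,8],[],[[6,9],[10,7]]),
([8,9],[],[[6,11],[10,7]]),
([8,11],[],[[6,13],[10,9]]),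
([8,1],[],[[1,0],[1,0],[10,2],[10,2],[18,1]]),
([6,1],[[8,1]],[[1,0],[2,2],[2,2],[17,0]]),
([1,7],[],[[1,5],[1,9]]),
([2,6],[],[[2,4],[2,8]]),
([5,3],[],[[1,5],[9,1]]),
([6,2],[],[[2,4],[10,0]]),
([8,0],[],[[6,0],[10,0]]),
([8,2],[],[[6,4],[10,0]]),
([8,3],[],[[6,5],[10,1]]),
([8,5],[],[[6,7],[10,3]]),
([8,10],[],[[6,12],[10,8]]),
([8,12],[],[[6,14],[10,10]])] []" by code_simp
qed (simp_all add: word_def)

lemma ident_2: "ident (word ''abbabaabababbabaababba'') (word ''abbabaababbababaababba'')"
proof (rule certified_ident)
  show "certified (word ''abbabaababbababaababba'') (word ''abbabaabababbabaababba'')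
[([10],[],[[6],[6],[18]]),
([11],[],[[7],[7],[19]]),
([0,10],[],[[0,6],[0,6],[0,18]]),
([3,7],[],[[3,3],[3,3],[3,15]]),
([5,5],[],[[5,1],[5,1],[5,13]]),
([6,4],[],[[0,6],[0,6],[18,0]]),
([8,2],[],[[0,6],[6,0],[18,0]]),
([10,0],[],[[6,0],[6,0],[18,0]]),
([10,3],[],[[6,3],[6,5],[18,1]]),
([10,6],[],[[6,10],[8,8],[16,0]]),
([10,8],[],[[6,12],[6,12],[18,0]]),
([10,9],[],[[6,13],[6,13],[18,1]]),
([10,1],[],[[8,1],[8,1],[8,1],[8,1],[18,1]]),
([0,9],[],[[0,5],[0,5],[0,17]]),
([3,6],[],[[3,2],[3,2],[3,14]]),
([5,4],[],[[5,0],[5,0],[5,12]]),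
([10,4],[],[[6,4],[6,6],[18,2]]),
([10,7],[],[[6,11],[8,9],[16,1]]),
([10,10],[],[[6,14],[6,14],[18,2]]),
([6,3],[],[[6,1],[6,1],[6,1],[6,9]]),
([10,5],[[0,9]],[[8,9],[16,1],[16,1]]),
([8,1],[],[[6,1],[6,1],[6,1],[6,1],[16,1]]),
([10,2],[],[[8,2],[8,2],[8,2],[8,2],[18,2]]),
([1,9],[],[[1,5],[1,5],[1,17]]),
([2,8],[],[[2,4],[2,4],[2,16]]),
([4,6],[],[[4,2],[4,2],[4,14]]),
([11,2],[],[[7,2],[7,4],[19,0]]),
([11,7],[],[[7,11],[9,9],[17,1]]),
([11,8],[],[[7,12],[7,12],[19,0]]),
([7,3],[],[[7,1],[7,1],[7,1],[7,9]]),
([11,5],[[1,9]],[[9,9],[17,1],[17,1]]),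
([9,1],[],[[7,1],[7,1],[7,1],[7,1],[17,1]]),
([11,0],[],[[9,0],[9,0],[9,0],[9,0],[19,0]]),
([1,8],[],[[1,4],[1,4],[1,16]]),
([2,7],[],[[2,3],[2,3],[2,15]]),
([4,5],[],[[4,1],[4,1],[4,13]]),
([11,3],[],[[7,3],[7,5],[19,1]]),
([11,6],[],[[7,10],[9,8],[17,0]]),
([11,9],[],[[7,13],[7,13],[19,1]]),
([7,2],[],[[7,0],[7,0],[7,0],[7,8]]),
([11,4],[[1,8]],[[9,8],[17,0],[17,0]]),
([9,0],[],[[7,0],[7,0],[7,0],[7,0],[17,0]]),
([11,1],[],[[9,1],[9,1],[9,1],[9,1],[19,1]])] []" by code_simp
  show "certified (word ''abbabaabababbabaababba'') (word ''abbabaababbababaababba'')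
[([11],[],[[3],[15],[15]]),
([10],[],[[2],[14],[14]]),
([0,9],[],[[0,1],[0,13],[0,13]]),
([3,6],[],[[3,0],[3,8],[3,10]]),
([6,3],[],[[0,1],[8,5],[10,3]]),
([11,5],[],[[3,13],[15,1],[15,1]]),
([11,7],[],[[3,15],[15,3],[15,3]]),
([11,8],[],[[3,16],[15,4],[15,4]]),
([5,4],[[11,8]],[[3,0],[3,0],[3,8]]),
([11,2],[],[[5,8],[13,0],[13,0],[13,0]]),
([8,1],[],[[0,1],[10,1],[10,1],[10,1],[10,1]]),
([11,0],[],[[3,0],[13,0],[13,0],[13,0],[13,0]]),
([0,10],[],[[0,2],[0,14],[0,14]]),
([3,7],[],[[3,1],[3,9],[3,11]]),
([6,4],[],[[0,2],[8,6],[10,4]]),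
([11,4],[],[[3,12],[15,0],[15,0]]),
([11,6],[],[[3,14],[15,2],[15,2]]),
([11,9],[],[[3,17],[15,5],[15,5]]),
([5,5],[[11,9]],[[3,1],[3,1],[3,9]]),
([11,3],[],[[5,9],[13,1],[13,1],[13,1]]),
([8,2],[],[[0,2],[10,2],[10,2],[10,2],[10,2]]),
([11,1],[],[[3,1],[13,1],[13,1],[13,1],[13,1]]),
([1,8],[],[[1,0],[1,12],[1,12]]),
([2,7],[],[[2,1],[2,9],[2,11]]),
([7,2],[],[[1,0],[9,4],[11,2]]),
([10,6],[],[[2,14],[14,2],[14,2]]),
([10,8],[],[[2,16],[14,4],[14,4]]),
([10,9],[],[[2,17],[14,5],[14,5]]),
([4,5],[[10,9]],[[2,1],[2,1],[2,9]]),
([10,3],[],[[4,9],[12,1],[12,1],[12,1]]),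
([9,0],[],[[1,0],[11,0],[11,0],[11,0],[11,0]]),
([10,1],[],[[2,1],[12,1],[12,1],[12,1],[12,1]]),
([1,9],[],[[1,1],[1,13],[1,13]]),
([2,8],[],[[2,0],[2,12],[2,12]]),
([4,6],[],[[4,0],[4,8],[4,10]]),
([7,3],[],[[1,1],[9,5],[11,3]]),
([10,0],[],[[2,0],[14,0],[14,0]]),
([10,2],[],[[2,0],[14,0],[14,6]]),
([10,4],[],[[2,0],[14,6],[14,6]]),
([10,5],[],[[2,13],[14,1],[14,1]]),
([10,7],[],[[2,15],[14,3],[14,3]]),
([10,10],[],[[2,18],[14,6],[14,6]]),
([9,1],[],[[1,1],[11,1],[11,1],[11,1],[11,1]])] []" by code_simp
qed (simp_all add: word_def)

lemma ident_3: "ident (word ''ababbabaababbaababbaba'') (word ''ababbabaabbabaababbaba'')"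
proof (rule certified_ident)
  show "certified (word ''ababbabaabbabaababbaba'') (word ''ababbabaababbaababbaba'')
[([10],[],[[0],[14],[16]]),
([11],[],[[1],[15],[17]]),
([0,10],[],[[0,0],[0,14],[0,16]]),
([2,8],[],[[2,0],[2,12],[2,12]]),
([5,5],[],[[5,3],[5,3],[5,9]]),
([7,3],[],[[5,3],[5,3],[11,3]]),
([8,2],[],[[0,0],[8,6],[16,0]]),
([10,0],[],[[0,0],[14,0],[16,0]]),
([10,4],[],[[2,12],[14,0],[14,0]]),
([10,6],[],[[0,16],[14,2],[16,0]]),
([10,7],[],[[0,17],[14,3],[16,1]]),
([10,9],[],[[0,19],[14,5],[16,3]]),
([10,1],[],[[8,1],[8,1],[8,1],[16,1]]),
([0,9],[],[[0,1],[0,13],[0,13]]),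
([2,7],[],[[2,5],[2,5],[2,11]]),
([5,4],[],[[5,2],[5,2],[5,8]]),
([7,2],[],[[5,2],[5,2],[11,2]]),
([10,3],[[2,7]],[[14,1],[14,1]]),
([10,5],[],[[2,13],[14,1],[14,1]]),
([10,8],[],[[0,18],[14,4],[16,2]]),
([10,10],[],[[0,20],[14,6],[16,4]]),
([10,2],[],[[8,2],[8,2],[8,2],[16,2]]),
([8,1],[],[[14,1],[14,1],[14,1],[14,1],[0,1],[0,1],[0,1]]),
([1,8],[],[[1,0],[1,12],[1,12]]),
([3,6],[],[[3,4],[3,4],[3,10]]),
([4,5],[],[[4,3],[4,3],[4,9]]),
([6,3],[],[[4,3],[4,3],[10,3]]),
([11,2],[[3,6]],[[15,0],[15,0]]),
([11,4],[],[[3,12],[15,0],[15,0]]),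
([11,7],[],[[1,17],[15,3],[17,1]]),
([11,9],[],[[1,19],[15,5],[17,3]]),
([11,1],[],[[9,1],[9,1],[9,1],[17,1]]),
([9,0],[],[[15,0],[15,0],[15,0],[15,0],[1,0],[1,0],[1,0]]),
([1,9],[],[[1,1],[1,13],[1,13]]),
([3,7],[],[[3,5],[3,5],[3,11]]),
([4,6],[],[[4,4],[4,4],[4,10]]),
([6,4],[],[[4,4],[4,4],[10,4]]),
([11,3],[[3,7]],[[15,1],[15,1]]),
([11,5],[],[[3,13],[15,1],[15,1]]),
([11,6],[],[[1,16],[15,2],[17,0]]),
([11,8],[],[[1,18],[15,4],[17,2]]),
([11,0],[],[[9,0],[9,0],[9,0],[17,0]]),
([9,1],[],[[15,1],[15,1],[15,1],[15,1],[1,1],[1,1],[1,1]])] []" by code_simp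
  show "certified (word ''ababbabaababbaababbaba'') (word ''ababbabaabbabaababbaba'')
[([11],[],[[5],[7],[21]]),
([10],[],[[4],[6],[20]]),
([0,9],[],[[0,3],[0,5],[0,19]]),
([2,7],[],[[2,1],[2,3],[2,17]]),
([5,4],[],[[5,0],[5,0],[5,12]]),
([11,3],[],[[7,3],[13,3],[13,3]]),
([11,5],[],[[7,9],[13,3],[13,3]]),
([11,6],[],[[7,10],[13,4],[13,4]]),
([11,8],[],[[7,12],[7,12],[19,0]]),
([7,2],[[11,6]],[[5,0],[5,0]]),
([8,1],[],[[2,1],[10,1],[10,1],[10,1]]),
([11,0],[],[[19,0],[19,0],[19,0],[5,0],[5,0],[5,0],[5,0]]),
([0,10],[],[[0,4],[0,6],[0,20]]),
([2,8],[],[[2,2],[2,4],[2,18]]),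
([5,5],[],[[5,1],[5,1],[5,13]]),
([11,2],[],[[7,2],[13,2],[13,2]]),
([11,4],[],[[7,8],[13,2],[13,2]]),
([11,7],[],[[7,11],[13,5],[13,5]]),
([11,9],[],[[7,13],[7,13],[19,1]]),
([7,3],[[11,7]],[[5,1],[5,1]]),
([8,2],[],[[2,2],[10,2],[10,2],[10,2]]),
([11,1],[],[[19,1],[19,1],[19,1],[5,1],[5,1],[5,1],[5,1]]),
([1,9],[],[[1,3],[1,5],[1,19]]),
([3,7],[],[[3,1],[3,3],[3,17]]),
([4,6],[],[[4,0],[4,2],[4,16]]),
([6,4],[],[[6,0],[6,0],[6,12]]),
([10,0],[],[[4,0],[6,0],[20,0]]),
([10,2],[],[[4,0],[6,6],[20,0]]),
([10,3],[],[[6,3],[12,3],[12,3]]),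
([10,5],[],[[6,9],[12,3],[12,3]]),
([10,8],[],[[6,12],[6,12],[18,0]]),
([10,10],[],[[4,16],[6,14],[20,0]]),
([9,1],[],[[3,1],[11,1],[11,1],[11,1]]),
([1,8],[],[[1,2],[1,4],[1,18]]),
([3,6],[],[[3,0],[3,2],[3,16]]),
([4,5],[],[[4,1],[4,1],[4,13]]),
([10,4],[],[[6,4],[12,4],[12,4]]),
([10,6],[],[[6,10],[12,4],[12,4]]),
([10,7],[],[[6,11],[12,5],[12,5]]),
([10,9],[],[[6,13],[6,13],[18,1]]),
([6,3],[[10,7]],[[4,1],[4,1]]),
([9,0],[],[[3,0],[11,0],[11,0],[11,0]]),
([10,1],[],[[18,1],[18,1],[18,1],[4,1],[4,1],[4,1],[4,1]])] []" by code_simp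
qed (simp_all add: word_def)

lemma ident_4: "ident (word ''abbabaabababababbabaab'') (word ''abbabaababbaababbabaab'')"
proof (rule certified_ident)
  show "certified (word ''abbabaababbaababbabaab'') (word ''abbabaabababababbabaab'')
[([10],[],[[0],[20]]),
([11],[],[[1],[21]]),
([0,10],[],[[0,0],[0,20]]),
([3,7],[],[[3,3],[3,11]]),
([5,5],[],[[5,1],[5,9]]),
([6,4],[],[[0,0],[12,8]]),
([8,2],[],[[8,0],[8,4]]),
([10,0],[],[[0,0],[20,0]]),
([10,2],[],[[8,4],[12,0]]),
([10,4],[],[[0,8],[20,0]]),
([10,5],[],[[6,9],[14,1]]),
([10,7],[],[[6,11],[14,3]]),
([10,10],[],[[0,20],[20,0]]),
([0,9],[],[[0,5],[0,13]]),
([3,6],[],[[3,2],[3,10]]),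
([5,4],[],[[5,0],[5,8]]),
([6,3],[],[[0,5],[12,1]]),
([10,3],[],[[6,1],[14,5]]),
([10,6],[],[[6,10],[14,2]]),
([10,8],[],[[6,12],[14,4]]),
([10,9],[],[[6,13],[14,5]]),
([8,1],[],[[6,1],[6,1],[12,1]]),
([10,1],[],[[6,1],[12,1],[12,1]]),
([1,9],[],[[1,5],[1,13]]),
([2,8],[],[[2,4],[2,12]]),
([4,6],[],[[4,2],[4,10]]),
([7,3],[],[[1,5],[13,1]]),
([11,3],[],[[7,1],[15,5]]),
([11,4],[],[[7,8],[15,0]]),
([11,6],[],[[7,10],[15,2]]),
([11,9],[],[[7,13],[15,5]]),
([9,1],[],[[7,1],[7,1],[13,1]]),
([11,1],[],[[7,1],[13,1],[13,1]]),
([1,8],[],[[1,4],[1,12]]),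
([2,7],[],[[2,3],[2,11]]),
([4,5],[],[[4,1],[4,9]]),
([7,2],[],[[1,4],[13,0]]),
([11,2],[],[[7,0],[15,4]]),
([11,5],[],[[7,9],[15,1]]),
([11,7],[],[[7,11],[15,3]]),
([11,8],[],[[7,12],[15,4]]),
([9,0],[],[[7,0],[7,0],[13,0]]),
([11,0],[],[[7,0],[13,0],[13,0]])] []" by code_simp
  show "certified (word ''abbabaabababababbabaab'') (word ''abbabaababbaababbabaab'')
[([11],[],[[3],[19]]),
([10],[],[[2],[18]]),
([0,9],[],[[0,1],[0,17]]),
([3,6],[],[[3,0],[3,12]]),
([6,3],[],[[0,1],[12,5]]),
([11,3],[],[[3,5],[19,1]]),
([11,6],[],[[5,12],[17,0]]),
([11,9],[],[[3,17],[19,1]]),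
([8,1],[],[[0,1],[0,1],[0,1],[14,1],[14,1],[14,1],[14,1]]),
([11,1],[],[[5,1],[5,1],[5,1],[5,1],[19,1],[19,1],[19,1]]),
([5,4],[],[[17,0],[17,0],[17,0],[5,10],[5,10],[5,10],[5,10],[5,10],[5,10],[5,10],[5,10],[5,10],[5,10],[5,10],[5,10],[5,10],[5,10],[3,0],[3,0],[3,0],[3,0],[3,0],[3,0],[3,0],[3,0],[3,0],[3,0],[3,0],[3,0],[3,0],[3,0],[3,0],[3,0],[3,0],[3,0]]),
([11,4],[[5,4]],[[5,12],[17,0],[17,0]]),
([0,10],[],[[0,2],[0,18]]),
([3,7],[],[[3,1],[3,13]]),
([6,4],[],[[0,2],[12,6]]),
([11,2],[],[[3,4],[19,0]]),
([11,7],[],[[5,13],[17,1]]),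
([11,8],[],[[3,16],[19,0]]),
([8,2],[],[[0,2],[0,2],[0,2],[14,2],[14,2],[14,2],[14,2]]),
([11,0],[],[[5,0],[5,0],[5,0],[5,0],[19,0],[19,0],[19,0]]),
([5,5],[],[[17,1],[17,1],[17,1],[5,11],[5,11],[5,11],[5,11],[5,11],[5,11],[5,11],[5,11],[5,11],[5,11],[5,11],[5,11],[5,11],[5,11],[3,1],[3,1],[3,1],[3,1],[3,1],[3,1],[3,1],[3,1],[3,1],[3,1],[3,1],[3,1],[3,1],[3,1],[3,1],[3,1],[3,1],[3,1]]),
([11,5],[[5,5]],[[5,13],[17,1],[17,1]]),
([1,8],[],[[1,0],[1,16]]),
([2,7],[],[[2,1],[2,13]]),
([7,2],[],[[1,0],[13,4]]),
([10,4],[],[[2,6],[18,2]]),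
([10,7],[],[[4,13],[16,1]]),
([10,10],[],[[2,18],[18,2]]),
([9,0],[],[[15,0],[15,0],[15,0],[15,0],[1,0],[1,0],[1,0]]),
([10,2],[],[[4,2],[4,2],[4,2],[4,2],[18,2],[18,2],[18,2]]),
([4,5],[],[[16,1],[16,1],[16,1],[4,11],[4,11],[4,11],[4,11],[4,11],[4,11],[4,11],[4,11],[4,11],[4,11],[4,11],[4,11],[4,11],[4,11],[2,1],[2,1],[2,1],[2,1],[2,1],[2,1],[2,1],[2,1],[2,1],[2,1],[2,1],[2,1],[2,1],[2,1],[2,1],[2,1],[2,1],[2,1]]),
([10,5],[[4,5]],[[4,13],[16,1],[16,1]]),
([1,9],[],[[1,1],[1,17]]),
([2,8],[],[[2,0],[2,16]]),
([4,6],[],[[4,0],[4,12]]),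
([7,3],[],[[1,1],[13,5]]),
([10,0],[],[[2,0],[18,0]]),
([10,3],[],[[2,5],[18,1]]),
([10,6],[],[[4,12],[16,0]]),
([10,8],[],[[2,16],[18,0]]),
([10,9],[],[[2,17],[18,1]]),
([9,1],[],[[1,1],[1,1],[1,1],[15,1],[15,1],[15,1],[15,1]]),
([10,1],[],[[4,1],[4,1],[4,1],[4,1],[18,1],[18,1],[18,1]])] []" by code_simp
qed (simp_all add: word_def)

lemma ident_5: "ident (word ''ababbabaababababbabaab'') (word ''ababbabaabbaababbabaab'')"
proof (rule certified_ident)
  show "certified (word ''ababbabaabbaababbabaab'') (word ''ababbabaababababbabaab'')
[([10],[],[[0],[20]]),
([11],[],[[1],[21]]),
([0,10],[],[[0,0],[0,20]]),
([2,8],[],[[2,6],[2,10]]),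
([5,5],[],[[5,3],[5,7]]),
([7,3],[],[[7,1],[7,5]]),
([8,2],[],[[8,0],[8,4]]),
([10,0],[],[[0,0],[20,0]]),
([10,2],[],[[8,4],[12,0]]),
([10,4],[],[[0,8],[20,0]]),
([10,5],[],[[8,7],[12,3]]),
([10,7],[],[[8,9],[12,5]]),
([10,10],[],[[0,20],[20,0]]),
([0,9],[],[[0,7],[0,11]]),
([2,7],[],[[2,5],[2,9]]),
([5,4],[],[[5,2],[5,6]]),
([7,2],[],[[7,0],[7,4]]),
([10,3],[],[[8,5],[12,1]]),
([10,6],[],[[8,8],[12,4]]),
([10,8],[],[[8,10],[12,6]]),
([10,9],[],[[8,11],[12,7]]),
([8,1],[],[[0,1],[12,1],[12,1]]),
([10,1],[[8,1]],[[12,1]]),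
([1,8],[],[[1,6],[1,10]]),
([3,6],[],[[3,4],[3,8]]),
([4,5],[],[[4,3],[4,7]]),
([6,3],[],[[6,1],[6,5]]),
([11,2],[],[[9,4],[13,0]]),
([11,5],[],[[9,7],[13,3]]),
([11,7],[],[[9,9],[13,5]]),
([11,8],[],[[9,10],[13,6]]),
([9,0],[],[[1,0],[13,0],[13,0]]),
([11,0],[[9,0]],[[13,0]]),
([1,9],[],[[1,7],[1,11]]),
([3,7],[],[[3,5],[3,9]]),
([4,6],[],[[4,4],[4,8]]),
([6,4],[],[[6,2],[6,6]]),
([11,3],[],[[9,5],[13,1]]),
([11,4],[],[[9,6],[13,2]]),
([11,6],[],[[9,8],[13,4]]),
([11,9],[],[[9,11],[13,7]]),
([9,1],[],[[1,1],[13,1],[13,1]]),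
([11,1],[[9,1]],[[13,1]])] []" by code_simp
  show "certified (word ''ababbabaababababbabaab'') (word ''ababbabaabbaababbabaab'')
[([11],[],[[5],[17]]),
([10],[],[[4],[16]]),
([0,9],[],[[0,3],[0,15]]),
([2,7],[],[[2,1],[2,13]]),
([8,1],[],[[2,1],[14,1]]),
([11,3],[],[[5,3],[17,3]]),
([11,6],[],[[5,12],[17,0]]),
([11,9],[],[[5,15],[17,3]]),
([5,4],[],[[5,0],[5,0],[5,12]]),
([7,2],[[11,6]],[[5,0],[5,0]]),
([11,1],[],[[7,1],[7,1],[19,1]]),
([11,4],[[5,4]],[[5,12],[17,0],[17,0]]),
([0,10],[],[[0,4],[0,16]]),
([2,8],[],[[2,2],[2,14]]),
([8,2],[],[[2,2],[14,2]]),
([11,2],[],[[5,2],[17,2]]),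
([11,7],[],[[5,13],[17,1]]),
([11,8],[],[[5,14],[17,2]]),
([5,5],[],[[5,1],[5,1],[5,13]]),
([7,3],[[11,7]],[[5,1],[5,1]]),
([11,0],[],[[7,0],[7,0],[19,0]]),
([11,5],[[5,5]],[[5,13],[17,1],[17,1]]),
([1,9],[],[[1,3],[1,15]]),
([3,7],[],[[3,1],[3,13]]),
([4,6],[],[[4,0],[4,12]]),
([9,1],[],[[3,1],[15,1]]),
([10,0],[],[[4,0],[16,0]]),
([10,3],[],[[4,3],[16,3]]),
([10,6],[],[[4,12],[16,0]]),
([10,8],[],[[4,14],[16,2]]),
([10,9],[],[[4,15],[16,3]]),
([6,4],[[10,0]],[[4,0],[4,12]]),
([10,1],[],[[6,1],[6,1],[18,1]]),
([1,8],[],[[1,2],[1,14]]),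
([3,6],[],[[3,0],[3,12]]),
([9,0],[],[[3,0],[15,0]]),
([10,4],[],[[4,4],[16,4]]),
([10,7],[],[[4,13],[16,1]]),
([10,10],[],[[4,16],[16,4]]),
([4,5],[],[[4,1],[4,1],[4,13]]),
([6,3],[[10,7]],[[4,1],[4,1]]),
([10,2],[],[[6,2],[6,2],[18,2]]),
([10,5],[[4,5]],[[4,13],[16,1],[16,1]])] []" by code_simp
qed (simp_all add: word_def)

lemma ident_6: "ident (word ''abbaabbabaabbaababbaba'') (word ''abbaabbabababaababbaba'')"
proof (rule certified_ident)
  show "certified (word ''abbaabbabababaababbaba'') (word ''abbaabbabaabbaababbaba'')
[([10],[],[[4],[16]]),
([11],[],[[5],[17]]),
([0,10],[],[[0,4],[0,16]]),
([3,7],[],[[3,1],[3,13]]),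
([4,6],[],[[4,0],[4,12]]),
([7,3],[],[[3,1],[11,5]]),
([10,0],[],[[4,0],[16,0]]),
([10,1],[],[[4,1],[16,1]]),
([10,6],[],[[4,12],[16,0]]),
([10,7],[],[[4,13],[16,1]]),
([10,9],[],[[4,15],[16,3]]),
([10,4],[[10,0]],[[4,12],[16,0]]),
([9,1],[],[[3,1],[3,1],[13,1],[13,1],[13,1]]),
([0,9],[],[[0,3],[0,15]]),
([3,6],[],[[3,0],[3,12]]),
([7,2],[],[[3,0],[11,4]]),
([10,2],[],[[4,2],[16,2]]),
([10,8],[],[[4,14],[16,2]]),
([10,10],[],[[4,16],[16,4]]),
([9,0],[],[[3,0],[3,0],[13,0],[13,0],[13,0]]),
([10,5],[],[[4,11],[4,11],[14,1],[14,1],[14,1]]),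
([4,5],[[0,9],[10,5],[10,5]],[[0,3],[0,3]]),
([10,3],[],[[0,3],[4,11],[14,1],[14,1],[14,1],[14,1]]),
([1,9],[],[[1,3],[1,15]]),
([2,8],[],[[2,2],[2,14]]),
([6,4],[],[[2,2],[10,6]]),
([11,0],[],[[5,0],[17,0]]),
([11,6],[],[[5,12],[17,0]]),
([11,8],[],[[5,14],[17,2]]),
([8,2],[],[[2,2],[2,2],[12,2],[12,2],[12,2]]),
([11,5],[],[[5,11],[5,11],[15,1],[15,1],[15,1]]),
([5,5],[[1,9],[11,5],[11,5]],[[1,3],[1,3]]),
([11,3],[],[[1,3],[5,11],[15,1],[15,1],[15,1],[15,1]]),
([1,8],[],[[1,2],[1,14]]),
([2,7],[],[[2,1],[2,13]]),
([6,3],[],[[2,1],[10,5]]),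
([11,1],[],[[5,1],[17,1]]),
([11,7],[],[[5,13],[17,1]]),
([11,9],[],[[5,15],[17,3]]),
([8,1],[],[[2,1],[2,1],[12,1],[12,1],[12,1]]),
([11,4],[],[[5,10],[5,10],[15,0],[15,0],[15,0]]),
([5,4],[[1,8],[11,4],[11,4]],[[1,2],[1,2]]),
([11,2],[],[[1,2],[5,10],[15,0],[15,0],[15,0],[15,0]])] []" by code_simp
  show "certified (word ''abbaabbabaabbaababbaba'') (word ''abbaabbabababaababbaba'')
[([11],[],[[3],[19]]),
([10],[],[[2],[18]]),
([0,9],[],[[0,1],[0,17]]),
([3,6],[],[[3,4],[3,8]]),
([4,5],[],[[4,3],[4,7]]),
([7,2],[],[[7,0],[7,4]]),
([11,3],[],[[9,5],[13,1]]),
([11,5],[],[[9,7],[13,3]]),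
([11,6],[],[[9,8],[13,4]]),
([11,8],[],[[3,16],[19,0]]),
([11,0],[],[[7,0],[7,0],[19,0]]),
([9,0],[[11,0]],[[7,0]]),
([0,10],[],[[0,2],[0,18]]),
([3,7],[],[[3,5],[3,9]]),
([4,6],[],[[4,4],[4,8]]),
([7,3],[],[[7,1],[7,5]]),
([11,2],[],[[9,4],[13,0]]),
([11,4],[],[[9,6],[13,2]]),
([11,7],[],[[9,9],[13,5]]),
([11,9],[],[[3,17],[19,1]]),
([11,1],[],[[7,1],[7,1],[19,1]]),
([9,1],[[11,1]],[[7,1]]),
([1,8],[],[[1,0],[1,16]]),
([2,7],[],[[2,5],[2,9]]),
([5,4],[],[[5,2],[5,6]]),
([6,3],[],[[6,1],[6,5]]),
([10,4],[],[[8,6],[12,2]]),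
([10,6],[],[[8,8],[12,4]]),
([10,7],[],[[8,9],[12,5]]),
([10,9],[],[[2,17],[18,1]]),
([10,1],[],[[6,1],[6,1],[18,1]]),
([8,1],[[10,1]],[[6,1]]),
([1,9],[],[[1,1],[1,17]]),
([2,8],[],[[2,0],[2,16]]),
([5,5],[],[[5,3],[5,7]]),
([6,4],[],[[6,2],[6,6]]),
([8,2],[],[[8,0],[8,4]]),
([10,0],[],[[2,0],[18,0]]),
([10,2],[],[[2,4],[18,0]]),
([10,3],[],[[8,5],[12,1]]),
([10,5],[],[[8,7],[12,3]]),
([10,8],[],[[2,16],[18,0]]),
([10,10],[],[[2,18],[18,2]])] []" by code_simp
qed (simp_all add: word_def)

lemma ident_7: "ident (word ''abbaabbabaabbabaabbaab'') (word ''abbaabbababababaabbaab'')"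
proof (rule certified_ident)
  show "certified (word ''abbaabbababababaabbaab'') (word ''abbaabbabaabbabaabbaab'')
[([10],[],[[0],[20]]),
([11],[],[[1],[21]]),
([0,10],[],[[0,0],[0,20]]),
([3,7],[],[[3,1],[3,13]]),
([4,6],[],[[4,0],[4,12]]),
([7,3],[],[[3,1],[11,5]]),
([9,1],[],[[3,1],[15,1]]),
([10,0],[],[[0,0],[20,0]]),
([10,1],[],[[4,1],[16,1]]),
([10,3],[],[[4,5],[16,1]]),
([10,6],[],[[4,12],[16,0]]),
([10,7],[],[[4,13],[16,1]]),
([10,10],[],[[0,20],[20,0]]),
([0,9],[],[[0,3],[0,15]]),
([3,6],[],[[3,0],[3,12]]),
([7,2],[],[[3,0],[11,4]]),
([9,0],[],[[3,0],[15,0]]),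
([10,2],[],[[4,2],[16,2]]),
([10,4],[],[[4,6],[16,2]]),
([10,8],[],[[4,14],[16,2]]),
([10,9],[],[[4,15],[16,3]]),
([4,5],[],[[16,3],[16,3],[16,3],[4,11],[4,11],[4,11],[4,11],[0,3],[0,3],[0,3],[0,3],[0,3],[0,3],[0,3],[0,3],[0,3]]),
([10,5],[[10,9],[4,5],[4,5]],[[16,3],[16,3]]),
([1,9],[],[[1,3],[1,15]]),
([2,8],[],[[2,2],[2,14]]),
([6,4],[],[[2,2],[10,6]]),
([8,2],[],[[2,2],[14,2]]),
([11,0],[],[[5,0],[17,0]]),
([11,2],[],[[5,4],[17,0]]),
([11,6],[],[[5,12],[17,0]]),
([11,9],[],[[5,15],[17,3]]),
([5,5],[],[[17,3],[17,3],[17,3],[5,11],[5,11],[5,11],[5,11],[1,3],[1,3],[1,3],[1,3],[1,3],[1,3],[1,3],[1,3],[1,3]]),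
([11,5],[[11,9],[5,5],[5,5]],[[17,3],[17,3]]),
([1,8],[],[[1,2],[1,14]]),
([2,7],[],[[2,1],[2,13]]),
([6,3],[],[[2,1],[10,5]]),
([8,1],[],[[2,1],[14,1]]),
([11,1],[],[[5,1],[17,1]]),
([11,3],[],[[5,5],[17,1]]),
([11,7],[],[[5,13],[17,1]]),
([11,8],[],[[5,14],[17,2]]),
([5,4],[],[[17,2],[17,2],[17,2],[5,10],[5,10],[5,10],[5,10],[1,2],[1,2],[1,2],[1,2],[1,2],[1,2],[1,2],[1,2],[1,2]]),
([11,4],[[11,8],[5,4],[5,4]],[[17,2],[17,2]])] []" by code_simp
  show "certified (word ''abbaabbabaabbabaabbaab'') (word ''abbaabbababababaabbaab'')
[([11],[],[[3],[19]]),
([10],[],[[2],[18]]),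
([0,9],[],[[0,1],[0,17]]),
([3,6],[],[[3,2],[3,10]]),
([4,5],[],[[4,1],[4,9]]),
([7,2],[],[[7,0],[7,4]]),
([11,2],[],[[9,4],[13,0]]),
([11,5],[],[[7,9],[15,1]]),
([11,6],[],[[7,10],[15,2]]),
([11,9],[],[[3,17],[19,1]]),
([9,0],[],[[7,0],[7,0],[13,0]]),
([11,0],[],[[7,0],[13,0],[13,0]]),
([0,10],[],[[0,2],[0,18]]),
([3,7],[],[[3,3],[3,11]]),
([4,6],[],[[4,2],[4,10]]),
([7,3],[],[[7,1],[7,5]]),
([11,3],[],[[9,5],[13,1]]),
([11,4],[],[[7,8],[15,0]]),
([11,7],[],[[7,11],[15,3]]),
([11,8],[],[[3,16],[19,0]]),
([9,1],[],[[7,1],[7,1],[13,1]]),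
([11,1],[],[[7,1],[13,1],[13,1]]),
([1,8],[],[[1,0],[1,16]]),
([2,7],[],[[2,3],[2,11]]),
([5,4],[],[[5,0],[5,8]]),
([6,3],[],[[6,1],[6,5]]),
([10,3],[],[[8,5],[12,1]]),
([10,6],[],[[6,10],[14,2]]),
([10,7],[],[[6,11],[14,3]]),
([10,10],[],[[2,18],[18,2]]),
([8,1],[],[[6,1],[6,1],[12,1]]),
([10,1],[],[[6,1],[12,1],[12,1]]),
([1,9],[],[[1,1],[1,17]]),
([2,8],[],[[2,0],[2,16]]),
([5,5],[],[[5,1],[5,9]]),
([6,4],[],[[6,0],[6,8]]),
([8,2],[],[[2,0],[14,4]]),
([10,0],[],[[2,0],[18,0]]),
([10,2],[],[[2,4],[18,0]]),
([10,4],[],[[6,8],[14,0]]),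
([10,5],[],[[6,9],[14,1]]),
([10,8],[],[[2,16],[18,0]]),
([10,9],[],[[2,17],[18,1]])] []" by code_simp
qed (simp_all add: word_def)

lemma ident_8: "ident (word ''ababbabaabababbabaabab'') (word ''ababbabaabbaabbabaabab'')"
proof (rule certified_ident)
  show "certified (word ''ababbabaabbaabbabaabab'') (word ''ababbabaabababbabaabab'')
[([10],[],[[0],[20]]),
([11],[],[[1],[21]]),
([0,10],[],[[0,0],[0,20]]),
([2,8],[],[[2,0],[2,16]]),
([5,5],[],[[5,3],[5,7]]),
([7,3],[],[[7,1],[7,5]]),
([8,2],[],[[8,0],[8,4]]),
([10,0],[],[[0,0],[20,0]]),
([10,2],[],[[8,4],[12,0]]),
([10,3],[],[[8,5],[12,1]]),
([10,5],[],[[8,7],[12,3]]),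
([10,8],[],[[2,16],[18,0]]),
([10,10],[],[[0,20],[20,0]]),
([0,9],[],[[0,1],[0,17]]),
([2,7],[],[[2,5],[2,9]]),
([5,4],[],[[5,2],[5,6]]),
([7,2],[],[[7,0],[7,4]]),
([10,4],[],[[8,6],[12,2]]),
([10,6],[],[[8,8],[12,4]]),
([10,7],[],[[8,9],[12,5]]),
([10,9],[],[[2,17],[18,1]]),
([8,1],[],[[18,1],[18,1],[18,1],[18,1],[0,1],[0,1],[0,1],[0,1],[0,1]]),
([10,1],[[8,1],[8,1],[8,1],[8,1]],[[18,1]]),
([1,8],[],[[1,0],[1,16]]),
([3,6],[],[[3,4],[3,8]]),
([4,5],[],[[4,3],[4,7]]),
([6,3],[],[[6,1],[6,5]]),
([11,3],[],[[9,5],[13,1]]),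
([11,5],[],[[9,7],[13,3]]),
([11,6],[],[[9,8],[13,4]]),
([11,8],[],[[3,16],[19,0]]),
([9,0],[],[[19,0],[19,0],[19,0],[19,0],[1,0],[1,0],[1,0],[1,0],[1,0]]),
([11,0],[[9,0],[9,0],[9,0],[9,0]],[[19,0]]),
([1,9],[],[[1,1],[1,17]]),
([3,7],[],[[3,5],[3,9]]),
([4,6],[],[[4,4],[4,8]]),
([6,4],[],[[6,2],[6,6]]),
([11,2],[],[[9,4],[13,0]]),
([11,4],[],[[9,6],[13,2]]),
([11,7],[],[[9,9],[13,5]]),
([11,9],[],[[3,17],[19,1]]),
([9,1],[],[[19,1],[19,1],[19,1],[19,1],[1,1],[1,1],[1,1],[1,1],[1,1]]),
([11,1],[[9,1],[9,1],[9,1],[9,1]],[[19,1]])] []" by code_simp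
  show "certified (word ''ababbabaabababbabaabab'') (word ''ababbabaabbaabbabaabab'')
[([11],[],[[5],[17]]),
([10],[],[[4],[16]]),
([0,9],[],[[0,3],[0,15]]),
([2,7],[],[[2,1],[2,13]]),
([5,4],[],[[5,0],[5,8]]),
([11,4],[],[[7,8],[15,0]]),
([11,7],[],[[5,13],[17,1]]),
([11,9],[],[[5,15],[17,3]]),
([7,2],[],[[5,0],[5,0],[5,0],[5,10],[15,0]]),
([8,1],[],[[2,1],[2,1],[12,1],[12,1],[12,1]]),
([11,1],[],[[7,1],[7,1],[7,1],[17,1],[17,1]]),
([11,2],[],[[5,0],[5,10],[15,0],[15,0],[15,0]]),
([0,10],[],[[0,4],[0,16]]),
([2,8],[],[[2,2],[2,14]]),
([5,5],[],[[5,1],[5,9]]),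
([11,5],[],[[7,9],[15,1]]),
([11,6],[],[[5,12],[17,0]]),
([11,8],[],[[5,14],[17,2]]),
([7,3],[],[[5,1],[5,1],[5,1],[5,11],[15,1]]),
([8,2],[],[[2,2],[2,2],[12,2],[12,2],[12,2]]),
([11,0],[],[[7,0],[7,0],[7,0],[17,0],[17,0]]),
([11,3],[],[[5,1],[5,11],[15,1],[15,1],[15,1]]),
([1,9],[],[[1,3],[1,15]]),
([3,7],[],[[3,1],[3,13]]),
([4,6],[],[[4,0],[4,12]]),
([6,4],[],[[6,0],[6,8]]),
([10,0],[],[[4,0],[16,0]]),
([10,4],[],[[6,8],[14,0]]),
([10,6],[],[[4,12],[16,0]]),
([10,7],[],[[4,13],[16,1]]),
([10,9],[],[[4,15],[16,3]]),
([9,1],[],[[3,1],[3,1],[13,1],[13,1],[13,1]]),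
([10,1],[],[[6,1],[6,1],[6,1],[16,1],[16,1]]),
([1,8],[],[[1,2],[1,14]]),
([3,6],[],[[3,0],[3,12]]),
([4,5],[],[[4,1],[4,9]]),
([10,5],[],[[6,9],[14,1]]),
([10,8],[],[[4,14],[16,2]]),
([10,10],[],[[4,16],[16,4]]),
([6,3],[],[[4,1],[4,1],[4,1],[4,11],[14,1]]),
([9,0],[],[[3,0],[3,0],[13,0],[13,0],[13,0]]),
([10,2],[],[[6,2],[6,2],[6,2],[16,2],[16,2]]),
([10,3],[],[[4,1],[4,11],[14,1],[14,1],[14,1]])] []" by code_simp
qed (simp_all add: word_def)

lemma ident_9: "ident (word ''ababbabaababbabaababba'') (word ''ababbabaabbababaababba'')"
proof (rule certified_ident)
  show "certified (word ''ababbabaabbababaababba'') (word ''ababbabaababbabaababba'')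
[([10],[],[[2],[18]]),
([11],[],[[3],[19]]),
([0,10],[],[[0,2],[0,18]]),
([2,8],[],[[2,0],[2,16]]),
([8,2],[],[[0,2],[16,2]]),
([10,0],[],[[2,0],[18,0]]),
([10,1],[],[[2,1],[18,1]]),
([10,8],[],[[2,16],[18,0]]),
([10,9],[],[[2,17],[18,1]]),
([10,3],[[10,1]],[[2,7],[18,1]]),
([5,5],[],[[5,3],[5,3],[5,3],[5,11]]),
([7,3],[],[[5,3],[5,3],[5,3],[13,3]]),
([10,6],[],[[0,16],[8,8],[16,0],[16,0]]),
([0,9],[],[[0,1],[0,17]]),
([8,1],[],[[0,1],[16,1]]),
([10,2],[],[[2,2],[18,2]]),
([10,10],[],[[2,18],[18,2]]),
([10,4],[[10,2]],[[2,8],[18,2]]),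
([2,7],[],[[0,1],[0,1],[0,17],[8,9]]),
([5,4],[],[[5,2],[5,2],[5,2],[5,10]]),
([7,2],[],[[5,2],[5,2],[5,2],[13,2]]),
([10,5],[[8,1]],[[0,17],[16,1],[16,1]]),
([10,7],[],[[0,17],[8,9],[16,1],[16,1]]),
([1,8],[],[[1,0],[1,16]]),
([9,0],[],[[1,0],[17,0]]),
([11,1],[],[[3,1],[19,1]]),
([11,9],[],[[3,17],[19,1]]),
([11,3],[[11,1]],[[3,7],[19,1]]),
([3,6],[],[[1,0],[1,0],[1,16],[9,8]]),
([4,5],[],[[4,3],[4,3],[4,3],[4,11]]),
([6,3],[],[[4,3],[4,3],[4,3],[12,3]]),
([11,4],[[9,0]],[[1,16],[17,0],[17,0]]),
([11,6],[],[[1,16],[9,8],[17,0],[17,0]]),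
([1,9],[],[[1,1],[1,17]]),
([9,1],[],[[1,1],[17,1]]),
([11,0],[],[[3,0],[19,0]]),
([11,8],[],[[3,16],[19,0]]),
([11,2],[[11,0]],[[3,6],[19,0]]),
([3,7],[],[[1,1],[1,1],[1,17],[9,9]]),
([4,6],[],[[4,4],[4,4],[4,4],[4,12]]),
([6,4],[],[[4,4],[4,4],[4,4],[12,4]]),
([11,5],[[9,1]],[[1,17],[17,1],[17,1]]),
([11,7],[],[[1,17],[9,9],[17,1],[17,1]])] []" by code_simp
  show "certified (word ''ababbabaababbabaababba'') (word ''ababbabaabbababaababba'')
[([11],[],[[7],[15]]),
([10],[],[[6],[14]]),
([0,9],[],[[0,5],[0,13]]),
([2,7],[],[[2,3],[2,11]]),
([5,4],[],[[5,0],[5,8]]),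
([11,5],[],[[7,9],[15,1]]),
([11,7],[],[[7,11],[15,3]]),
([11,8],[],[[7,12],[15,4]]),
([11,2],[],[[7,6],[13,0],[13,0]]),
([7,2],[[5,4],[11,2]],[[5,0]]),
([8,1],[],[[2,1],[2,1],[10,1],[18,1]]),
([11,0],[],[[5,0],[13,0],[13,0],[13,0]]),
([0,10],[],[[0,6],[0,14]]),
([2,8],[],[[2,4],[2,12]]),
([5,5],[],[[5,1],[5,9]]),
([11,4],[],[[7,8],[15,0]]),
([11,6],[],[[7,10],[15,2]]),
([11,9],[],[[7,13],[15,5]]),
([11,3],[],[[7,7],[13,1],[13,1]]),
([7,3],[[5,5],[11,3]],[[5,1]]),
([8,2],[],[[2,2],[2,2],[10,2],[18,2]]),
([11,1],[],[[5,1],[13,1],[13,1],[13,1]]),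
([1,9],[],[[1,5],[1,13]]),
([3,7],[],[[3,3],[3,11]]),
([4,6],[],[[4,2],[4,10]]),
([6,4],[],[[6,0],[6,8]]),
([10,0],[],[[6,0],[14,0]]),
([10,2],[[6,4]],[[14,0]]),
([10,4],[],[[6,8],[14,0]]),
([10,5],[],[[6,9],[14,1]]),
([10,7],[],[[6,11],[14,3]]),
([10,10],[],[[6,14],[14,6]]),
([9,1],[],[[3,1],[3,1],[11,1],[19,1]]),
([1,8],[],[[1,4],[1,12]]),
([3,6],[],[[3,2],[3,10]]),
([4,5],[],[[4,1],[4,9]]),
([10,6],[],[[6,10],[14,2]]),
([10,8],[],[[6,12],[14,4]]),
([10,9],[],[[6,13],[14,5]]),
([10,3],[],[[6,7],[12,1],[12,1]]),
([6,3],[[4,5],[10,3]],[[4,1]]),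
([9,0],[],[[3,0],[3,0],[11,0],[19,0]]),
([10,1],[],[[4,1],[12,1],[12,1],[12,1]])] []" by code_simp
qed (simp_all add: word_def)

lemma ident_10: "ident (word ''abbaabbabaabbabaababba'') (word ''abbaabbababababaababba'')"
proof (rule certified_ident)
  show "certified (word ''abbaabbababababaababba'') (word ''abbaabbabaabbabaababba'')
[([10],[],[[4],[16]]),
([11],[],[[5],[17]]),
([0,10],[],[[0,4],[0,16]]),
([3,7],[],[[3,1],[3,13]]),
([4,6],[],[[4,0],[4,12]]),
([7,3],[],[[3,1],[11,5]]),
([9,1],[],[[3,1],[15,1]]),
([10,0],[],[[4,0],[16,0]]),
([10,3],[],[[4,3],[16,3]]),
([10,6],[],[[4,12],[16,0]]),
([10,8],[],[[4,14],[16,2]]),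
([10,9],[],[[4,15],[16,3]]),
([10,1],[],[[0,1],[4,1],[18,1],[18,1]]),
([0,9],[],[[0,3],[0,15]]),
([3,6],[],[[3,0],[3,12]]),
([7,2],[],[[3,0],[11,4]]),
([9,0],[],[[3,0],[15,0]]),
([10,4],[],[[4,4],[16,4]]),
([10,7],[],[[4,13],[16,1]]),
([10,10],[],[[4,16],[16,4]]),
([10,2],[],[[0,2],[4,2],[18,2],[18,2]]),
([4,5],[],[[16,1],[16,1],[16,1],[4,11],[4,11],[4,11],[4,11],[4,11],[0,3],[0,3],[0,3],[0,3],[0,3],[0,3],[0,3],[0,3],[0,3]]),
([10,5],[[4,5]],[[4,13],[16,1],[16,1]]),
([1,9],[],[[1,3],[1,15]]),
([2,8],[],[[2,2],[2,14]]),
([6,4],[],[[2,2],[10,6]]),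
([8,2],[],[[2,2],[14,2]]),
([11,2],[],[[5,2],[17,2]]),
([11,7],[],[[5,13],[17,1]]),
([11,8],[],[[5,14],[17,2]]),
([11,0],[],[[1,0],[5,0],[19,0],[19,0]]),
([5,5],[],[[17,1],[17,1],[17,1],[5,11],[5,11],[5,11],[5,11],[5,11],[1,3],[1,3],[1,3],[1,3],[1,3],[1,3],[1,3],[1,3],[1,3]]),
([11,5],[[5,5]],[[5,13],[17,1],[17,1]]),
([1,8],[],[[1,2],[1,14]]),
([2,7],[],[[2,1],[2,13]]),
([6,3],[],[[2,1],[10,5]]),
([8,1],[],[[2,1],[14,1]]),
([11,3],[],[[5,3],[17,3]]),
([11,6],[],[[5,12],[17,0]]),
([11,9],[],[[5,15],[17,3]]),
([11,1],[],[[1,1],[5,1],[19,1],[19,1]]),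
([5,4],[],[[17,0],[17,0],[17,0],[5,10],[5,10],[5,10],[5,10],[5,10],[1,2],[1,2],[1,2],[1,2],[1,2],[1,2],[1,2],[1,2],[1,2]]),
([11,4],[[5,4]],[[5,12],[17,0],[17,0]])] []" by code_simp
  show "certified (word ''abbaabbabaabbabaababba'') (word ''abbaabbababababaababba'')
[([11],[],[[7],[15]]),
([10],[],[[6],[14]]),
([0,9],[],[[0,5],[0,13]]),
([3,6],[],[[3,2],[3,10]]),
([4,5],[],[[4,1],[4,9]]),
([7,2],[],[[7,0],[7,4]]),
([11,2],[],[[7,0],[15,4]]),
([11,5],[],[[7,9],[15,1]]),
([11,7],[],[[7,11],[15,3]]),
([11,8],[],[[7,12],[15,4]]),
([9,0],[],[[7,0],[7,0],[13,0]]),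
([11,0],[],[[7,0],[13,0],[13,0]]),
([0,10],[],[[0,6],[0,14]]),
([3,7],[],[[3,3],[3,11]]),
([4,6],[],[[4,2],[4,10]]),
([7,3],[],[[7,1],[7,5]]),
([11,3],[],[[7,1],[15,5]]),
([11,4],[],[[7,8],[15,0]]),
([11,6],[],[[7,10],[15,2]]),
([11,9],[],[[7,13],[15,5]]),
([9,1],[],[[7,1],[7,1],[13,1]]),
([11,1],[],[[7,1],[13,1],[13,1]]),
([1,8],[],[[1,4],[1,12]]),
([2,7],[],[[2,3],[2,11]]),
([5,4],[],[[5,0],[5,8]]),
([6,3],[],[[6,1],[6,5]]),
([10,3],[],[[6,1],[14,5]]),
([10,6],[],[[6,10],[14,2]]),
([10,8],[],[[6,12],[14,4]]),
([10,9],[],[[6,13],[14,5]]),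
([8,1],[],[[6,1],[6,1],[12,1]]),
([10,1],[],[[6,1],[12,1],[12,1]]),
([1,9],[],[[1,5],[1,13]]),
([2,8],[],[[2,4],[2,12]]),
([5,5],[],[[5,1],[5,9]]),
([6,4],[],[[6,0],[6,8]]),
([8,2],[],[[2,4],[14,0]]),
([10,0],[],[[6,0],[14,0]]),
([10,2],[],[[8,4],[12,0]]),
([10,4],[],[[6,2],[14,6]]),
([10,5],[],[[6,9],[14,1]]),
([10,7],[],[[6,11],[14,3]]),
([10,10],[],[[6,14],[14,6]])] []" by code_simp
qed (simp_all add: word_def)

section \<open>Classification of the binary identities of length 22\<close>

definition ten_words :: "(bool list \<times> bool list) list" where
  "ten_words = [(word ''abbaabbaabbaababbbbaba'', word ''abbaabbababaababbbbaba''),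
    (word ''abbabaabababbabaababba'', word ''abbabaababbababaababba''),
    (word ''ababbabaababbaababbaba'', word ''ababbabaabbabaababbaba''),
    (word ''abbabaabababababbabaab'', word ''abbabaababbaababbabaab''),
    (word ''ababbabaababababbabaab'', word ''ababbabaabbaababbabaab''),
    (word ''abbaabbabaabbaababbaba'', word ''abbaabbabababaababbaba''),
    (word ''abbaabbabaabbabaabbaab'', word ''abbaabbababababaabbaab''),
    (word ''ababbabaabababbabaabab'', word ''ababbabaabbaabbabaabab''),
    (word ''ababbabaababbabaababba'', word ''ababbabaabbababaababba''),
    (word ''abbaabbabaabbabaababba'', word ''abbaabbababababaababba'')]"

definition symmetries :: "(bool list \<Rightarrow> bool list) list" where
  "symmetries = [\<lambda>w. w, map Not, rev, \<lambda>w. map Not (rev w)]"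

definition orbit :: "bool list \<times> bool list \<Rightarrow> (bool list \<times> bool list) list" where
  "orbit p = concat (map (\<lambda>g. [(g (fst p), g (snd p)), (g (snd p), g (fst p))]) symmetries)"

definition orbits :: "(bool list \<times> bool list) list" where "orbits = concat (map orbit ten_words)"

lemma orbit_iff: "(w, v) \<in> set (orbit (x, y)) \<longleftrightarrow>
    (\<exists>g\<in>set symmetries. w = g x \<and> v = g y \<or> w = g y \<and> v = g x)"
  by (auto simp: orbit_def)

lemma orbits_iff: "(w, v) \<in> set orbits \<longleftrightarrow> (\<exists>p\<in>set ten_words. (w, v) \<in> set (orbit p))"
  by (auto simp: orbits_def)

lemma map_Not_Not [simp]: "map Not (map Not w) = w"
  by (induction w) auto

lemma map_Not_comp [simp]: "map (Not \<circ> Not) w = w"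
  by (induction w) auto

lemma orbits_closed:
  assumes "(w, v) \<in> set orbits"
  shows "(v, w) \<in> set orbits" "(map Not w, map Not v) \<in> set orbits" "(rev w, rev v) \<in> set orbits"
proof -
  obtain x y where p: "(x, y) \<in> set ten_words" "(w, v) \<in> set (orbit (x, y))" using assms by (auto simp: orbits_iff)
  then have "(v, w) \<in> set (orbit (x, y)) \<and> (map Not w, map Not v) \<in> set (orbit (x, y)) \<and> (rev w, rev v) \<in> set (orbit (x, y))"
    unfolding orbit_iff symmetries_def by (simp add: rev_map) (elim disjE; simp add: rev_map)
  then show "(v, w) \<in> set orbits" "(map Not w, map Not v) \<in> set orbits" "(rev w, rev v) \<in> set orbits"
    using p(1) by (auto simp: orbits_iff)
qed

lemma sols_in_orbits: "list_all (\<lambda>p. p \<in> set orbits) sols"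
  by code_simp

lemma check_8: "checks 7 6 12 11 [False]"
proof -
  have "checks (Suc 6) 6 12 11 [False]" using check_8_aa check_8_ab by (simp only: checks.simps append.simps)
  then show ?thesis by simp
qed

lemma check_9: "checks 8 4 11 10 [False]"
proof -
  have "checks (Suc 6) 4 11 10 [False, True]" using check_9_aba check_9_abb by (simp only: checks.simps append.simps)
  then have "checks 7 4 11 10 [False, True]" by simp
  then have "checks (Suc 7) 4 11 10 [False]" using check_9_aa by (simp only: checks.simps append.simps)
  then show ?thesis by simp
qed

lemma check_10: "checks 9 2 10 9 [False]"
proof -
  have "checks (Suc 7) 2 10 9 [False, False]" using check_10_aaa check_10_aab by (simp only: checks.simps append.simps)
  then have aa: "checks 8 2 10 9 [False, False]" by simp
  have "checks (Suc 6) 2 10 9 [False, True, False]" using check_10_abaa check_10_abab by (simp only: checks.simps append.simps)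
  then have aba: "checks 7 2 10 9 [False, True, False]" by simp
  have "checks (Suc 6) 2 10 9 [False, True, True]" using check_10_abba check_10_abbb by (simp only: checks.simps append.simps)
  then have abb: "checks 7 2 10 9 [False, True, True]" by simp
  have "checks (Suc 7) 2 10 9 [False, True]" using aba abb by (simp only: checks.simps append.simps)
  then have "checks 8 2 10 9 [False, True]" by simp
  then have "checks (Suc 8) 2 10 9 [False]" using aa by (simp only: checks.simps append.simps)
  then show ?thesis by simp
qed

lemma all_prefixes:
  assumes "length p \<le> 10" "p = [] \<or> hd p = False"
  shows "check_prefix dirsP dirsT (leaf p (22 - 2 * length p)) (20 - length p) (int (20 - length p) - 1) p"
proof (cases p)
  case Nil
  then show ?thesis using check_0 by simp
next
  case (Cons t r)
  have c: "check_prefix dirsP dirsT (leaf p m) n q p" if "checks k m n q [False]" "length r = k" for k m n q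
    using checks_sound[OF that] Cons assms(2) by simp
  have "length r \<le> 9" using assms(1) Cons by simp
  then have "length r = 0 \<or> length r = 1 \<or> length r = 2 \<or> length r = 3 \<or> length r = 4 \<or> length r = 5 \<or> length r = 6 \<or>
      length r = 7 \<or> length r = 8 \<or> length r = 9" by presburger
  then show ?thesis
    using c[OF check_1_a] c[OF check_2_a] c[OF check_3_a] c[OF check_4_a] c[OF check_5_a] c[OF check_6_a] c[OF check_7_a]
      c[OF check_8] c[OF check_9] c[OF check_10]
    unfolding Cons by (elim disjE) simp_all
qed

lemma replicate_split: "\<exists>i x. y = replicate i False @ x \<and> (x = [] \<or> hd x)"
proof (induction y)
  case (Cons t y)
  then obtain i x where y: "y = replicate i False @ x" "x = [] \<or> hd x" by blast
  show ?case
  proof (cases t)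
    case True
    then show ?thesis by (intro exI[of _ 0] exI[of _ "t # y"]) simp
  next
    case False
    then show ?thesis using y by (intro exI[of _ "Suc i"] exI[of _ x]) simp
  qed
qed (intro exI[of _ 0] exI[of _ "[]"], simp)

lemma lower_word:
  assumes i: "ident w v" and w: "w = p @ False # x" and v: "v = p @ True # y" and l: "length w = 22"
    and p: "length p \<le> 10" "p = [] \<or> hd p = False" and d: "drop (22 - length p) w = drop (22 - length p) v"
  shows "(w, v) \<in> set orbits"
proof -
  have "nb x = nb y + 1" using ident_na_nb(2)[OF i] w v by simp
  then have "x \<noteq> replicate j False" for j using nb_nonneg[of y] by (auto simp: nb_def)
  then obtain j x' where x: "x = replicate j False @ True # x'"
    using replicate_split[of x] by (metis append_Nil2 list.collapse)
  have "(w, v) \<in> set sols"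
  proof (rule prefix_classified)
    show "check_prefix dirsP dirsT (leaf p (22 - 2 * length p)) (20 - length p) (int (20 - length p) - 1) p"
      using all_prefixes p by blast
    show "length p + (20 - length p) + 2 = length w" "0 < 22 - 2 * length p" using p l by simp_all
    show "w = p @ replicate (Suc j) False @ True # x'" using w x by simp
    show "v = p @ True # y" by (rule v)
    show "equiv3 w v" using i by (rule ident_equiv3)
    have "length p + (22 - 2 * length p) = 22 - length p" using p by simp
    then show "drop (length p + (22 - 2 * length p)) w = drop (length p + (22 - 2 * length p)) v" using d by simp
  qed simp
  then show ?thesis using sols_in_orbits by (auto simp: list_all_iff)
qed

lemma early_difference:
  assumes i: "ident w v" and w: "w = p @ s # x" and v: "v = p @ t # y" and st: "s \<noteq> t" and l: "length w = 22"
    and p: "length p \<le> 10" and d: "drop (22 - length p) w = drop (22 - length p) v"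
  shows "(w, v) \<in> set orbits"
proof -
  have 1: "(w, v) \<in> set orbits" if "ident w v" "w = p @ s # x" "v = p @ t # y" "s \<noteq> t" "length w = 22"
    "drop (22 - length p) w = drop (22 - length p) v" "p = [] \<or> hd p = False" "length p \<le> 10" for w v p s t x y
  proof (cases s)
    case False
    then show ?thesis using lower_word[of w v p x y] that by simp
  next
    case True
    have "length v = 22" using that(5) eq2_length ident_equiv3[OF that(1)] by (fastforce simp: equiv3_def)
    then have "(v, w) \<in> set orbits" using lower_word[of v w p y x] that ident_sym True by simp
    then show ?thesis by (rule orbits_closed)
  qed
  show ?thesis
  proof (cases "p = [] \<or> hd p = False")
    case True
    show ?thesis by (rule 1[OF i w v st l d True p])
  next
    case False
    then have "map Not p = [] \<or> hd (map Not p) = False" by (cases p) auto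
    moreover have "drop (22 - length (map Not p)) (map Not w) = drop (22 - length (map Not p)) (map Not v)"
      by (simp only: drop_map length_map d)
    ultimately have "(map Not w, map Not v) \<in> set orbits"
      using 1[of "map Not w" "map Not v" "map Not p" "\<not> s" "map Not x" "\<not> t" "map Not y"] ident_map[OF i, of Not] w v st l p
      by simp
    then have "(map Not (map Not w), map Not (map Not v)) \<in> set orbits" by (rule orbits_closed)
    then show ?thesis by (simp only: map_Not_Not)
  qed
qed

lemma drop_end: "w = a @ s # q \<Longrightarrow> length w = 22 \<Longrightarrow> k \<le> length q \<Longrightarrow> drop (22 - k) w = drop (length q - k) q"
proof -
  assume w: "w = a @ s # q" and l: "length w = 22" and k: "k \<le> length q"
  have "22 - k = length (a @ [s]) + (length q - k)" using w l k by simp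
  then have "drop (22 - k) w = drop (length (a @ [s]) + (length q - k)) ((a @ [s]) @ q)" using w by simp
  then show ?thesis by (simp only: drop_append) simp
qed

theorem classification_22:
  assumes i: "ident w v" and ne: "w \<noteq> v" and l: "length w = 22"
  shows "(w, v) \<in> set orbits"
proof -
  have lv: "length v = 22" using l eq2_length ident_equiv3[OF i] by (fastforce simp: equiv3_def)
  have diff: "\<exists>p s x t y. w = p @ s # x \<and> v = p @ t # y \<and> s \<noteq> t" if "w \<noteq> v" "length w = length v" for w v :: "bool list"
    using that
  proof (induction w v rule: list_induct2')
    case (4 a w b v)
    show ?case
    proof (cases "a = b")
      case True
      then have "w \<noteq> v" "length w = length v" using 4 by auto
      then obtain p s x t y where "w = p @ s # x" "v = p @ t # y" "s \<noteq> t" using 4(1) by blast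
      then have "a # w = (b # p) @ s # x \<and> b # v = (b # p) @ t # y \<and> s \<noteq> t" using True by simp
      then show ?thesis by blast
    next
      case False
      then have "a # w = [] @ a # w \<and> b # v = [] @ b # v \<and> a \<noteq> b" by simp
      then show ?thesis by blast
    qed
  qed auto
  obtain p s x t y where 1: "w = p @ s # x" "v = p @ t # y" "s \<noteq> t" using diff[OF ne] l lv by auto
  have "rev w \<noteq> rev v" "length (rev w) = length (rev v)" using ne l lv by auto
  then obtain q s' x' t' y' where 2: "rev w = q @ s' # x'" "rev v = q @ t' # y'" "s' \<noteq> t'" using diff by metis
  have w2: "w = rev x' @ s' # rev q" "v = rev y' @ t' # rev q" using arg_cong[OF 2(1), of rev] arg_cong[OF 2(2), of rev] by auto
  have le: "length p + length q \<le> 21"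
  proof (rule ccontr)
    assume "\<not> length p + length q \<le> 21"
    then have a: "length x < length q" "length y < length q" using l lv 1 by auto
    have "length x = length y" using 1 l lv by simp
    have "(rev x @ [s]) @ rev p = q @ s' # x'" "(rev y @ [t]) @ rev p = q @ t' # y'" using 1 2 by auto
    then have "take (Suc (length x)) (q @ s' # x') = rev x @ [s]" "take (Suc (length y)) (q @ t' # y') = rev y @ [t]"
      by (metis length_append_singleton length_rev append_eq_conv_conj)+
    then have "take (Suc (length x)) q = rev x @ [s]" "take (Suc (length y)) q = rev y @ [t]" using a by simp_all
    then show False using 1(3) \<open>length x = length y\<close> by simp
  qed
  show ?thesis
  proof (cases "length p \<le> length q")
    case True
    have "drop (22 - length p) w = drop (22 - length p) v"
      using drop_end[OF w2(1) l] drop_end[OF w2(2) lv] True by simp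
    then show ?thesis using early_difference[OF i 1 l] True le by simp
  next
    case False
    have e: "rev w = rev x @ s # rev p" "rev v = rev y @ t # rev p" using 1 by simp_all
    have "drop (22 - length q) (rev w) = drop (length (rev p) - length q) (rev p)"
      by (rule drop_end[OF e(1)]) (use False l in simp_all)
    moreover have "drop (22 - length q) (rev v) = drop (length (rev p) - length q) (rev p)"
      by (rule drop_end[OF e(2)]) (use False lv in simp_all)
    ultimately have "drop (22 - length q) (rev w) = drop (22 - length q) (rev v)" by simp
    then have "(rev w, rev v) \<in> set orbits"
      using early_difference[OF ident_rev[OF i] 2] l False le by simp
    then have "(rev (rev w), rev (rev v)) \<in> set orbits" by (rule orbits_closed)
    then show ?thesis by simp
  qed
qed

section \<open>No shorter identities\<close>

primrec binary :: "bool list \<Rightarrow> int" where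
  "binary [] = 0" | "binary (t # w) = 2 * binary w + pick t 1 0"

lemma last_letter_check:
  "list_all (\<lambda>(k, t). list_all (\<lambda>(k', t'). k = k' \<longrightarrow> t = t') (map (\<lambda>p. (binary (butlast (fst p)), last (fst p))) orbits))
     (map (\<lambda>p. (binary (butlast (fst p)), last (fst p))) orbits)"
  by code_simp

lemma ident_length: "ident w v \<Longrightarrow> length w = length v"
  using eq2_length ident_equiv3 by (auto simp: equiv3_def)

theorem no_shorter:
  assumes i: "ident w v" and ne: "w \<noteq> v"
  shows "22 \<le> length w"
proof (rule ccontr)
  assume s: "\<not> 22 \<le> length w"
  let ?u = "replicate (21 - length w) True"
  have o: "(w @ ?u @ [t], v @ ?u @ [t]) \<in> set orbits" for t
    using classification_22[OF ident_append[OF i, of "?u @ [t]"]] ne s by simp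
  let ?k = "\<lambda>p. (binary (butlast (fst p)), last (fst p))"
  have "?k (w @ ?u @ [t], v @ ?u @ [t]) \<in> set (map ?k orbits)" for t using o[of t] by (simp only: set_map image_eqI)
  then have k: "(binary (w @ ?u), t) \<in> set (map ?k orbits)" for t by (simp add: butlast_append)
  show False using last_letter_check k[of True] k[of False] unfolding list_all_iff by blast
qed

lemma orbits_ident: "(w, v) \<in> set orbits \<Longrightarrow> ident w v \<and> w \<noteq> v \<and> length w = 22 \<and> length v = 22"
proof -
  assume "(w, v) \<in> set orbits"
  then obtain x y g where p: "(x, y) \<in> set ten_words" and g: "g \<in> set symmetries" and
    wv: "w = g x \<and> v = g y \<or> w = g y \<and> v = g x" unfolding orbits_iff by (metis orbit_iff surj_pair)
  have t: "ident x y"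
    using p ident_1 ident_2 ident_3 ident_4 ident_5 ident_6 ident_7 ident_8 ident_9 ident_10 unfolding ten_words_def by auto
  have n: "x \<noteq> y \<and> length x = 22 \<and> length y = 22" using p unfolding ten_words_def by (auto simp: word_def)
  have "ident (g x) (g y)" using g t ident_map[of _ _ Not] ident_rev by (auto simp: symmetries_def)
  moreover have "g x \<noteq> g y \<and> length (g x) = 22 \<and> length (g y) = 22"
  proof -
    have "inj (map Not)" by (metis injI map_Not_Not)
    then show ?thesis using g n by (auto simp: symmetries_def inj_eq)
  qed
  ultimately show ?thesis using wv ident_sym by auto
qed

section \<open>Words over an arbitrary alphabet\<close>

definition unword :: "bool list \<Rightarrow> string" where "unword w = map (\<lambda>t. if t then CHR ''b'' else CHR ''a'') w"

definition identity :: "bool list \<Rightarrow> bool list \<Rightarrow> string set" where "identity w v = {unword w, unword v}"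

lemma word_unword [simp]: "word (unword w) = w"
  by (induction w) (auto simp: word_def unword_def)

lemma unword_word: "s \<in> lists AB \<Longrightarrow> unword (word s) = s"
  by (induction s) (auto simp: word_def unword_def AB_def)

lemma unword_lists: "unword w \<in> lists AB"
  by (auto simp: unword_def AB_def)

lemma unword_inj [simp]: "unword w = unword v \<longleftrightarrow> w = v"
  by (metis word_unword)

lemma length_unword [simp]: "length (unword w) = length w"
  by (simp add: unword_def)

lemma sim_AB: "sim AB 3 (unword w) (unword v) \<longleftrightarrow> w \<noteq> [] \<and> v \<noteq> [] \<and> ident w v"
proof
  assume s: "sim AB 3 (unword w) (unword v)"
  have "List.map_filter (\<lambda>c. Some (c = CHR ''b'')) z = word z" for z by (induction z) (auto simp: word_def List.map_filter_simps)
  then have "ident w v" using sim_ident_project[OF s, of "\<lambda>c. Some (c = CHR ''b'')"] by simp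
  moreover have "w \<noteq> []" "v \<noteq> []" using s by (auto simp: sim_def free_semigroup_def unword_def)
  ultimately show "w \<noteq> [] \<and> v \<noteq> [] \<and> ident w v" by simp
next
  assume r: "w \<noteq> [] \<and> v \<noteq> [] \<and> ident w v"
  have "matprod f (unword w) = matprod f (unword v)" if "\<forall>t\<in>AB. f t \<in> UT 3" for f
    using that r unfolding ident_def unword_def matprod_map by (simp add: AB_def)
  moreover have "unword w \<in> free_semigroup AB" "unword v \<in> free_semigroup AB"
    using r unword_lists by (auto simp: free_semigroup_def unword_def)
  ultimately show "sim AB 3 (unword w) (unword v)" unfolding sim_iff_matprod by blast
qed

lemma nontrivial_AB: "nontrivial_identities AB 3 = {identity w v | w v. w \<noteq> [] \<and> v \<noteq> [] \<and> ident w v \<and> w \<noteq> v}" (is "?L = ?R")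
proof
  show "?L \<subseteq> ?R"
  proof
    fix P assume "P \<in> ?L"
    then obtain s r where P: "P = {s, r}" "sim AB 3 s r" "s \<noteq> r" by (auto simp: nontrivial_identities_def)
    then have "s \<in> lists AB" "r \<in> lists AB" by (auto simp: sim_def free_semigroup_def)
    then have "s = unword (word s)" "r = unword (word r)" using unword_word by simp_all
    then have "P = identity (word s) (word r)" "sim AB 3 (unword (word s)) (unword (word r))" "word s \<noteq> word r"
      using P by (auto simp: identity_def)
    then show "P \<in> ?R" unfolding sim_AB by blast
  qed
  show "?R \<subseteq> ?L"
  proof
    fix P assume "P \<in> ?R"
    then obtain w v where P: "P = {unword w, unword v}" "sim AB 3 (unword w) (unword v)" "unword w \<noteq> unword v"
      unfolding identity_def sim_AB unword_inj by blast
    then show "P \<in> ?L" unfolding nontrivial_identities_def by blast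
  qed
qed

lemma identity_length: "ident w v \<Longrightarrow> has_length (identity w v) l \<longleftrightarrow> length w = l"
  using ident_length by (auto simp: has_length_def identity_def)

lemma sim_length:
  assumes "sim \<Sigma> 3 w v"
  shows "length w = length v"
proof -
  have c: "count_list w x = count_list v x" for x
  proof -
    have "nb (List.map_filter (\<lambda>c. if c = x then Some True else None) z) = int (count_list z x)" for z
      by (induction z) (auto simp: List.map_filter_simps)
    then show ?thesis using ident_na_nb(2)[OF sim_ident_project[OF assms, of "\<lambda>c. if c = x then Some True else None"]] by simp
  qed
  have "mset w = mset v" using c by (simp add: multiset_eq_iff count_mset)
  then show ?thesis by (rule mset_eq_length)
qed

lemma projection:
  assumes s: "sim \<Sigma> 3 w v" and ne: "w \<noteq> v"
  obtains x y where "x \<noteq> y" "\<And>h. h x = Some False \<Longrightarrow> h y = Some True \<Longrightarrow> List.map_filter h w \<noteq> List.map_filter h v"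
proof -
  have "\<exists>p x y w' v'. w = p @ x # w' \<and> v = p @ y # v' \<and> x \<noteq> y" using ne sim_length[OF s]
  proof (induction w v rule: list_induct2')
    case (4 a w b v)
    show ?case
    proof (cases "a = b")
      case True
      then have "w \<noteq> v" "length w = length v" using 4 by auto
      then obtain p x y w' v' where "w = p @ x # w'" "v = p @ y # v'" "x \<noteq> y" using 4(1) by blast
      then have "a # w = (b # p) @ x # w' \<and> b # v = (b # p) @ y # v' \<and> x \<noteq> y" using True by simp
      then show ?thesis by blast
    next
      case False
      then have "a # w = [] @ a # w \<and> b # v = [] @ b # v \<and> a \<noteq> b" by simp
      then show ?thesis by blast
    qed
  qed auto
  then obtain p x y w' v' where 1: "w = p @ x # w'" "v = p @ y # v'" "x \<noteq> y" by blast
  have app: "List.map_filter h (z @ z') = List.map_filter h z @ List.map_filter h z'" for h :: "'a \<Rightarrow> bool option" and z z'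
    by (induction z) (auto simp: List.map_filter_simps split: option.splits)
  show thesis by (rule that[of x y]) (use 1 in \<open>auto simp: app List.map_filter_simps\<close>)
qed

lemma map_filter_length:
  "length (List.map_filter h w) \<le> length w"
  "length (List.map_filter h w) = length w \<Longrightarrow> c \<in> set w \<Longrightarrow> h c \<noteq> None"
proof -
  show l: "length (List.map_filter h w) \<le> length w" for w
    by (induction w) (auto simp: List.map_filter_simps split: option.splits)
  show "length (List.map_filter h w) = length w \<Longrightarrow> c \<in> set w \<Longrightarrow> h c \<noteq> None"
  proof (induction w)
    case (Cons d w)
    then show ?case using l[of w] by (auto simp: List.map_filter_simps split: option.splits)
  qed simp
qed

theorem over_alphabet:
  assumes s: "sim \<Sigma> 3 w v" and ne: "w \<noteq> v"
  shows "22 \<le> length w"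
    and "length w = 22 \<Longrightarrow> \<exists>x y f. (x, y) \<in> set orbits \<and> inj_on f AB \<and> {w, v} = map f ` identity x y"
proof -
  obtain c d where cd: "c \<noteq> d" "\<And>h. h c = Some False \<Longrightarrow> h d = Some True \<Longrightarrow> List.map_filter h w \<noteq> List.map_filter h v"
    using projection[OF s ne] by metis
  define h where "h z = (if z = c then Some False else if z = d then Some True else None)" for z
  let ?w = "List.map_filter h w" and ?v = "List.map_filter h v"
  have n: "?w \<noteq> ?v" by (rule cd(2)) (use cd(1) in \<open>auto simp: h_def\<close>)
  have i: "ident ?w ?v" by (rule sim_ident_project[OF s])
  have l: "22 \<le> length ?w" by (rule no_shorter[OF i n])
  then show "22 \<le> length w" using map_filter_length(1)[of h w] by linarith
  assume w22: "length w = 22"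
  then have eq: "length ?w = length w" "length ?v = length v"
    using l map_filter_length(1)[of h w] ident_length[OF i] sim_length[OF s] by simp_all
  define f where "f z = (if z = CHR ''b'' then d else c)" for z
  have undo: "map f (unword (List.map_filter h z)) = z" if "\<forall>x\<in>set z. h x \<noteq> None" for z
    using that
  proof (induction z)
    case (Cons a z)
    then show ?case by (auto simp: List.map_filter_simps unword_def h_def f_def split: if_splits)
  qed (simp add: List.map_filter_simps unword_def)
  have "map f (unword ?w) = w" "map f (unword ?v) = v"
    using undo map_filter_length(2)[OF eq(1)] map_filter_length(2)[OF eq(2)] by blast+
  moreover have "(?w, ?v) \<in> set orbits" by (rule classification_22[OF i n]) (simp add: eq w22)
  moreover have "inj_on f AB" using cd(1) by (auto simp: f_def AB_def)
  ultimately show "\<exists>x y f. (x, y) \<in> set orbits \<and> inj_on f AB \<and> {w, v} = map f ` identity x y"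
    unfolding identity_def by (intro exI[of _ ?w] exI[of _ ?v] exI[of _ f]) simp
qed

section \<open>The ten identities up to symmetry\<close>

lemma ten_identities_eq: "ten_identities = map (\<lambda>p. identity (fst p) (snd p)) ten_words"
  by (simp add: ten_identities_def ten_words_def identity_def word_def unword_def)

lemma exchange_identity: "exchange (identity w v) = identity (map Not w) (map Not v)"
proof -
  have "id(CHR ''a'' := CHR ''b'', CHR ''b'' := CHR ''a'') \<circ> (\<lambda>t. if t then CHR ''b'' else CHR ''a'') =
      (\<lambda>t. if t then CHR ''b'' else CHR ''a'') \<circ> Not" by (auto simp: fun_eq_iff)
  then show ?thesis by (simp add: exchange_def identity_def unword_def)
qed

lemma reversal_identity: "reversal (identity w v) = identity (rev w) (rev v)"
  by (simp add: reversal_def identity_def unword_def rev_map)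

lemma same_up_to_symmetry_iff:
  "same_up_to_symmetry P (identity x y) \<longleftrightarrow> (\<exists>g\<in>set symmetries. P = identity (g x) (g y))"
  by (auto simp: same_up_to_symmetry_def symmetries_def exchange_identity reversal_identity)

lemma identity_eq_iff: "identity w v = identity x y \<longleftrightarrow> w = x \<and> v = y \<or> w = y \<and> v = x"
  by (auto simp: identity_def doubleton_eq_iff)

lemma same_orbit: "same_up_to_symmetry (identity w v) (identity x y) \<longleftrightarrow> (w, v) \<in> set (orbit (x, y))"
  by (simp add: same_up_to_symmetry_iff orbit_iff identity_eq_iff)

lemma orbits_eq: "{P. \<exists>Q\<in>set ten_identities. same_up_to_symmetry P Q} = {identity w v | w v. (w, v) \<in> set orbits}"
  (is "?L = ?R")
proof
  show "?L \<subseteq> ?R"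
  proof
    fix P assume "P \<in> ?L"
    then obtain x y where p: "(x, y) \<in> set ten_words" "same_up_to_symmetry P (identity x y)"
      by (auto simp: ten_identities_eq)
    then obtain g where "g \<in> set symmetries" "P = identity (g x) (g y)" unfolding same_up_to_symmetry_iff by blast
    moreover from this have "(g x, g y) \<in> set orbits" using p(1) orbit_iff orbits_iff by blast
    ultimately show "P \<in> ?R" by blast
  qed
  show "?R \<subseteq> ?L"
  proof
    fix P assume "P \<in> ?R"
    then obtain w v where P: "P = identity w v" "(w, v) \<in> set orbits" by blast
    then obtain x y where p: "(x, y) \<in> set ten_words" "(w, v) \<in> set (orbit (x, y))" unfolding orbits_iff by (metis surj_pair)
    then have "same_up_to_symmetry P (identity x y)" using same_orbit P by simp
    then show "P \<in> ?L" using p(1) by (force simp: ten_identities_eq)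
  qed
qed

definition apart :: "(bool list \<times> bool list) list \<Rightarrow> bool" where
  "apart ps = list_all (\<lambda>i. list_all (\<lambda>j. i = j \<or> ps ! i \<notin> set (orbit (ps ! j))) [0..<length ps]) [0..<length ps]"

lemma ten_words_apart: "apart ten_words"
  by code_simp

lemma shortest_AB: "shortest_identities AB 3 = {identity w v | w v. (w, v) \<in> set orbits}" (is "?L = ?R")
proof
  have low: "22 \<le> k" if Q: "Q \<in> nontrivial_identities AB 3" "has_length Q k" for Q k
    using that no_shorter by (auto simp: nontrivial_AB identity_length)
  have mem: "identity w v \<in> nontrivial_identities AB 3 \<and> has_length (identity w v) 22" if "(w, v) \<in> set orbits" for w v
    using orbits_ident[OF that] identity_length unfolding nontrivial_AB by fastforce
  show "?R \<subseteq> ?L" using mem low unfolding shortest_identities_def by blast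
  show "?L \<subseteq> ?R"
  proof
    fix P assume P: "P \<in> ?L"
    obtain l where l: "has_length P l" "\<And>Q k. Q \<in> nontrivial_identities AB 3 \<Longrightarrow> has_length Q k \<Longrightarrow> l \<le> k"
      and n: "P \<in> nontrivial_identities AB 3" using P by (auto simp: shortest_identities_def)
    have "orbits \<noteq> []" by (simp add: orbits_def ten_words_def orbit_def symmetries_def)
    then obtain x y where "(x, y) \<in> set orbits" by (metis hd_in_set surj_pair)
    then have "l \<le> 22" using mem l(2) by blast
    then have l22: "l = 22" using low[OF n l(1)] by simp
    obtain w v where wv: "P = identity w v" "ident w v" "w \<noteq> v" using n unfolding nontrivial_AB by blast
    then have "(w, v) \<in> set orbits" using classification_22 l(1) l22 identity_length by blast
    then show "P \<in> ?R" using wv(1) by blast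
  qed
qed

theorem theorem1p3:
  fixes \<Sigma> :: "'c set"
  assumes "finite \<Sigma>"
  shows "(\<forall>P\<in>nontrivial_identities \<Sigma> 3. \<exists>l\<ge>22. has_length P l) \<and>
    (\<forall>P\<in>nontrivial_identities \<Sigma> 3. has_length P 22 \<longrightarrow>
       (\<exists>Q\<in>shortest_identities AB 3. \<exists>f. inj_on f AB \<and> P = map f ` Q)) \<and>
    (\<forall>P\<in>shortest_identities AB 3. has_length P 22) \<and>
    shortest_identities AB 3 =
      {P. \<exists>Q\<in>set ten_identities. same_up_to_symmetry P Q} \<and>
    (\<forall>i<10. \<forall>j<10. same_up_to_symmetry (ten_identities ! i) (ten_identities ! j) \<longrightarrow> i = j)"
proof (intro conjI ballI allI impI)
  fix P assume "P \<in> nontrivial_identities \<Sigma> 3"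
  then obtain w v where P: "P = {w, v}" "sim \<Sigma> 3 w v" "w \<noteq> v" by (auto simp: nontrivial_identities_def)
  have "has_length P (length w)" using P(1) sim_length[OF P(2)] by (simp add: has_length_def)
  then show "\<exists>l\<ge>22. has_length P l" using over_alphabet(1)[OF P(2,3)] by blast
  assume "has_length P 22"
  then have "length w = 22" using P(1) by (simp add: has_length_def)
  then obtain x y f where "(x, y) \<in> set orbits" "inj_on f AB" "P = map f ` identity x y"
    using over_alphabet(2)[OF P(2,3)] P(1) by blast
  then show "\<exists>Q\<in>shortest_identities AB 3. \<exists>f. inj_on f AB \<and> P = map f ` Q" unfolding shortest_AB by blast
next
  fix P assume "P \<in> shortest_identities AB 3"
  then show "has_length P 22" using orbits_ident identity_length unfolding shortest_AB by blast
next
  show "shortest_identities AB 3 = {P. \<exists>Q\<in>set ten_identities. same_up_to_symmetry P Q}"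
    unfolding shortest_AB orbits_eq ..
next
  fix i j :: nat assume ij: "i < 10" "j < 10" and s: "same_up_to_symmetry (ten_identities ! i) (ten_identities ! j)"
  have l: "length ten_words = 10" by (simp add: ten_words_def)
  then have "ten_words ! i \<in> set (orbit (ten_words ! j))"
    using s ij same_orbit by (simp add: ten_identities_eq)
  moreover have "\<forall>i\<in>{0..<10}. \<forall>j\<in>{0..<10}. i = j \<or> ten_words ! i \<notin> set (orbit (ten_words ! j))"
    using ten_words_apart by (simp only: apart_def l list_all_iff set_upt)
  ultimately show "i = j" using ij by (metis atLeastLessThan_iff zero_le)
qed

end
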